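(* Let $x: M^n \to \mathbb{R}^{n+1}$ be a closed orientable hypersurface (an isometric immersion), with globally defined unit normal vector field $N$, whose support function $\rho = \langle x, N\rangle$ is non-negative, and let $r \in \{0,\dots,n\}$ be such that the operator $P_r$ is positive definite. Then the mean curvature $H_1$ satisfies the equation $L_r u = 1 + H_1\rho$ (that is, $L_r(H_1) = 1 + H_1 \rho$ on $M$) if and only if $M$ is isometric to a round sphere.
   Context: $x: M^n \to \mathbb{R}^{n+1}$ is a (smooth) isometric immersion of an orientable $n$-dimensional Riemannian manifold; "closed" means compact with empty boundary. The immersion is not assumed to be an embedding. $N$ is a unit normal vector field globally defined on $M$, and $A$ is the second fundamental form (shape operator) with respect to $N$, with the sign convention $A(X) = -D_X N$, where $D$ is the flat connection of $\mathbb{R}^{n+1}$. For $r = 1,\dots,n$, $S_r$ is the $r$-th elementary symmetric function of the eigenvalues of $A$, $S_0 = 1$, and the $r$-mean curvature is $H_r = \binom{n}{r}^{-1} S_r$; in particular $H_1 = \frac1n \mathrm{tr}\,A$. The Newton transformations are defined recursively by $P_0 = I$ and $P_r = S_r I - A P_{r-1}$ for $1 \le r \le n$; $P_r$ is a self-adjoint endomorphism of the tangent spaces of $M$, and positive definite means positive definite at every point of $M$. For a smooth function $u$ on $M$, $L_r(u) = \mathrm{tr}(P_r \nabla^2 u)$, where $\nabla^2 u$ is the Hessian operator of $u$. The support function is $\rho: M \to \mathbb{R}$, $\rho = \langle x, N \rangle$ (position vector relative to the origin of $\mathbb{R}^{n+1}$).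
   Formalization: Formalized for n ≥ 2 and connected M, and with the right-hand side "M is isometric to a round sphere and, if x(M) is a round sphere, its centre is the origin"; the "if" part fails for spheres not centred at the origin and for n = 1 (e.g. an ellipse). *)

theory Defs
  imports "HOL-Analysis.Analysis"
begin

section \<open>Smooth maps and smooth manifolds\<close>

text \<open>\<open>Ck_on k S f\<close> is intended for open \<open>S\<close>: all iterated directional derivatives of order at
  most \<open>k\<close> exist and are continuous, and those of order less than \<open>k\<close> are Frechet differentiable.\<close>

primrec Ck_on ::
  "nat \<Rightarrow> 'e::euclidean_space set \<Rightarrow> ('e \<Rightarrow> 'b::real_normed_vector) \<Rightarrow> bool"
where
  "Ck_on 0 S f \<longleftrightarrow> continuous_on S f"
| "Ck_on (Suc k) S f \<longleftrightarrow> (\<forall>y\<in>S. f differentiable (at y)) \<and>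
     (\<forall>v. Ck_on k S (\<lambda>y. frechet_derivative f (at y) v))"

definition smooth_on :: "'e::euclidean_space set \<Rightarrow> ('e \<Rightarrow> 'b::real_normed_vector) \<Rightarrow> bool" where
  "smooth_on S f \<longleftrightarrow> (\<forall>k. Ck_on k S f)"

text \<open>A chart is a pair of its domain and its coordinate map.\<close>

type_synonym ('a, 'n) chart = "'a set \<times> ('a \<Rightarrow> real ^ 'n)"

abbreviation param :: "('a, 'n::finite) chart \<Rightarrow> real ^ 'n \<Rightarrow> 'a" where
  "param c \<equiv> inv_into (fst c) (snd c)"

definition smooth_atlas :: "'a::t2_space set \<Rightarrow> ('a, 'n::finite) chart set \<Rightarrow> bool" where
  "smooth_atlas M \<A> \<longleftrightarrow>
     M = (\<Union>c\<in>\<A>. fst c) \<and>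
     (\<forall>c\<in>\<A>. openin (top_of_set M) (fst c) \<and> open (snd c ` fst c) \<and>
        homeomorphism (fst c) (snd c ` fst c) (snd c) (param c)) \<and>
     (\<forall>c\<in>\<A>. \<forall>d\<in>\<A>. smooth_on (snd c ` (fst c \<inter> fst d)) (snd d \<circ> param c))"

text \<open>Manifolds are connected and non-empty.  Second countability is automatic for compact \<open>M\<close>.\<close>

definition closed_manifold :: "'a::t2_space set \<Rightarrow> ('a, 'n::finite) chart set \<Rightarrow> bool" where
  "closed_manifold M \<A> \<longleftrightarrow> smooth_atlas M \<A> \<and> compact M \<and> connected M \<and> M \<noteq> {}"

definition smooth_map :: "('a, 'n::finite) chart set \<Rightarrow> ('a \<Rightarrow> 'b::real_normed_vector) \<Rightarrow> bool" where
  "smooth_map \<A> f \<longleftrightarrow> (\<forall>c\<in>\<A>. smooth_on (snd c ` fst c) (f \<circ> param c))"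

text \<open>\<open>pd c i f p\<close> is the value at \<open>p\<close> (in the domain of \<open>c\<close>) of the \<open>i\<close>-th coordinate vector field
  of the chart \<open>c\<close> applied to \<open>f\<close>.\<close>

definition pd ::
  "('a, 'n::finite) chart \<Rightarrow> 'n \<Rightarrow> ('a \<Rightarrow> 'b::real_normed_vector) \<Rightarrow> 'a \<Rightarrow> 'b"
where
  "pd c i f p = frechet_derivative (f \<circ> param c) (at (snd c p)) (axis i 1)"

section \<open>Immersed hypersurfaces and their Riemannian metric\<close>

definition immersion ::
  "('a, 'n::finite) chart set \<Rightarrow> ('a \<Rightarrow> real ^ 'm::finite) \<Rightarrow> bool"
where
  "immersion \<A> x \<longleftrightarrow> smooth_map \<A> x \<and>
     (\<forall>c\<in>\<A>. \<forall>p\<in>fst c. inj (frechet_derivative (x \<circ> param c) (at (snd c p))))"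

definition unit_normal_field ::
  "('a, 'n::finite) chart set \<Rightarrow> ('a \<Rightarrow> real ^ 'm::finite) \<Rightarrow> ('a \<Rightarrow> real ^ 'm) \<Rightarrow> bool"
where
  "unit_normal_field \<A> x N \<longleftrightarrow> smooth_map \<A> N \<and>
     (\<forall>c\<in>\<A>. \<forall>p\<in>fst c. norm (N p) = 1 \<and> (\<forall>i. N p \<bullet> pd c i x p = 0))"

text \<open>Metric coefficients in the chart \<open>c\<close>.  The hypersurface carries the metric induced by \<open>x\<close>; this
  is what it means for the immersion \<open>x\<close> to be isometric.

  Tangent vectors are represented by their coordinate columns with respect to the coordinate fields
  of a chart \<open>c\<close>, and endomorphisms of tangent spaces by the corresponding matrices.\<close>

definition metric ::
  "('a, 'n::finite) chart \<Rightarrow> ('a \<Rightarrow> real ^ 'm::finite) \<Rightarrow> 'a \<Rightarrow> real ^ 'n ^ 'n"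
where
  "metric c x p = (\<chi> i j. pd c i x p \<bullet> pd c j x p)"

text \<open>\<open>christoffel c x k i j p\<close> is the Christoffel symbol of the Levi-Civita connection with upper
  index \<open>k\<close> and lower indices \<open>i\<close>, \<open>j\<close>.\<close>

definition christoffel ::
  "('a, 'n::finite) chart \<Rightarrow> ('a \<Rightarrow> real ^ 'm::finite) \<Rightarrow> 'n \<Rightarrow> 'n \<Rightarrow> 'n \<Rightarrow> 'a \<Rightarrow> real"
where
  "christoffel c x k i j p =
     (\<Sum>l\<in>UNIV. matrix_inv (metric c x p) $ k $ l / 2 *
        (pd c i (\<lambda>q. metric c x q $ j $ l) p + pd c j (\<lambda>q. metric c x q $ i $ l) p
          - pd c l (\<lambda>q. metric c x q $ i $ j) p))"

text \<open>The Hessian as a bilinear form, and the Hessian operator obtained from it by raising an index.\<close>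

definition hessian_form ::
  "('a, 'n::finite) chart \<Rightarrow> ('a \<Rightarrow> real ^ 'm::finite) \<Rightarrow> ('a \<Rightarrow> real) \<Rightarrow> 'a \<Rightarrow> real ^ 'n ^ 'n"
where
  "hessian_form c x u p =
     (\<chi> i j. pd c i (pd c j u) p - (\<Sum>k\<in>UNIV. christoffel c x k i j p * pd c k u p))"

definition hessian_operator ::
  "('a, 'n::finite) chart \<Rightarrow> ('a \<Rightarrow> real ^ 'm::finite) \<Rightarrow> ('a \<Rightarrow> real) \<Rightarrow> 'a \<Rightarrow> real ^ 'n ^ 'n"
where
  "hessian_operator c x u p = matrix_inv (metric c x p) ** hessian_form c x u p"

section \<open>Second fundamental form, higher mean curvatures, Newton transformations\<close>

text \<open>\<open>A X = - D\<^sub>X N\<close>, expressed in the coordinate fields.\<close>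

definition shape_operator ::
  "('a, 'n::finite) chart \<Rightarrow> ('a \<Rightarrow> real ^ 'm::finite) \<Rightarrow> ('a \<Rightarrow> real ^ 'm) \<Rightarrow> 'a \<Rightarrow> real ^ 'n ^ 'n"
where
  "shape_operator c x N p =
     (THE a. \<forall>j. (\<Sum>i\<in>UNIV. a $ i $ j *\<^sub>R pd c i x p) = - pd c j N p)"

text \<open>An enumeration of the eigenvalues with multiplicity.  It exists when all eigenvalues are real, in
  particular for shape operators (which are self-adjoint), and is unique up to order.\<close>

definition eigenvalues :: "real ^ 'n ^ 'n \<Rightarrow> 'n::finite \<Rightarrow> real" where
  "eigenvalues B = (SOME \<kappa>. \<forall>t. det (mat t - B) = (\<Prod>i\<in>UNIV. t - \<kappa> i))"

definition elem_sym :: "nat \<Rightarrow> ('n::finite \<Rightarrow> real) \<Rightarrow> real" where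
  "elem_sym r \<kappa> = (\<Sum>I | card I = r. \<Prod>i\<in>I. \<kappa> i)"

definition S_curv ::
  "('a, 'n::finite) chart \<Rightarrow> ('a \<Rightarrow> real ^ 'm::finite) \<Rightarrow> ('a \<Rightarrow> real ^ 'm) \<Rightarrow> nat \<Rightarrow> 'a \<Rightarrow> real"
where
  "S_curv c x N r p = elem_sym r (eigenvalues (shape_operator c x N p))"

definition mean_curvature ::
  "('a, 'n::finite) chart \<Rightarrow> ('a \<Rightarrow> real ^ 'm::finite) \<Rightarrow> ('a \<Rightarrow> real ^ 'm) \<Rightarrow> nat \<Rightarrow> 'a \<Rightarrow> real"
where
  "mean_curvature c x N r p = S_curv c x N r p / real (CARD('n) choose r)"

text \<open>For a scalar \<open>s\<close>, \<open>mat s\<close> is \<open>s\<close> times the identity.\<close>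

primrec newton ::
  "('a, 'n::finite) chart \<Rightarrow> ('a \<Rightarrow> real ^ 'm::finite) \<Rightarrow> ('a \<Rightarrow> real ^ 'm) \<Rightarrow> nat \<Rightarrow> 'a \<Rightarrow> real ^ 'n ^ 'n"
where
  "newton c x N 0 = (\<lambda>p. mat 1)"
| "newton c x N (Suc r) =
     (\<lambda>p. mat (S_curv c x N (Suc r) p) - shape_operator c x N p ** newton c x N r p)"

definition newton_positive_definite ::
  "('a, 'n::finite) chart set \<Rightarrow> ('a \<Rightarrow> real ^ 'm::finite) \<Rightarrow> ('a \<Rightarrow> real ^ 'm) \<Rightarrow> nat \<Rightarrow> bool"
where
  "newton_positive_definite \<A> x N r \<longleftrightarrow>
     (\<forall>c\<in>\<A>. \<forall>p\<in>fst c. \<forall>v. v \<noteq> 0 \<longrightarrow>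
        0 < (newton c x N r p *v v) \<bullet> (metric c x p *v v))"

definition L_op ::
  "('a, 'n::finite) chart \<Rightarrow> ('a \<Rightarrow> real ^ 'm::finite) \<Rightarrow> ('a \<Rightarrow> real ^ 'm) \<Rightarrow> nat \<Rightarrow> ('a \<Rightarrow> real) \<Rightarrow> 'a \<Rightarrow> real"
where
  "L_op c x N r u p = trace (newton c x N r p ** hessian_operator c x u p)"

definition support_function ::
  "('a \<Rightarrow> real ^ 'm::finite) \<Rightarrow> ('a \<Rightarrow> real ^ 'm) \<Rightarrow> 'a \<Rightarrow> real"
where
  "support_function x N p = x p \<bullet> N p"

section \<open>Isometry with a round sphere\<close>

text \<open>The abstract Riemannian manifold \<open>M\<close> (with the metric induced by \<open>x\<close>) is isometric to a round
  sphere of the same dimension: some map \<open>f\<close>, a priori unrelated to \<open>x\<close>, is a smooth bijection onto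
  the sphere and pulls its metric back to that of \<open>M\<close>.  Such an \<open>f\<close> is a local diffeomorphism onto the
  sphere, so smoothness of its inverse need not be required.\<close>

definition isometric_to_round_sphere ::
  "'a set \<Rightarrow> ('a, 'n::finite) chart set \<Rightarrow> ('a \<Rightarrow> real ^ 'm::finite) \<Rightarrow> bool"
where
  "isometric_to_round_sphere M \<A> x \<longleftrightarrow>
     (\<exists>(f :: 'a \<Rightarrow> real ^ 'm) z R. R > 0 \<and> bij_betw f M (sphere z R) \<and> smooth_map \<A> f \<and>
        (\<forall>c\<in>\<A>. \<forall>p\<in>fst c. metric c f p = metric c x p))"

end

theory Submission
  imports Defs "HOL-Computational_Algebra.Polynomial"
begin

text \<open>Write \<open>H\<close> for \<open>H\<^sub>1\<close>, \<open>s\<close> for the normalized scalar curvature, so that \<open>H\<^sup>2 \<ge> s\<close> with equality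
  precisely at umbilic points, and \<open>u = \<bar>x\<bar>\<^sup>2/2\<close>.  The Newton transformations are divergence free (Codazzi), so
  \<open>div (\<phi> P\<^sub>r(\<nabla>f)) = \<phi> L\<^sub>r f + \<langle>P\<^sub>r(\<nabla>f), \<nabla>\<phi>\<rangle>\<close>, while \<open>L\<^sub>0 u = n (1 + H \<rho>)\<close> and
  \<open>L\<^sub>1 u = n (n - 1) (H + s \<rho>)\<close>.

  If \<open>L\<^sub>r H = 1 + H \<rho>\<close>, the field \<open>H P\<^sub>r(\<nabla>H) - P\<^sub>1(\<nabla>u) / (n (n - 1))\<close> has the divergence
  \<open>\<langle>P\<^sub>r(\<nabla>H), \<nabla>H\<rangle> + \<rho> (H\<^sup>2 - s)\<close>.  It is non-negative and integrates to 0, hence vanishes: \<open>H\<close> is constant,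
  \<open>1 + H \<rho> = 0\<close>, so \<open>\<rho> > 0\<close> and all points are umbilic.  A totally umbilic closed hypersurface covers a round
  sphere, which is simply connected as \<open>n \<ge> 2\<close>, and the constancy of \<open>\<rho>\<close> puts its centre at the origin.

  Conversely, if \<open>M\<close> is isometric to a sphere of radius \<open>1/k\<close>, the Gauss equation gives \<open>s = k\<^sup>2\<close>, hence
  \<open>\<bar>H\<bar> \<ge> k\<close>.  Integrating \<open>L\<^sub>0 u\<close> excludes \<open>H > 0\<close>, and combining \<open>L\<^sub>0 u\<close> with \<open>L\<^sub>1 u\<close> yields the
  non-negative divergence \<open>(- H - k) (1 + k \<rho>)\<close>.  So \<open>H = - k\<close>, all points are umbilic, and \<open>M\<close> is immersed as a
  round sphere.\<close>

section \<open>Maps of class \<open>C\<^sup>k\<close>\<close>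

text \<open>The equation depends on the origin through \<open>support_function\<close>, being
  isometric to a sphere does not; hence the clause on the centre. On a sphere about a point other
  than the origin H is constant, so L_r H = 0, while 1 + H rho does not vanish identically.
  Non-negativity of rho also fixes the side of the normal: on a sphere it points outward, which is
  why H turns out negative.

  Two obstacles shape the proof. First, the eigenvalues are picked by a choice operator and need not
  be differentiable, so identities and derivatives of S_r and P_r are read off from generating
  polynomials such as det (1 + t A). Second, M is an abstract compact Hausdorff space with charts.
  No integral over M is defined: the only consequence of the divergence theorem in use is that a
  non-negative divergence vanishes, and this is derived from finitely many chart integrals. For the
  covering argument M is replaced by a homeomorphic copy in a normed space, on which the immersion
  becomes a projection.\<close>

lemma Ck_on_Suc_imp_Ck_on: "Ck_on (Suc k) S f \<Longrightarrow> Ck_on k S f"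
proof (induction k arbitrary: f)
  case 0
  then show ?case
    by (auto intro!: continuous_at_imp_continuous_on differentiable_imp_continuous_within)
next
  case (Suc k)
  then show ?case by (simp del: Ck_on.simps add: Ck_on.simps(2))
qed

lemma Ck_on_mono: "Ck_on k S f \<Longrightarrow> j \<le> k \<Longrightarrow> Ck_on j S f"
proof (induction k)
  case (Suc k)
  then show ?case using Ck_on_Suc_imp_Ck_on le_SucE by blast
qed simp

lemma Ck_on_imp_continuous_on: "Ck_on k S f \<Longrightarrow> continuous_on S f"
  using Ck_on_mono[of k S f 0] by simp

lemma frechet_derivative_cong_open:
  assumes "open S" "y \<in> S" "\<And>z. z \<in> S \<Longrightarrow> f z = g z"
  shows "frechet_derivative f (at y) = frechet_derivative g (at y)"
proof -
  have "(f has_derivative D) (at y) \<longleftrightarrow> (g has_derivative D) (at y)" for D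
    using assms has_derivative_transform_within_open[of _ D y UNIV S] by metis
  then show ?thesis by (simp add: frechet_derivative_def)
qed

lemma Ck_on_cong:
  assumes "open S" "\<And>y. y \<in> S \<Longrightarrow> f y = g y" "Ck_on k S f"
  shows "Ck_on k S g"
  using assms(2,3)
proof (induction k arbitrary: f g)
  case 0
  then show ?case by (auto cong: continuous_on_cong)
next
  case (Suc k)
  have "g differentiable at y" if "y \<in> S" for y
    using Suc.prems that assms(1) has_derivative_transform_within_open[of f _ y UNIV S g]
    by (auto simp: differentiable_def) metis
  moreover have "Ck_on k S (\<lambda>y. frechet_derivative g (at y) v)" for v
    by (rule Suc.IH[of "\<lambda>y. frechet_derivative f (at y) v"])
      (use Suc.prems frechet_derivative_cong_open[OF assms(1), of _ f g] in auto)
  ultimately show ?case by simp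
qed

lemma Ck_on_subset: "Ck_on k S f \<Longrightarrow> T \<subseteq> S \<Longrightarrow> Ck_on k T f"
  by (induction k arbitrary: f) (auto intro: continuous_on_subset)

lemma Ck_on_local:
  assumes "\<And>y. y \<in> S \<Longrightarrow> \<exists>T. open T \<and> y \<in> T \<and> Ck_on k T f"
  shows "Ck_on k S f"
  using assms
proof (induction k arbitrary: f)
  case 0
  have "isCont f y" if "y \<in> S" for y
    using 0[OF that] by (auto simp: continuous_on_eq_continuous_at)
  then show ?case by (simp add: continuous_at_imp_continuous_on)
next
  case (Suc k)
  have "Ck_on k S (\<lambda>y. frechet_derivative f (at y) v)" for v
    by (rule Suc.IH) (use Suc.prems in force)
  then show ?case using Suc.prems by force
qed

lemma Ck_on_const [simp]: "Ck_on k S (\<lambda>y. c)"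
  by (induction k arbitrary: c) auto

lemma has_frechet_derivative:
  "f differentiable (at y) \<Longrightarrow> (f has_derivative frechet_derivative f (at y)) (at y)"
  by (simp add: frechet_derivative_works)

lemma Ck_on_bounded_linear:
  assumes "open S" "bounded_linear L" "Ck_on k S f"
  shows "Ck_on k S (\<lambda>y. L (f y))"
  using assms(3)
proof (induction k arbitrary: f)
  case 0
  then show ?case using bounded_linear.continuous_on[OF assms(2)] by auto
next
  case (Suc k)
  have d: "((\<lambda>y. L (f y)) has_derivative (\<lambda>v. L (frechet_derivative f (at y) v))) (at y)"
    if "y \<in> S" for y
    using Suc.prems that
    by (auto intro!: bounded_linear.has_derivative[OF assms(2)] has_frechet_derivative)
  have "Ck_on k S (\<lambda>y. frechet_derivative (\<lambda>y. L (f y)) (at y) v)" for v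
    by (rule Ck_on_cong[OF assms(1), where f="\<lambda>y. L (frechet_derivative f (at y) v)"])
      (use Suc d in \<open>auto simp: frechet_derivative_at[OF d, symmetric]\<close>)
  then show ?case using d by (auto simp: differentiable_def)
qed

lemma Ck_on_add:
  assumes "open S" "Ck_on k S f" "Ck_on k S g"
  shows "Ck_on k S (\<lambda>y. f y + g y)"
  using assms(2,3)
proof (induction k arbitrary: f g)
  case 0
  then show ?case by (auto intro: continuous_on_add)
next
  case (Suc k)
  have d: "((\<lambda>y. f y + g y) has_derivative
      (\<lambda>v. frechet_derivative f (at y) v + frechet_derivative g (at y) v)) (at y)"
    if "y \<in> S" for y
    using Suc.prems that by (auto intro!: has_derivative_add has_frechet_derivative)
  have "Ck_on k S (\<lambda>y. frechet_derivative (\<lambda>y. f y + g y) (at y) v)" for v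
    by (rule Ck_on_cong[OF assms(1), where
          f="\<lambda>y. frechet_derivative f (at y) v + frechet_derivative g (at y) v"])
      (use Suc d in \<open>auto simp: frechet_derivative_at[OF d, symmetric]\<close>)
  then show ?case using d by (auto simp: differentiable_def)
qed

text \<open>One induction serves products, scalar multiples and inner products. Both functions are
  generalized because the derivative pairs each of them with the derivative of the other.\<close>

lemma Ck_on_bounded_bilinear:
  assumes "open S" "bounded_bilinear B" "Ck_on k S f" "Ck_on k S g"
  shows "Ck_on k S (\<lambda>y. B (f y) (g y))"
  using assms(3,4)
proof (induction k arbitrary: f g)
  case 0
  then show ?case by (auto intro: bounded_bilinear.continuous_on[OF assms(2)])
next
  case (Suc k)
  have d: "((\<lambda>y. B (f y) (g y)) has_derivative
      (\<lambda>v. B (f y) (frechet_derivative g (at y) v) + B (frechet_derivative f (at y) v) (g y))) (at y)"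
    if "y \<in> S" for y
    using Suc.prems that
    by (auto intro!: bounded_bilinear.FDERIV[OF assms(2)] has_frechet_derivative)
  have "Ck_on k S (\<lambda>y. frechet_derivative (\<lambda>y. B (f y) (g y)) (at y) v)" for v
  proof (rule Ck_on_cong[OF assms(1), where f="\<lambda>y. B (f y) (frechet_derivative g (at y) v)
      + B (frechet_derivative f (at y) v) (g y)"])
    show "Ck_on k S (\<lambda>y. B (f y) (frechet_derivative g (at y) v)
      + B (frechet_derivative f (at y) v) (g y))"
      using Suc.prems Ck_on_Suc_imp_Ck_on[OF Suc.prems(1)] Ck_on_Suc_imp_Ck_on[OF Suc.prems(2)]
      by (intro Ck_on_add assms(1) Suc.IH) simp_all
  qed (use d in \<open>auto simp: frechet_derivative_at[OF d, symmetric]\<close>)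
  then show ?case using d by (auto simp: differentiable_def)
qed

lemmas Ck_on_mult = Ck_on_bounded_bilinear[OF _ bounded_bilinear_mult]
lemmas Ck_on_scaleR = Ck_on_bounded_bilinear[OF _ bounded_bilinear_scaleR]
lemmas Ck_on_inner = Ck_on_bounded_bilinear[OF _ bounded_bilinear_inner]

lemma Ck_on_minus: "open S \<Longrightarrow> Ck_on k S f \<Longrightarrow> Ck_on k S (\<lambda>y. - f y)"
  by (rule Ck_on_bounded_linear[OF _ bounded_linear_minus[OF bounded_linear_ident]])

lemma Ck_on_diff: "open S \<Longrightarrow> Ck_on k S f \<Longrightarrow> Ck_on k S g \<Longrightarrow> Ck_on k S (\<lambda>y. f y - g y)"
  using Ck_on_add[of S k f "\<lambda>y. - g y"] Ck_on_minus[of S k g] by simp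

lemma Ck_on_sum:
  "open S \<Longrightarrow> (\<And>i. i \<in> I \<Longrightarrow> Ck_on k S (f i)) \<Longrightarrow> Ck_on k S (\<lambda>y. \<Sum>i\<in>I. f i y)"
  by (induction I rule: infinite_finite_induct) (auto intro: Ck_on_add)

lemma Ck_on_prod:
  fixes f :: "'i \<Rightarrow> 'e::euclidean_space \<Rightarrow> real"
  shows "open S \<Longrightarrow> (\<And>i. i \<in> I \<Longrightarrow> Ck_on k S (f i)) \<Longrightarrow> Ck_on k S (\<lambda>y. \<Prod>i\<in>I. f i y)"
  by (induction I rule: infinite_finite_induct) (auto intro: Ck_on_mult)

text \<open>The derivative of 1/f is a product of 1/f, f' and 1/f, so it involves nothing beyond f'
  and the function whose regularity is known from the induction hypothesis.\<close>

lemma Ck_on_inverse: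
  fixes f :: "'e::euclidean_space \<Rightarrow> real"
  assumes "open S" "Ck_on k S f" "\<And>y. y \<in> S \<Longrightarrow> f y \<noteq> 0"
  shows "Ck_on k S (\<lambda>y. inverse (f y))"
  using assms(2,3)
proof (induction k arbitrary: f)
  case 0
  then show ?case by (auto intro: continuous_on_inverse)
next
  case (Suc k)
  have d: "((\<lambda>y. inverse (f y)) has_derivative
      (\<lambda>v. - (inverse (f y) * frechet_derivative f (at y) v * inverse (f y)))) (at y)"
    if "y \<in> S" for y
    using Suc.prems that by (auto intro!: Deriv.has_derivative_inverse has_frechet_derivative)
  have "Ck_on k S (\<lambda>y. frechet_derivative (\<lambda>y. inverse (f y)) (at y) v)" for v
  proof (rule Ck_on_cong[OF assms(1), where
        f="\<lambda>y. - (inverse (f y) * frechet_derivative f (at y) v * inverse (f y))"])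
    show "Ck_on k S (\<lambda>y. - (inverse (f y) * frechet_derivative f (at y) v * inverse (f y)))"
      using Suc.prems Ck_on_Suc_imp_Ck_on[OF Suc.prems(1)]
      by (intro Ck_on_minus Ck_on_mult assms(1) Suc.IH) simp_all
  qed (use d in \<open>auto simp: frechet_derivative_at[OF d, symmetric]\<close>)
  then show ?case using d by (auto simp: differentiable_def)
qed

lemma linear_eq_sum_Basis:
  fixes L :: "'e::euclidean_space \<Rightarrow> 'b::real_vector"
  assumes "linear L"
  shows "L v = (\<Sum>b\<in>Basis. (v \<bullet> b) *\<^sub>R L b)"
proof -
  have "L v = L (\<Sum>b\<in>Basis. (v \<bullet> b) *\<^sub>R b)" by (simp add: euclidean_representation)
  also have "\<dots> = (\<Sum>b\<in>Basis. (v \<bullet> b) *\<^sub>R L b)"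
    using assms by (simp add: linear_sum linear_cmul)
  finally show ?thesis .
qed

text \<open>The chain rule applies a linear map depending on \<open>g y\<close> to a vector
  depending on \<open>y\<close>. Expanding that vector in the basis turns it into a sum of scalar
  functions times compositions, to which the induction hypothesis applies.\<close>

lemma Ck_on_compose:
  fixes g :: "'e::euclidean_space \<Rightarrow> 'd::euclidean_space"
  assumes "open S" "open T" "Ck_on k S g" "Ck_on k T f" "g ` S \<subseteq> T"
  shows "Ck_on k S (\<lambda>y. f (g y))"
  using assms(3,4)
proof (induction k arbitrary: f)
  case 0
  then show ?case using assms(5) by (auto intro: continuous_on_compose2)
next
  case (Suc k)
  have d: "((\<lambda>y. f (g y)) has_derivative
      (\<lambda>v. frechet_derivative f (at (g y)) (frechet_derivative g (at y) v))) (at y)"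
    if "y \<in> S" for y
    using Suc.prems that assms(5)
      by (intro has_derivative_compose[of g _ y UNIV f] has_frechet_derivative) auto
  have "Ck_on k S (\<lambda>y. frechet_derivative (\<lambda>y. f (g y)) (at y) v)" for v
  proof (rule Ck_on_cong[OF assms(1), where f="\<lambda>y. \<Sum>b\<in>Basis. (frechet_derivative g (at y) v \<bullet> b)
      *\<^sub>R frechet_derivative f (at (g y)) b"])
    show "Ck_on k S (\<lambda>y. \<Sum>b\<in>Basis. (frechet_derivative g (at y) v \<bullet> b)
      *\<^sub>R frechet_derivative f (at (g y)) b)"
      using Suc.prems Ck_on_Suc_imp_Ck_on[OF Suc.prems(1)]
      by (intro Ck_on_sum Ck_on_scaleR Ck_on_inner assms(1) Suc.IH) simp_all
  next
    fix y assume y: "y \<in> S"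
    then have "linear (frechet_derivative f (at (g y)))"
      using Suc.prems assms(5) by (auto intro!: linear_frechet_derivative)
    then show "(\<Sum>b\<in>Basis. (frechet_derivative g (at y) v \<bullet> b) *\<^sub>R frechet_derivative f (at (g y)) b)
      = frechet_derivative (\<lambda>y. f (g y)) (at y) v"
      by (simp add: frechet_derivative_at[OF d[OF y], symmetric] linear_eq_sum_Basis[symmetric])
  qed
  then show ?case using d by (auto simp: differentiable_def)
qed

text \<open>The mean value theorem is applied twice: along \<open>u\<close> to the difference of
  \<open>f\<close> across \<open>s *\<^sub>R v\<close>, then along \<open>v\<close> to the
  derivative in direction \<open>u\<close>. The bound on \<open>s\<close> keeps the whole
  parallelogram inside the ball.\<close>

lemma second_difference_mean_value:
  fixes f :: "'e::euclidean_space \<Rightarrow> real"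
  assumes C: "Ck_on 2 (ball y e) f" and "0 < s" "s * (norm u + norm v) < e"
  obtains z where "z \<in> ball y e" "norm (z - y) \<le> s * (norm u + norm v)"
    "f (y + s *\<^sub>R u + s *\<^sub>R v) - f (y + s *\<^sub>R u) - f (y + s *\<^sub>R v) + f y
      = s * s * frechet_derivative (\<lambda>y. frechet_derivative f (at y) u) (at z) v"
proof -
  have inb: "norm (a *\<^sub>R u + b *\<^sub>R v) \<le> s * (norm u + norm v)"
    if "0 \<le> a" "a \<le> s" "0 \<le> b" "b \<le> s" for a b
  proof -
    have "norm (a *\<^sub>R u + b *\<^sub>R v) \<le> a * norm u + b * norm v"
      using norm_triangle_ineq[of "a *\<^sub>R u" "b *\<^sub>R v"] that by simp
    also have "\<dots> \<le> s * norm u + s * norm v"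
      using that by (intro add_mono mult_right_mono) auto
    finally show ?thesis by (simp add: algebra_simps)
  qed
  have inball: "y + a *\<^sub>R u + b *\<^sub>R v \<in> ball y e"
    if "0 \<le> a" "a \<le> s" "0 \<le> b" "b \<le> s" for a b
    using le_less_trans[OF inb[OF that] assms(3)]
    by (metis add.assoc add_diff_cancel_left' dist_commute dist_norm mem_ball)
  define f1 where "f1 z = frechet_derivative f (at z) u" for z
  have df: "(f has_derivative frechet_derivative f (at z)) (at z)" if "z \<in> ball y e" for z
    using C that by (auto simp: numeral_2_eq_2 intro: has_frechet_derivative)
  have df1: "(f1 has_derivative frechet_derivative f1 (at z)) (at z)" if "z \<in> ball y e" for z
    using C that unfolding f1_def by (auto simp: numeral_2_eq_2 intro: has_frechet_derivative)
  define \<phi> where "\<phi> a = f (y + a *\<^sub>R u + s *\<^sub>R v) - f (y + a *\<^sub>R u)" for a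
  have d\<phi>: "(\<phi> has_real_derivative f1 (y + a *\<^sub>R u + s *\<^sub>R v) - f1 (y + a *\<^sub>R u)) (at a)"
    if "0 \<le> a" "a \<le> s" for a
  proof -
    have 1: "y + a *\<^sub>R u + s *\<^sub>R v \<in> ball y e" "y + a *\<^sub>R u \<in> ball y e"
      using inball[of a s] inball[of a 0] that assms by auto
    have "((\<lambda>a. y + a *\<^sub>R u + s *\<^sub>R v) has_derivative (\<lambda>t. t *\<^sub>R u)) (at a)"
      "((\<lambda>a. y + a *\<^sub>R u) has_derivative (\<lambda>t. t *\<^sub>R u)) (at a)"
      by (auto intro!: derivative_eq_intros)
    from has_derivative_compose[OF this(1) df[OF 1(1)]] has_derivative_compose[OF this(2) df[OF 1(2)]]
    have "(\<phi> has_derivative (\<lambda>t. frechet_derivative f (at (y + a *\<^sub>R u + s *\<^sub>R v)) (t *\<^sub>R u)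
        - frechet_derivative f (at (y + a *\<^sub>R u)) (t *\<^sub>R u))) (at a)"
      unfolding \<phi>_def by (rule has_derivative_diff)
    moreover have "frechet_derivative f (at z) (t *\<^sub>R u) = t * f1 z" if "z \<in> ball y e" for z t
      using linear_cmul[OF has_derivative_linear[OF df[OF that]], of t u] by (simp add: f1_def)
    ultimately show ?thesis
      using 1 unfolding has_field_derivative_def
      by (elim has_derivative_eq_rhs) (simp add: fun_eq_iff algebra_simps)
  qed
  obtain a where a: "0 < a" "a < s"
    "\<phi> s - \<phi> 0 = (s - 0) * (f1 (y + a *\<^sub>R u + s *\<^sub>R v) - f1 (y + a *\<^sub>R u))"
    using MVT2[OF assms(2) d\<phi>] by auto
  define \<psi> where "\<psi> b = f1 (y + a *\<^sub>R u + b *\<^sub>R v)" for b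
  have d\<psi>: "(\<psi> has_real_derivative frechet_derivative f1 (at (y + a *\<^sub>R u + b *\<^sub>R v)) v) (at b)"
    if "0 \<le> b" "b \<le> s" for b
  proof -
    have 1: "y + a *\<^sub>R u + b *\<^sub>R v \<in> ball y e" using inball[of a b] that a by auto
    have "((\<lambda>b. y + a *\<^sub>R u + b *\<^sub>R v) has_derivative (\<lambda>t. t *\<^sub>R v)) (at b)"
      by (auto intro!: derivative_eq_intros)
    from has_derivative_compose[OF this df1[OF 1]] show ?thesis
      using linear_cmul[OF has_derivative_linear[OF df1[OF 1]], of _ v]
      unfolding has_field_derivative_def \<psi>_def[abs_def]
      by (elim has_derivative_eq_rhs) (simp add: fun_eq_iff)
  qed
  obtain b where b: "0 < b" "b < s"
    "\<psi> s - \<psi> 0 = (s - 0) * frechet_derivative f1 (at (y + a *\<^sub>R u + b *\<^sub>R v)) v"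
    using MVT2[OF assms(2) d\<psi>] by auto
  show ?thesis
  proof
    show "y + a *\<^sub>R u + b *\<^sub>R v \<in> ball y e" using inball a b by simp
    show "norm (y + a *\<^sub>R u + b *\<^sub>R v - y) \<le> s * (norm u + norm v)"
      using inb[of a b] a b by (simp add: add.assoc)
    show "f (y + s *\<^sub>R u + s *\<^sub>R v) - f (y + s *\<^sub>R u) - f (y + s *\<^sub>R v) + f y
      = s * s * frechet_derivative (\<lambda>y. frechet_derivative f (at y) u) (at (y + a *\<^sub>R u + b *\<^sub>R v)) v"
      using a(3) b(3) by (simp add: \<phi>_def \<psi>_def f1_def[abs_def])
  qed
qed

text \<open>The second difference is symmetric in \<open>u\<close> and \<open>v\<close>, so the two
  iterated derivatives take a common value at two points arbitrarily close to \<open>y\<close>.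
  Different values at \<open>y\<close> would contradict their continuity.\<close>

lemma second_derivative_symmetric_real:
  fixes f :: "'e::euclidean_space \<Rightarrow> real"
  assumes "open S" "Ck_on 2 S f" "y \<in> S"
  shows "frechet_derivative (\<lambda>y. frechet_derivative f (at y) u) (at y) v
    = frechet_derivative (\<lambda>y. frechet_derivative f (at y) v) (at y) u"
proof (rule ccontr)
  define F where "F u v z = frechet_derivative (\<lambda>y. frechet_derivative f (at y) u) (at z) v" for u v z
  assume "\<not> ?thesis"
  then have pos: "0 < \<bar>F u v y - F v u y\<bar> / 2" by (simp add: F_def)
  have "continuous_on S (F u v)" for u v
    using assms(2) by (simp add: numeral_2_eq_2 F_def[abs_def])
  then have cF: "isCont (F u v) y" for u v
    using assms(1,3) by (simp add: continuous_on_eq_continuous_at)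
  obtain d1 where d1: "d1 > 0" "\<And>z. dist z y < d1 \<Longrightarrow> dist (F u v z) (F u v y) < \<bar>F u v y - F v u y\<bar> / 2"
    using cF[of u v] pos unfolding continuous_at_eps_delta by metis
  obtain d2 where d2: "d2 > 0" "\<And>z. dist z y < d2 \<Longrightarrow> dist (F v u z) (F v u y) < \<bar>F u v y - F v u y\<bar> / 2"
    using cF[of v u] pos unfolding continuous_at_eps_delta by metis
  obtain e where e: "e > 0" "ball y e \<subseteq> S"
    using assms(1,3) open_contains_ball by blast
  define d where "d = min e (min d1 d2)"
  have d: "d > 0" "d \<le> e" "d \<le> d1" "d \<le> d2" using e d1 d2 by (auto simp: d_def)
  \<comment> \<open>The summand 1 keeps the denominator positive when both directions are zero, and
    it makes the inequality below strict.\<close>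
  define s where "s = d / (norm u + norm v + 1)"
  have s: "s > 0" "s * (norm u + norm v) < d"
  proof -
    show "s > 0" using d by (simp add: s_def add_nonneg_pos)
    have "s * (norm u + norm v) < s * (norm u + norm v + 1)" using \<open>s > 0\<close> by (intro mult_strict_left_mono) auto
    also have "\<dots> = d" by (simp add: s_def add_nonneg_eq_0_iff add_nonneg_pos less_imp_neq[THEN not_sym])
    finally show "s * (norm u + norm v) < d" .
  qed
  have C: "Ck_on 2 (ball y e) f" using assms(2) e Ck_on_subset by blast
  have se: "s * (norm u + norm v) < e" and se': "s * (norm v + norm u) < e"
    using s d by (auto simp: add.commute)
  obtain z1 where z1: "norm (z1 - y) \<le> s * (norm u + norm v)"
    "f (y + s *\<^sub>R u + s *\<^sub>R v) - f (y + s *\<^sub>R u) - f (y + s *\<^sub>R v) + f y = s * s * F u v z1"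
    using second_difference_mean_value[OF C s(1) se] unfolding F_def by metis
  obtain z2 where z2: "norm (z2 - y) \<le> s * (norm v + norm u)"
    "f (y + s *\<^sub>R v + s *\<^sub>R u) - f (y + s *\<^sub>R v) - f (y + s *\<^sub>R u) + f y = s * s * F v u z2"
    using second_difference_mean_value[OF C s(1) se'] unfolding F_def by metis
  have "f (y + s *\<^sub>R u + s *\<^sub>R v) = f (y + s *\<^sub>R v + s *\<^sub>R u)" by (simp add: algebra_simps)
  then have "s * s * F u v z1 = s * s * F v u z2" using z1(2) z2(2) by linarith
  then have "F u v z1 = F v u z2" using s by simp
  moreover have "dist z1 y < d1" "dist z2 y < d2"
    using z1 z2 s d by (auto simp: dist_norm add.commute)
  ultimately show False using d1(2)[of z1] d2(2)[of z2] unfolding dist_real_def by (smt (verit) field_sum_of_halves)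
qed

lemma frechet_derivative_bounded_linear:
  assumes "bounded_linear L" "f differentiable at y"
  shows "frechet_derivative (\<lambda>y. L (f y)) (at y) v = L (frechet_derivative f (at y) v)"
  using frechet_derivative_at[OF bounded_linear.has_derivative[OF assms(1) has_frechet_derivative[OF assms(2)]]]
  by metis

lemma second_derivative_symmetric:
  fixes f :: "'e::euclidean_space \<Rightarrow> 'b::euclidean_space"
  assumes "open S" "Ck_on 2 S f" "y \<in> S"
  shows "frechet_derivative (\<lambda>y. frechet_derivative f (at y) u) (at y) v
    = frechet_derivative (\<lambda>y. frechet_derivative f (at y) v) (at y) u"
proof (rule euclidean_eqI)
  fix b :: 'b
  define L where "L x = x \<bullet> b" for x :: 'b
  have L: "bounded_linear L" unfolding L_def by (rule bounded_linear_inner_left)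
  have d1: "f differentiable at z" if "z \<in> S" for z using that assms(2) by (simp add: numeral_2_eq_2)
  have d2: "(\<lambda>y. frechet_derivative f (at y) u) differentiable at y" for u
    using assms(2,3) by (simp add: numeral_2_eq_2)
  have e: "L (frechet_derivative (\<lambda>y. frechet_derivative f (at y) u) (at y) v)
    = frechet_derivative (\<lambda>y. frechet_derivative (\<lambda>y. L (f y)) (at y) u) (at y) v" for u v
    unfolding frechet_derivative_bounded_linear[OF L d2, symmetric]
    by (rule fun_cong[OF frechet_derivative_cong_open[OF assms(1,3)]])
      (simp add: frechet_derivative_bounded_linear[OF L d1])
  show "frechet_derivative (\<lambda>y. frechet_derivative f (at y) u) (at y) v \<bullet> b
    = frechet_derivative (\<lambda>y. frechet_derivative f (at y) v) (at y) u \<bullet> b"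
    using second_derivative_symmetric_real[OF assms(1) Ck_on_bounded_linear[OF assms(1) L assms(2)] assms(3)] e
    by (metis L_def)
qed

section \<open>Elementary symmetric functions and Newton transformations of diagonalizable matrices\<close>

lemma linear_coefficient_eq_0:
  fixes b c :: real
  assumes "\<And>s. 2 * s * b + s * s * c \<le> 0"
  shows "b = 0"
proof (rule ccontr)
  assume b: "b \<noteq> 0"
  \<comment> \<open>With this choice the linear term 2 s b equals 2 s^2 (\<bar>c\<bar> + 1), which
    outweighs s^2 \<bar>c\<bar>.\<close>
  define s where "s = b / (\<bar>c\<bar> + 1)"
  have p: "\<bar>c\<bar> + 1 > 0" by simp
  have s: "s * (\<bar>c\<bar> + 1) = b" using p by (simp add: s_def)
  then have sn: "s \<noteq> 0" using b by auto
  have "s * s * c \<ge> - (s * s * \<bar>c\<bar>)"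
    using mult_left_mono[of "- \<bar>c\<bar>" c "s * s"] by simp
  moreover have "2 * s * b = 2 * (s * s) * (\<bar>c\<bar> + 1)" unfolding s[symmetric] by (simp add: algebra_simps)
  moreover have "s * s * \<bar>c\<bar> \<ge> 0" by simp
  moreover have "s * s > 0" using sn by (simp add: zero_less_mult_iff) linarith
  ultimately show False using assms[of s] by (simp add: algebra_simps)
qed

text \<open>A maximizer of the Rayleigh quotient a(u,u) / g(u,u) on the unit sphere of S is an
  eigenvector, and its g-orthogonal complement in S is again invariant. Working with invariant
  subspaces rather than the whole space is what lets the induction on the dimension go
  through.\<close>

lemma simultaneous_diagonalization_subspace:
  fixes A G :: "real^'n^'n"
  assumes symG: "\<And>u v. u \<bullet> (G *v v) = v \<bullet> (G *v u)"
    and pos: "\<And>u. u \<noteq> 0 \<Longrightarrow> 0 < u \<bullet> (G *v u)"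
    and sa: "\<And>u v. (A *v u) \<bullet> (G *v v) = (A *v v) \<bullet> (G *v u)"
    and "subspace S" "\<And>u. u \<in> S \<Longrightarrow> A *v u \<in> S"
  shows "\<exists>B\<subseteq>S. independent B \<and> card B = dim S \<and> (\<forall>b\<in>B. \<exists>\<kappa>. A *v b = \<kappa> *\<^sub>R b)"
  using assms(4,5)
proof (induction "dim S" arbitrary: S)
  case 0
  then show ?case by (intro exI[of _ "{}"]) (auto simp: independent_empty)
next
  case (Suc k)
  define a where "a u v = (A *v u) \<bullet> (G *v v)" for u v
  define g where "g u v = u \<bullet> (G *v v)" for u v
  have asym: "a u v = a v u" for u v using sa by (simp add: a_def)
  have gsym: "g u v = g v u" for u v using symG by (simp add: g_def)
  have gpos: "u \<noteq> 0 \<Longrightarrow> 0 < g u u" for u using pos by (simp add: g_def)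
  have lin: "a (u + v) w = a u w + a v w" "a w (u + v) = a w u + a w v"
    "a (s *\<^sub>R u) w = s * a u w" "a w (s *\<^sub>R u) = s * a w u"
    "g (u + v) w = g u w + g v w" "g w (u + v) = g w u + g w v"
    "g (s *\<^sub>R u) w = s * g u w" "g w (s *\<^sub>R u) = s * g w u"
    for u v w s
    by (simp_all add: a_def g_def matrix_vector_right_distrib inner_add_left inner_add_right
        matrix_vector_mult_scaleR)
  define K where "K = S \<inter> sphere 0 1"
  have "compact K"
    unfolding K_def using closed_subspace[OF Suc.prems(1)] by (simp add: closed_Int_compact)
  moreover have "K \<noteq> {}"
  proof -
    obtain v where "v \<in> S" "v \<noteq> 0"
      using Suc.hyps(2) by (metis dim_eq_0 nat.distinct(1) subsetI singletonI)
    then have "(1 / norm v) *\<^sub>R v \<in> K" using Suc.prems(1) by (auto simp: K_def subspace_scale)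
    then show ?thesis by blast
  qed
  moreover have "continuous_on K (\<lambda>u. a u u / g u u)"
  proof (intro continuous_on_divide)
    show "continuous_on K (\<lambda>u. a u u)" "continuous_on K (\<lambda>u. g u u)"
      unfolding a_def g_def
      by (intro continuous_intros matrix_vector_mult_linear_continuous_on)+
    show "\<forall>u\<in>K. g u u \<noteq> 0"
    proof
      fix u assume "u \<in> K"
      then have "u \<noteq> 0" by (auto simp: K_def)
      then show "g u u \<noteq> 0" using gpos[of u] by simp
    qed
  qed
  ultimately have "\<exists>u\<in>K. \<forall>w\<in>K. a w w / g w w \<le> a u u / g u u"
    by (rule continuous_attains_sup)
  then obtain u where u: "u \<in> K" "\<And>w. w \<in> K \<Longrightarrow> a w w / g w w \<le> a u u / g u u" by blast
  define \<kappa> where "\<kappa> = a u u / g u u"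
  have uS: "u \<in> S" "u \<noteq> 0" using u(1) by (auto simp: K_def)
  have le: "a w w - \<kappa> * g w w \<le> 0" if "w \<in> S" for w
  proof (cases "w = 0")
    case True
    then show ?thesis by (simp add: a_def g_def)
  next
    case False
    have "(1 / norm w) *\<^sub>R w \<in> K" using False that Suc.prems(1) by (auto simp: K_def subspace_scale)
    from u(2)[OF this] have "a w w / g w w \<le> \<kappa>" using False by (simp add: lin \<kappa>_def)
    then show ?thesis using gpos[OF False] by (simp add: divide_le_eq)
  qed
  \<comment> \<open>The form a - \<kappa> g is nowhere positive on S and vanishes at u, so its first
    variation at u is zero in every direction of S.\<close>
  have crit: "a u w - \<kappa> * g u w = 0" if "w \<in> S" for w
  proof (rule linear_coefficient_eq_0)
    fix s
    have "u + s *\<^sub>R w \<in> S" using that uS Suc.prems(1) by (simp add: subspace_add subspace_scale)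
    from le[OF this] have "a u u - \<kappa> * g u u + 2 * s * (a u w - \<kappa> * g u w)
        + s * s * (a w w - \<kappa> * g w w) \<le> 0"
      by (simp add: lin asym[of w u] gsym[of w u] algebra_simps)
    then show "2 * s * (a u w - \<kappa> * g u w) + s * s * (a w w - \<kappa> * g w w) \<le> 0"
      using gpos[OF uS(2)] by (simp add: \<kappa>_def)
  qed
  have eig: "A *v u = \<kappa> *\<^sub>R u"
  proof (rule ccontr)
    assume ne: "A *v u \<noteq> \<kappa> *\<^sub>R u"
    define w where "w = A *v u - \<kappa> *\<^sub>R u"
    have "w \<in> S" using uS Suc.prems by (simp add: w_def subspace_diff subspace_scale)
    from crit[OF this] have "g w w = 0"
      by (simp add: a_def g_def w_def inner_diff_left)
    then show False using gpos[of w] ne by (simp add: w_def)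
  qed
  define S' where "S' = {w \<in> S. g w u = 0}"
  have S': "subspace S'" using Suc.prems(1) unfolding S'_def subspace_def
    by (auto simp: lin) (simp add: g_def)
  have inv': "A *v w \<in> S'" if "w \<in> S'" for w
    using that Suc.prems(2) crit[of w] asym[of w u] gsym[of u w]
    by (auto simp: S'_def a_def g_def)
  have "span S' = S'" using S' by (simp only: span_eq_iff)
  moreover have "u \<notin> S'" using gpos[OF uS(2)] by (simp add: S'_def)
  ultimately have uS': "u \<notin> span S'" by blast
  have "span (insert u S') = S"
  proof
    show "span (insert u S') \<subseteq> S"
      using uS Suc.prems(1) by (intro span_minimal) (auto simp: S'_def)
    show "S \<subseteq> span (insert u S')"
    proof
      fix w assume w: "w \<in> S"
      have "w - (g w u / g u u) *\<^sub>R u \<in> S'"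
        using w uS Suc.prems(1) gpos[OF uS(2)] lin(5)[of w "- (g w u / g u u) *\<^sub>R u" u]
          lin(7)[of "- (g w u / g u u)" u u]
        by (simp add: S'_def subspace_diff subspace_scale)
      then have "(w - (g w u / g u u) *\<^sub>R u) + (g w u / g u u) *\<^sub>R u \<in> span (insert u S')"
        by (intro span_add span_scale) (auto intro: span_base)
      then show "w \<in> span (insert u S')" by simp
    qed
  qed
  then have "dim S = dim S' + 1"
    using uS' by (metis dim_insert dim_span)
  then have "k = dim S'" using Suc.hyps(2) by simp
  from Suc.hyps(1)[OF this S' inv'] obtain B where
    B: "B \<subseteq> S'" "independent B" "card B = dim S'" "\<forall>b\<in>B. \<exists>\<kappa>. A *v b = \<kappa> *\<^sub>R b" by blast
  have "u \<notin> span B" using uS' B(1) span_mono by blast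
  then have "independent (insert u B)" "u \<notin> B"
    using B(2) by (auto simp: independent_insert intro: span_base)
  moreover have "finite B" using B(2) by (rule independent_imp_finite)
  ultimately show ?case
    using B eig uS \<open>dim S = dim S' + 1\<close>
    by (intro exI[of _ "insert u B"]) (auto simp: S'_def)
qed

lemma matrix_add_rdistrib: "((A :: 'a::semiring_1^'n^'m) + B) ** C = A ** C + B ** C"
  by (vector matrix_matrix_mult_def sum.distrib[symmetric] distrib_right)

lemma matrix_diff_ldistrib: "(A :: 'a::ring_1^'n^'m) ** (B - C) = A ** B - A ** C"
  by (vector matrix_matrix_mult_def sum_subtractf[symmetric] right_diff_distrib)

lemma matrix_diff_rdistrib: "((A :: 'a::ring_1^'n^'m) - B) ** C = A ** C - B ** C"
  by (vector matrix_matrix_mult_def sum_subtractf[symmetric] left_diff_distrib)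

lemma matrix_mult_scaleR_left: "(t *\<^sub>R (A :: real^'n^'m)) ** B = t *\<^sub>R (A ** B)"
  by (vector matrix_matrix_mult_def) (simp add: sum_distrib_left mult.assoc)

lemma matrix_mult_scaleR_right: "(A :: real^'n^'m) ** (t *\<^sub>R B) = t *\<^sub>R (A ** B)"
  by (vector matrix_matrix_mult_def) (simp add: sum_distrib_left mult.left_commute)

lemma mat_eq_scaleR_mat_1: "(mat t :: real^'n^'n) = t *\<^sub>R mat 1"
  by (simp add: mat_def vec_eq_iff)

definition diag_mat :: "('n::finite \<Rightarrow> real) \<Rightarrow> real^'n^'n" where
  "diag_mat f = (\<chi> i j. if i = j then f i else 0)"

lemma diag_mat_mult: "diag_mat f ** diag_mat g = diag_mat (\<lambda>i. f i * g i)"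
proof -
  have "(\<Sum>k\<in>UNIV. (if i = k then f i else 0) * (if k = j then g k else 0))
    = (\<Sum>k\<in>UNIV. if k = i then (if i = j then f i * g i else 0) else 0)" for i j
    by (intro sum.cong) auto
  then show ?thesis by (simp add: diag_mat_def matrix_matrix_mult_def vec_eq_iff)
qed

text \<open>The inverse of \<open>E\<close> is carried as a separate matrix because \<open>E\<close>
  is not orthogonal in general: a shape operator is self-adjoint for \<open>metric\<close>, not for
  the standard inner product of the coordinate columns.\<close>

definition diagonalizable :: "real^'n^'n \<Rightarrow> bool" where
  "diagonalizable A \<longleftrightarrow> (\<exists>(E :: real^'n^'n) E' \<kappa>. E ** E' = mat 1 \<and> E' ** E = mat 1 \<and> A = E ** diag_mat \<kappa> ** E')"

lemma self_adjoint_diagonalizable: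
  fixes A G :: "real^'n^'n"
  assumes "\<And>u v. u \<bullet> (G *v v) = v \<bullet> (G *v u)" "\<And>u. u \<noteq> 0 \<Longrightarrow> 0 < u \<bullet> (G *v u)"
    "\<And>u v. (A *v u) \<bullet> (G *v v) = (A *v v) \<bullet> (G *v u)"
  shows "diagonalizable A"
proof -
  obtain B where B: "independent B" "card B = CARD('n)"
      "\<forall>b\<in>B. \<exists>\<kappa>. A *v b = \<kappa> *\<^sub>R b"
    using simultaneous_diagonalization_subspace[OF assms, of UNIV] by auto
  have fB: "finite B" using B(1) by (rule independent_imp_finite)
  obtain e :: "'n \<Rightarrow> _" where e: "bij_betw e UNIV B"
    using finite_same_card_bij[of "UNIV :: 'n set" B] fB B(2) by auto
  obtain \<kappa>0 where \<kappa>0: "\<And>b. b \<in> B \<Longrightarrow> A *v b = \<kappa>0 b *\<^sub>R b" using B(3) by metis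
  have eB: "e i \<in> B" for i using e by (auto simp: bij_betw_def)
  define E where "E = (\<chi> i j. e j $ i)"
  have col: "column j E = e j" for j by (simp add: column_def E_def vec_eq_iff)
  have "c i = 0" if "(\<Sum>i\<in>UNIV. c i *s column i E) = 0" for c i
  proof -
    have "(\<Sum>b\<in>B. c (inv_into UNIV e b) *\<^sub>R b) = (\<Sum>i\<in>UNIV. c i *s column i E)"
      using e by (subst sum.reindex_bij_betw[OF e, symmetric])
        (simp add: col scalar_mult_eq_scaleR bij_betw_def)
    then have "(\<Sum>b\<in>B. c (inv_into UNIV e b) *\<^sub>R b) = 0" using that by simp
    from independentD[OF B(1) fB subset_refl this eB] show ?thesis
      using e by (simp add: bij_betw_def)
  qed
  then have "\<exists>E'. E' ** E = mat 1"
    unfolding matrix_left_invertible_independent_columns by blast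
  then obtain E' :: "real^'n^'n" where E': "E' ** E = mat 1" ..
  then have E2: "E ** E' = mat 1" using matrix_left_right_inverse by blast
  have "A ** E = E ** diag_mat (\<lambda>i. \<kappa>0 (e i))"
  proof -
    have "(A ** E) $ i $ j = (E ** diag_mat (\<lambda>i. \<kappa>0 (e i))) $ i $ j" for i j
    proof -
      have "(A ** E) $ i $ j = (A *v e j) $ i"
        by (simp add: matrix_matrix_mult_def matrix_vector_mult_def E_def)
      also have "\<dots> = e j $ i * \<kappa>0 (e j)" by (simp add: \<kappa>0[OF eB])
      also have "\<dots> = (\<Sum>k\<in>UNIV. if k = j then e j $ i * \<kappa>0 (e j) else 0)" by simp
      also have "\<dots> = (E ** diag_mat (\<lambda>i. \<kappa>0 (e i))) $ i $ j"
        unfolding matrix_matrix_mult_def diag_mat_def E_def vec_lambda_beta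
        by (intro sum.cong) auto
      finally show ?thesis .
    qed
    then show ?thesis by (simp add: vec_eq_iff)
  qed
  then have "A = E ** diag_mat (\<lambda>i. \<kappa>0 (e i)) ** E'"
    by (metis E2 matrix_mul_assoc matrix_mul_rid)
  with E' E2 show ?thesis unfolding diagonalizable_def by (intro exI conjI)
qed

text \<open>This is det (1 + t A) as a polynomial in t when \<kappa> lists the eigenvalues of A,
  that is, the characteristic polynomial with reversed coefficients and adjusted signs. Its
  coefficient of t^r is S_r.\<close>

definition charpoly_sym :: "('n::finite \<Rightarrow> real) \<Rightarrow> real poly" where
  "charpoly_sym \<kappa> = (\<Prod>i\<in>UNIV. [:1, \<kappa> i:])"

text \<open>The coefficients are the elementary symmetric functions of all eigenvalues except the
  i-th. By \<open>newton_mat_eq\<close> they are the eigenvalues of the Newton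
  transformations.\<close>

definition charpoly_sym_minus :: "('n::finite \<Rightarrow> real) \<Rightarrow> 'n \<Rightarrow> real poly" where
  "charpoly_sym_minus \<kappa> i = (\<Prod>j\<in>UNIV - {i}. [:1, \<kappa> j:])"

lemma charpoly_sym_factor: "charpoly_sym \<kappa> = [:1, \<kappa> i:] * charpoly_sym_minus \<kappa> i"
  unfolding charpoly_sym_def charpoly_sym_minus_def by (subst prod.remove[of _ i]) auto

lemma elem_sym_eq_coeff: "elem_sym r \<kappa> = coeff (charpoly_sym \<kappa>) r"
proof -
  have m: "(\<Prod>i\<in>X. [:0, \<kappa> i:]) = monom (\<Prod>i\<in>X. \<kappa> i) (card X)" for X :: "'a set"
    by (induction X rule: infinite_finite_induct) (auto simp: monom_altdef mult.commute)
  have "charpoly_sym \<kappa> = (\<Prod>i\<in>UNIV. [:0, \<kappa> i:] + 1)"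
    by (simp add: charpoly_sym_def one_pCons)
  also have "\<dots> = (\<Sum>X\<in>UNIV. monom (\<Prod>i\<in>X. \<kappa> i) (card X))"
    by (subst prod_add) (simp_all add: m)
  finally have "coeff (charpoly_sym \<kappa>) r = (\<Sum>X\<in>UNIV. if card X = r then \<Prod>i\<in>X. \<kappa> i else 0)"
    by (simp add: coeff_sum)
  also have "\<dots> = elem_sym r \<kappa>"
    unfolding elem_sym_def by (subst sum.inter_filter[symmetric]) auto
  finally show ?thesis ..
qed

lemma degree_linear_le: "degree [:a, b:] \<le> Suc 0"
  by simp

lemma degree_charpoly_sym: "degree (charpoly_sym (\<kappa> :: 'n::finite \<Rightarrow> real)) \<le> CARD('n)"
proof -
  have "degree (charpoly_sym \<kappa>) \<le> (\<Sum>i\<in>(UNIV::'n set). 1)"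
    unfolding charpoly_sym_def
    by (rule order.trans[OF degree_prod_sum_le]) (auto intro!: sum_mono degree_linear_le simp del: sum_constant degree_pCons_eq_if)
  then show ?thesis by simp
qed

lemma degree_charpoly_sym_minus: "degree (charpoly_sym_minus (\<kappa> :: 'n::finite \<Rightarrow> real) i) < CARD('n)"
proof -
  have "degree (charpoly_sym_minus \<kappa> i) \<le> (\<Sum>i\<in>(UNIV::'n set) - {i}. 1)"
    unfolding charpoly_sym_minus_def
    by (rule order.trans[OF degree_prod_sum_le]) (auto intro!: sum_mono degree_linear_le simp del: sum_constant degree_pCons_eq_if)
  also have "\<dots> < CARD('n)" by (simp add: card_Diff_singleton)
  finally show ?thesis by simp
qed

lemma coeff_charpoly_sym_minus_Suc:
  "coeff (charpoly_sym_minus \<kappa> i) (Suc r)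
    = coeff (charpoly_sym \<kappa>) (Suc r) - \<kappa> i * coeff (charpoly_sym_minus \<kappa> i) r"
  by (simp add: charpoly_sym_factor[of _ i])

text \<open>Compare coefficients in the product rule for the derivative of
  \<open>charpoly_sym\<close>.\<close>

lemma newton_identity_coeff:
  "(\<Sum>i\<in>UNIV. \<kappa> i * coeff (charpoly_sym_minus \<kappa> i) r)
    = real (Suc r) * coeff (charpoly_sym \<kappa>) (Suc r)"
proof -
  have "pderiv (charpoly_sym \<kappa>) = (\<Sum>i\<in>UNIV. charpoly_sym_minus \<kappa> i * [:\<kappa> i:])"
    unfolding charpoly_sym_def charpoly_sym_minus_def by (simp add: pderiv_prod pderiv_pCons)
  then have "coeff (pderiv (charpoly_sym \<kappa>)) r
      = (\<Sum>i\<in>UNIV. \<kappa> i * coeff (charpoly_sym_minus \<kappa> i) r)"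
    by (simp add: coeff_sum)
  then show ?thesis by (simp add: coeff_pderiv)
qed

lemma poly_charpoly_sym: "poly (charpoly_sym \<kappa>) t = (\<Prod>i\<in>UNIV. 1 + t * \<kappa> i)"
  by (simp add: charpoly_sym_def poly_prod)

lemma poly_eqI_infinite:
  fixes p q :: "'a::idom poly"
  assumes "infinite A" "\<And>t. t \<in> A \<Longrightarrow> poly p t = poly q t"
  shows "p = q"
proof (rule ccontr)
  assume "p \<noteq> q"
  then have "finite {t. poly (p - q) t = 0}" by (intro poly_roots_finite) simp
  moreover have "A \<subseteq> {t. poly (p - q) t = 0}" using assms(2) by auto
  ultimately show False using assms(1) finite_subset by blast
qed

text \<open>For nonzero t, \<open>charpoly_sym\<close> at t is (-t)^n times the characteristic
  polynomial at -1/t. Agreement on this infinite set of t identifies the polynomials.\<close>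

lemma charpoly_sym_eqI:
  fixes \<kappa> \<kappa>' :: "'n::finite \<Rightarrow> real"
  assumes "\<And>t. (\<Prod>i\<in>UNIV. t - \<kappa> i) = (\<Prod>i\<in>UNIV. t - \<kappa>' i)"
  shows "charpoly_sym \<kappa> = charpoly_sym \<kappa>'"
proof (rule poly_eqI_infinite[where A="UNIV - {0}"])
  fix t :: real assume t: "t \<in> UNIV - {0}"
  have "(\<Prod>i\<in>UNIV. 1 + t * \<mu> i) = (- t) ^ CARD('n) * (\<Prod>i\<in>UNIV. - 1 / t - \<mu> i)" for \<mu> :: "'n \<Rightarrow> real"
  proof -
    have "(- t) ^ CARD('n) * (\<Prod>i\<in>UNIV. - 1 / t - \<mu> i) = (\<Prod>i\<in>UNIV. (- t) * (- 1 / t - \<mu> i))"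
      by (subst prod.distrib) simp
    also have "\<dots> = (\<Prod>i\<in>UNIV. 1 + t * \<mu> i)"
      using t by (intro prod.cong) (auto simp: field_simps)
    finally show ?thesis ..
  qed
  from this[of \<kappa>] this[of \<kappa>'] show "poly (charpoly_sym \<kappa>) t = poly (charpoly_sym \<kappa>') t"
    using assms[of "- 1 / t"] by (simp only: poly_charpoly_sym)
qed (auto simp: infinite_UNIV_char_0)

lemma poly_eq_sum_atMost:
  fixes p :: "real poly"
  assumes "degree p \<le> n"
  shows "poly p t = (\<Sum>r\<le>n. coeff p r * t ^ r)"
  using poly_altdef[of p t] assms
  by (simp, intro sum.mono_neutral_left) (auto simp: coeff_eq_0)

text \<open>Charts enter \<open>S_curv\<close> and \<open>newton\<close> only through the matrix of
  the shape operator, so the algebra is done for a single matrix.\<close>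

definition sym_curv :: "real^'n^'n \<Rightarrow> nat \<Rightarrow> real" where
  "sym_curv A r = elem_sym r (eigenvalues A)"

primrec newton_mat :: "real^'n^'n \<Rightarrow> nat \<Rightarrow> real^'n^'n" where
  "newton_mat A 0 = mat 1"
| "newton_mat A (Suc r) = mat (sym_curv A (Suc r)) - A ** newton_mat A r"

lemma newton_eq_newton_mat: "newton c x N r p = newton_mat (shape_operator c x N p) r"
  by (induction r) (simp_all add: S_curv_def sym_curv_def)

text \<open>For fixed \<open>E\<close> the map \<open>D\<close> defined below turns pointwise
  operations on functions of the index into matrix operations. Identities for \<open>A\<close>
  thereby reduce to identities for the numbers \<kappa> i.\<close>

locale diagonalized =
  fixes E E' :: "real^'n^'n" and \<kappa> :: "'n \<Rightarrow> real" and A :: "real^'n^'n"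
  assumes EE': "E ** E' = mat 1" and E'E: "E' ** E = mat 1" and A: "A = E ** diag_mat \<kappa> ** E'"
begin

definition D :: "('n \<Rightarrow> real) \<Rightarrow> real^'n^'n" where "D f = E ** diag_mat f ** E'"

lemma D_mult: "D f ** D g = D (\<lambda>i. f i * g i)"
proof -
  have "D f ** D g = E ** diag_mat f ** (E' ** E) ** diag_mat g ** E'"
    by (simp add: D_def matrix_mul_assoc)
  also have "\<dots> = E ** (diag_mat f ** diag_mat g) ** E'"
    by (simp add: E'E matrix_mul_assoc)
  finally show ?thesis by (simp add: diag_mat_mult D_def)
qed

lemma D_add: "D f + D g = D (\<lambda>i. f i + g i)"
proof -
  have "diag_mat f + diag_mat g = diag_mat (\<lambda>i. f i + g i)"
    by (simp add: diag_mat_def vec_eq_iff)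
  then show ?thesis unfolding D_def
    by (metis matrix_add_ldistrib matrix_add_rdistrib)
qed

lemma D_scaleR: "t *\<^sub>R D f = D (\<lambda>i. t * f i)"
proof -
  have "t *\<^sub>R diag_mat f = diag_mat (\<lambda>i. t * f i)"
    by (simp add: diag_mat_def vec_eq_iff)
  then show ?thesis unfolding D_def by (metis matrix_mult_scaleR_left matrix_mult_scaleR_right)
qed

lemma D_diff: "D f - D g = D (\<lambda>i. f i - g i)"
  using D_add[of f "\<lambda>i. - 1 * g i"] D_scaleR[of "-1" g] by (simp flip: add_uminus_conv_diff)

lemma D_mat: "mat t = D (\<lambda>_. t)"
proof -
  have "mat t = t *\<^sub>R (mat 1 :: real^'n^'n)" by (simp add: mat_def vec_eq_iff)
  also have "mat 1 = D (\<lambda>_. 1)"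
    using EE' by (simp add: D_def diag_mat_def mat_def[symmetric])
  finally show ?thesis by (simp add: D_scaleR)
qed

lemma D_sum: "(\<Sum>i\<in>I. D (f i)) = D (\<lambda>k. \<Sum>i\<in>I. f i k)"
proof (induction I rule: infinite_finite_induct)
  case (insert x F)
  then show ?case by (simp add: D_add)
qed (simp_all add: D_mat[symmetric] mat_def vec_eq_iff)

lemma trace_D: "trace (D f) = (\<Sum>i\<in>UNIV. f i)"
proof -
  have "trace (D f) = trace (E' ** (E ** diag_mat f))"
    unfolding D_def by (rule trace_mul_sym)
  also have "E' ** (E ** diag_mat f) = diag_mat f"
    by (simp add: matrix_mul_assoc E'E)
  finally show ?thesis by (simp add: trace_def diag_mat_def)
qed

lemma det_D: "det (D f) = (\<Prod>i\<in>UNIV. f i)"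
proof -
  have "det E * det E' = 1" using EE' by (metis det_I det_mul)
  then have "det (D f) = det (diag_mat f)" by (simp add: D_def det_mul)
  then show ?thesis by (simp add: det_diagonal diag_mat_def)
qed

lemma A_eq_D: "A = D \<kappa>"
  by (simp add: A D_def)

text \<open>\<open>eigenvalues\<close> is some enumeration and need not coincide with \<kappa>, but
  both have the same characteristic polynomial and therefore the same symmetric functions.\<close>

lemma charpoly_sym_eigenvalues: "charpoly_sym (eigenvalues A) = charpoly_sym \<kappa>"
proof (rule charpoly_sym_eqI)
  have "\<forall>t. det (mat t - A) = (\<Prod>i\<in>UNIV. t - \<kappa> i)"
    by (simp add: A_eq_D D_mat D_diff det_D)
  then have "\<forall>t. det (mat t - A) = (\<Prod>i\<in>UNIV. t - eigenvalues A i)"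
    unfolding eigenvalues_def by (rule someI[where P="\<lambda>\<kappa>. \<forall>t. det (mat t - A) = (\<Prod>i\<in>UNIV. t - \<kappa> i)"])
  then show "(\<Prod>i\<in>UNIV. t - eigenvalues A i) = (\<Prod>i\<in>UNIV. t - \<kappa> i)" for t
    by (simp add: A_eq_D D_mat D_diff det_D)
qed

lemma sym_curv_eq: "sym_curv A r = coeff (charpoly_sym \<kappa>) r"
  by (simp add: sym_curv_def elem_sym_eq_coeff charpoly_sym_eigenvalues)

lemma newton_mat_eq: "newton_mat A r = D (\<lambda>i. coeff (charpoly_sym_minus \<kappa> i) r)"
proof (induction r)
  case 0
  have "coeff (charpoly_sym_minus \<kappa> i) 0 = 1" for i
    by (simp add: poly_0_coeff_0[symmetric] charpoly_sym_minus_def poly_prod)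
  then show ?case by (simp add: D_mat)
next
  case (Suc r)
  then show ?case
    by (simp add: coeff_charpoly_sym_minus_Suc sym_curv_eq D_mat D_diff)
      (simp add: A_eq_D D_mult D_diff)
qed

end

context
  fixes A :: "real^'n^'n"
  assumes A: "diagonalizable A"
begin

lemma obtain_diagonalized:
  obtains E E' \<kappa> where "diagonalized E E' \<kappa> A"
  using A unfolding diagonalizable_def diagonalized_def by blast

text \<open>Together with the recursion for \<open>newton_mat\<close> this computes S_{r+1} as a
  polynomial in the entries of A. The dependence on a choice of eigenvalues disappears, which is the
  source of smoothness later on.\<close>

lemma sym_curv_Suc: "real (Suc r) * sym_curv A (Suc r) = trace (A ** newton_mat A r)"
proof -
  obtain E E' \<kappa> where "diagonalized E E' \<kappa> A" by (rule obtain_diagonalized)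
  then interpret diagonalized E E' \<kappa> A .
  show ?thesis
    unfolding sym_curv_eq newton_mat_eq newton_identity_coeff[symmetric]
    by (simp add: A_eq_D D_mult trace_D)
qed

lemma sym_curv_0: "sym_curv A 0 = 1"
proof -
  obtain E E' \<kappa> where "diagonalized E E' \<kappa> A" by (rule obtain_diagonalized)
  then interpret diagonalized E E' \<kappa> A .
  show ?thesis
    unfolding sym_curv_eq by (simp add: poly_0_coeff_0[symmetric] poly_charpoly_sym)
qed

lemma sym_curv_1: "sym_curv A 1 = trace A"
  using sym_curv_Suc[of 0] by simp

lemma newton_mat_commute: "A ** newton_mat A r = newton_mat A r ** A"
proof -
  obtain E E' \<kappa> where "diagonalized E E' \<kappa> A" by (rule obtain_diagonalized)
  then interpret diagonalized E E' \<kappa> A .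
  show ?thesis unfolding newton_mat_eq by (simp add: A_eq_D D_mult mult.commute)
qed

lemma det_mat_1_plus: "det (mat 1 + t *\<^sub>R A) = (\<Sum>r\<le>CARD('n). sym_curv A r * t ^ r)"
proof -
  obtain E E' \<kappa> where "diagonalized E E' \<kappa> A" by (rule obtain_diagonalized)
  then interpret diagonalized E E' \<kappa> A .
  show ?thesis
    unfolding sym_curv_eq poly_eq_sum_atMost[OF degree_charpoly_sym, symmetric] poly_charpoly_sym
    by (simp add: A_eq_D D_mat D_add D_scaleR det_D)
qed

text \<open>The P_r are the coefficients of the adjugate of 1 + t A, whose entries have degree less
  than n in t; this is why the sum stops before n.\<close>

lemma adjugate_mat_1_plus:
  "(mat 1 + t *\<^sub>R A) ** (\<Sum>r<CARD('n). t ^ r *\<^sub>R newton_mat A r) = mat (det (mat 1 + t *\<^sub>R A))"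
proof -
  obtain E E' \<kappa> where "diagonalized E E' \<kappa> A" by (rule obtain_diagonalized)
  then interpret diagonalized E E' \<kappa> A .
  have p: "(\<Sum>r<CARD('n). t ^ r * coeff (charpoly_sym_minus \<kappa> i) r) = poly (charpoly_sym_minus \<kappa> i) t" for i
    using degree_charpoly_sym_minus[of \<kappa> i]
    by (subst poly_eq_sum_atMost[of _ "CARD('n) - 1"])
      (auto simp: mult.commute lessThan_Suc_atMost[symmetric] simp del: lessThan_Suc)
  have e: "(\<Sum>r<CARD('n). t ^ r *\<^sub>R newton_mat A r) = D (\<lambda>i. poly (charpoly_sym_minus \<kappa> i) t)"
    unfolding newton_mat_eq by (simp add: D_scaleR D_sum p)
  have "(1 + t * \<kappa> i) * poly (charpoly_sym_minus \<kappa> i) t = (\<Prod>i\<in>UNIV. 1 + t * \<kappa> i)" for i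
    unfolding poly_charpoly_sym[symmetric] by (simp add: charpoly_sym_factor[of \<kappa> i] algebra_simps)
  moreover have "mat 1 + t *\<^sub>R A = D (\<lambda>i. 1 + t * \<kappa> i)"
    by (simp add: A_eq_D D_scaleR D_mat D_add)
  ultimately show ?thesis unfolding e by (simp add: det_D D_mult D_mat)
qed

text \<open>The quantity n tr (A^2) - (tr A)^2 is n times the sum of the squared deviations of the
  eigenvalues from their mean.\<close>

lemma trace_square_ge:
  "(trace A)\<^sup>2 \<le> CARD('n) * trace (A ** A)"
  "(trace A)\<^sup>2 = CARD('n) * trace (A ** A) \<Longrightarrow> A = mat (trace A / CARD('n))"
proof -
  obtain E E' \<kappa> where "diagonalized E E' \<kappa> A" by (rule obtain_diagonalized)
  then interpret diagonalized E E' \<kappa> A .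
  define n where "n = real CARD('n)"
  have n: "n > 0" by (simp add: n_def)
  define m where "m = (\<Sum>i\<in>UNIV. \<kappa> i) / n"
  have tr: "trace A = n * m" "trace (A ** A) = (\<Sum>i\<in>UNIV. \<kappa> i * \<kappa> i)"
    using n by (simp_all add: A_eq_D trace_D D_mult m_def)
  have "(\<Sum>i\<in>UNIV. (\<kappa> i - m)\<^sup>2) = (\<Sum>i\<in>UNIV. \<kappa> i * \<kappa> i - 2 * m * \<kappa> i + m * m)"
    by (intro sum.cong) (simp_all add: power2_eq_square algebra_simps)
  also have "\<dots> = (\<Sum>i\<in>UNIV. \<kappa> i * \<kappa> i) - 2 * m * (\<Sum>i\<in>UNIV. \<kappa> i) + n * (m * m)"
    by (simp add: sum.distrib sum_subtractf sum_distrib_left n_def)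
  also have "(\<Sum>i\<in>UNIV. \<kappa> i) = n * m" using n by (simp add: m_def)
  finally have key: "n * trace (A ** A) - (trace A)\<^sup>2 = n * (\<Sum>i\<in>UNIV. (\<kappa> i - m)\<^sup>2)"
    unfolding tr by (simp add: power2_eq_square right_diff_distrib distrib_left)
  moreover have "0 \<le> n * (\<Sum>i\<in>UNIV. (\<kappa> i - m)\<^sup>2)" using n by (simp add: sum_nonneg)
  ultimately show "(trace A)\<^sup>2 \<le> CARD('n) * trace (A ** A)" by (simp add: n_def)
  assume "(trace A)\<^sup>2 = CARD('n) * trace (A ** A)"
  then have "(\<Sum>i\<in>UNIV. (\<kappa> i - m)\<^sup>2) = 0" using key n by (simp add: n_def)
  then have "\<kappa> i = m" for i by (simp add: sum_nonneg_eq_0_iff)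
  then have "\<kappa> = (\<lambda>_. m)" by auto
  then have "A = mat m" by (simp add: A_eq_D D_mat)
  then show "A = mat (trace A / CARD('n))" using tr(1) n by (simp add: n_def)
qed

end


text \<open>Jacobi's formula with an inverse in place of the adjugate. The product rule gives a sum
  of determinants, each with one row differentiated; multiplying that row by \<open>R\<close> writes
  it as a combination of the rows of \<open>M y\<close>, and Cramer's rule evaluates the
  determinant.\<close>

lemma has_derivative_det:
  fixes M :: "'e::real_normed_vector \<Rightarrow> real^'n^'n"
  assumes M': "\<And>i j. ((\<lambda>y. M y $ i $ j) has_derivative M' i j) (at y)" and R: "R ** M y = mat 1"
  shows "((\<lambda>y. det (M y)) has_derivative
    (\<lambda>v. det (M y) * (\<Sum>i\<in>UNIV. \<Sum>j\<in>UNIV. M' i j v * R $ j $ i))) (at y)"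
proof -
  define B where "B v i = (\<chi> k. if k = i then (\<chi> l. M' i l v) else M y $ k)" for v i
  have *: "(\<Sum>p | p permutes UNIV. of_int (sign p) *
      (\<Sum>i\<in>UNIV. M' i (p i) v * (\<Prod>j\<in>UNIV - {i}. M y $ j $ p j)))
    = det (M y) * (\<Sum>i\<in>UNIV. \<Sum>j\<in>UNIV. M' i j v * R $ j $ i)" for v
  proof -
    have "(\<Sum>p | p permutes UNIV. of_int (sign p) *
        (\<Sum>i\<in>UNIV. M' i (p i) v * (\<Prod>j\<in>UNIV - {i}. M y $ j $ p j)))
      = (\<Sum>i\<in>UNIV. \<Sum>p | p permutes UNIV. of_int (sign p) *
          (M' i (p i) v * (\<Prod>j\<in>UNIV - {i}. M y $ j $ p j)))"
      by (subst sum.swap) (simp add: sum_distrib_left)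
    also have "\<dots> = (\<Sum>i\<in>UNIV. det (B v i))"
    proof (intro sum.cong refl)
      fix i
      have "M' i (p i) v * (\<Prod>j\<in>UNIV - {i}. M y $ j $ p j) = (\<Prod>j\<in>UNIV. B v i $ j $ p j)" for p
        by (subst prod.remove[of UNIV i]) (auto simp: B_def intro!: prod.cong)
      then show "(\<Sum>p | p permutes UNIV. of_int (sign p) *
          (M' i (p i) v * (\<Prod>j\<in>UNIV - {i}. M y $ j $ p j))) = det (B v i)"
        by (simp add: det_def)
    qed
    also have "\<dots> = (\<Sum>i\<in>UNIV. (\<Sum>j\<in>UNIV. M' i j v * R $ j $ i) * det (M y))"
    proof (intro sum.cong refl)
      fix i
      define x where "x = (\<chi> l. M' i l v) v* R"
      have "(\<Sum>k\<in>UNIV. x $ k *s row k (M y)) = x v* M y"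
        by (simp add: vec_eq_iff vector_matrix_mult_def row_def mult.commute)
      also have "\<dots> = (\<chi> l. M' i l v)"
        unfolding x_def vector_matrix_mul_assoc R by simp
      finally have "det (B v i) = x $ i * det (M y)"
        using cramer_lemma_transpose[of i x "M y"] by (simp add: B_def row_def cong: if_cong)
      then show "det (B v i) = (\<Sum>j\<in>UNIV. M' i j v * R $ j $ i) * det (M y)"
        by (simp add: x_def vector_matrix_mult_def mult.commute)
    qed
    finally show ?thesis by (simp add: sum_distrib_left mult.commute)
  qed
  have "((\<lambda>y. \<Sum>p | p permutes UNIV. of_int (sign p) * (\<Prod>i\<in>UNIV. M y $ i $ p i)) has_derivative
    (\<lambda>v. \<Sum>p | p permutes UNIV. of_int (sign p) *
      (\<Sum>i\<in>UNIV. M' i (p i) v * (\<Prod>j\<in>UNIV - {i}. M y $ j $ p j)))) (at y)"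
    by (rule has_derivative_sum has_derivative_mult_right has_derivative_prod M')+
  then show ?thesis unfolding * det_def[symmetric] .
qed

lemma Ck_on_det:
  fixes M :: "'e::euclidean_space \<Rightarrow> real^'n^'n"
  assumes "open S" "\<And>i j. Ck_on k S (\<lambda>y. M y $ i $ j)"
  shows "Ck_on k S (\<lambda>y. det (M y))"
  unfolding det_def by (intro Ck_on_sum Ck_on_mult Ck_on_prod assms Ck_on_const)

lemma matrix_inv_left_right:
  fixes M :: "real^'n^'n"
  assumes "det M \<noteq> 0"
  shows "matrix_inv M ** M = mat 1" "M ** matrix_inv M = mat 1"
  using assms invertible_det_nz[of M] matrix_left_right_inverse[of M]
    someI_ex[of "\<lambda>A'. M ** A' = mat 1 \<and> A' ** M = mat 1"]
  unfolding invertible_def matrix_inv_def by auto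

text \<open>Cramer's rule presents the entries of the inverse as rational functions of the entries
  of the matrix, the form in which regularity is inherited.\<close>

lemma matrix_inv_component:
  fixes M :: "real^'n^'n"
  assumes "det M \<noteq> 0"
  shows "matrix_inv M $ i $ j = det (\<chi> a b. if b = i then mat 1 $ a $ j else M $ a $ b) * inverse (det M)"
proof -
  have "M *v column j (matrix_inv M) = column j (mat 1)"
    using matrix_inv_left_right(2)[OF assms]
    by (metis matrix_vector_mul_assoc matrix_vector_mult_basis)
  then have "column j (matrix_inv M) = (\<chi> k. det (\<chi> a b. if b = k then column j (mat 1) $ a else M $ a $ b) / det M)"
    using cramer[OF assms] by blast
  then have "column j (matrix_inv M) $ i
      = det (\<chi> a b. if b = i then column j (mat 1) $ a else M $ a $ b) / det M"
    by (metis (no_types, lifting) vec_lambda_beta)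
  then show ?thesis by (simp add: column_def divide_inverse cong: if_cong)
qed

lemma Ck_on_matrix_inv:
  fixes M :: "'e::euclidean_space \<Rightarrow> real^'n^'n"
  assumes "open S" "\<And>i j. Ck_on k S (\<lambda>y. M y $ i $ j)" "\<And>y. y \<in> S \<Longrightarrow> det (M y) \<noteq> 0"
  shows "Ck_on k S (\<lambda>y. matrix_inv (M y) $ i $ j)"
proof (rule Ck_on_cong[OF assms(1), rotated])
  have "Ck_on k S (\<lambda>y. (\<chi> a b. if b = i then mat 1 $ a $ j else M y $ a $ b) $ a $ b)" for a b
    using assms(2) by (cases "b = i") simp_all
  then show "Ck_on k S (\<lambda>y. det (\<chi> a b. if b = i then mat 1 $ a $ j else M y $ a $ b) * inverse (det (M y)))"
    by (intro Ck_on_mult Ck_on_inverse Ck_on_det assms)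
qed (simp add: matrix_inv_component assms)

text \<open>The two claims need each other: S_{r+1} is the trace of A P_r divided by r + 1, and
  P_{r+1} contains S_{r+1}.\<close>

lemma Ck_on_sym_curv_newton_mat:
  fixes A :: "'e::euclidean_space \<Rightarrow> real^'n^'n"
  assumes S: "open S" and A: "\<And>i j. Ck_on k S (\<lambda>y. A y $ i $ j)"
    and dA: "\<And>y. y \<in> S \<Longrightarrow> diagonalizable (A y)"
  shows "Ck_on k S (\<lambda>y. sym_curv (A y) r) \<and> (\<forall>i j. Ck_on k S (\<lambda>y. newton_mat (A y) r $ i $ j))"
proof (induction r)
  case 0
  have "Ck_on k S (\<lambda>y. sym_curv (A y) 0)"
    by (rule Ck_on_cong[OF S, of "\<lambda>_. 1"]) (simp_all add: sym_curv_0 dA)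
  then show ?case by simp
next
  case (Suc r)
  have 1: "Ck_on k S (\<lambda>y. sym_curv (A y) (Suc r))"
  proof (rule Ck_on_cong[OF S])
    show "Ck_on k S (\<lambda>y. inverse (real (Suc r)) *
        (\<Sum>i\<in>UNIV. \<Sum>j\<in>UNIV. A y $ i $ j * newton_mat (A y) r $ j $ i))"
      using Suc by (intro Ck_on_mult Ck_on_sum Ck_on_const S A) auto
    show "inverse (real (Suc r)) *
        (\<Sum>i\<in>UNIV. \<Sum>j\<in>UNIV. A y $ i $ j * newton_mat (A y) r $ j $ i) = sym_curv (A y) (Suc r)"
      if "y \<in> S" for y
      using arg_cong[OF sym_curv_Suc[OF dA[OF that], of r], of "\<lambda>s. inverse (real (Suc r)) * s"]
      by (simp add: trace_def matrix_matrix_mult_def mult.assoc[symmetric] del: of_nat_Suc)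
  qed
  have "Ck_on k S (\<lambda>y. (if i = j then sym_curv (A y) (Suc r) else 0)
      - (\<Sum>l\<in>UNIV. A y $ i $ l * newton_mat (A y) r $ l $ j))" for i j
    using Suc 1 by (cases "i = j") (auto intro!: Ck_on_diff Ck_on_minus Ck_on_sum Ck_on_mult S A)
  then show ?case using 1 by (simp add: mat_def matrix_matrix_mult_def)
qed

lemmas Ck_on_sym_curv = Ck_on_sym_curv_newton_mat[THEN conjunct1]
lemmas Ck_on_newton_mat = Ck_on_sym_curv_newton_mat[THEN conjunct2, rule_format]

text \<open>Eigenvalues may fail to be differentiable where they cross, so det (1 + t A) is
  differentiated instead, once through its coefficients S_r and once by Jacobi's formula with the
  adjugate sum of t^r P_r. Comparing the coefficients of t^{r+1} yields dS_{r+1} = tr (dA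
  P_r).\<close>

lemma frechet_derivative_sym_curv:
  fixes A :: "'e::euclidean_space \<Rightarrow> real^'n^'n"
  assumes S: "open S" and A: "\<And>i j. Ck_on 1 S (\<lambda>y. A y $ i $ j)"
    and dA: "\<And>y. y \<in> S \<Longrightarrow> diagonalizable (A y)" and y: "y \<in> S" and r: "r < CARD('n)"
  shows "frechet_derivative (\<lambda>y. sym_curv (A y) (Suc r)) (at y) v
    = (\<Sum>i\<in>UNIV. \<Sum>j\<in>UNIV. frechet_derivative (\<lambda>y. A y $ i $ j) (at y) v * newton_mat (A y) r $ j $ i)"
proof -
  define s where "s r = frechet_derivative (\<lambda>y. sym_curv (A y) r) (at y)" for r
  define a where "a i j = frechet_derivative (\<lambda>y. A y $ i $ j) (at y)" for i j
  define c where "c r = (\<Sum>i\<in>UNIV. \<Sum>j\<in>UNIV. a i j v * newton_mat (A y) r $ j $ i)" for r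
  have ds: "((\<lambda>y. sym_curv (A y) r) has_derivative s r) (at y)" for r
    using Ck_on_sym_curv[OF S A dA, of r] y unfolding s_def
    by (intro has_frechet_derivative) simp
  have da: "((\<lambda>y. A y $ i $ j) has_derivative a i j) (at y)" for i j
    using A[of i j] y unfolding a_def by (intro has_frechet_derivative) simp
  define p where "p = (\<Sum>r\<le>CARD('n). monom (s r v) r)"
  define q where "q = (\<Sum>r<CARD('n). monom (c r) (Suc r))"
  \<comment> \<open>Jacobi's formula is stated with an inverse, so only parameters with 1 + t A
    invertible are compared. The others are roots of a polynomial with value 1 at 0, hence finitely
    many.\<close>
  have eq: "poly p t = poly q t" if t: "det (mat 1 + t *\<^sub>R A y) \<noteq> 0" for t
  proof -
    define d where "d = det (mat 1 + t *\<^sub>R A y)"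
    define R where "R = (1 / d) *\<^sub>R (\<Sum>r<CARD('n). t ^ r *\<^sub>R newton_mat (A y) r)"
    have "(mat 1 + t *\<^sub>R A y) ** R = mat 1"
      using adjugate_mat_1_plus[OF dA[OF y], of t] t
      by (simp add: R_def matrix_mult_scaleR_right d_def) (simp add: mat_def vec_eq_iff)
    then have R: "R ** (mat 1 + t *\<^sub>R A y) = mat 1" using matrix_left_right_inverse by blast
    have "((\<lambda>z. (mat 1 + t *\<^sub>R A z) $ i $ j) has_derivative (\<lambda>v. t * a i j v)) (at y)" for i j
    proof -
      have "((\<lambda>z. mat 1 $ i $ j + t * A z $ i $ j) has_derivative (\<lambda>v. 0 + t * a i j v)) (at y)"
        by (intro has_derivative_add has_derivative_const has_derivative_mult_right da)
      then show ?thesis by simp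
    qed
    from has_derivative_det[where M="\<lambda>z. mat 1 + t *\<^sub>R A z", OF this R]
    have D1: "((\<lambda>z. det (mat 1 + t *\<^sub>R A z)) has_derivative
        (\<lambda>v. d * (\<Sum>i\<in>UNIV. \<Sum>j\<in>UNIV. t * a i j v * R $ j $ i))) (at y)"
      by (simp add: d_def)
    have D2: "((\<lambda>z. \<Sum>r\<le>CARD('n). sym_curv (A z) r * t ^ r) has_derivative
        (\<lambda>v. \<Sum>r\<le>CARD('n). s r v * t ^ r)) (at y)"
      by (intro has_derivative_sum has_derivative_mult_left ds)
    have "((\<lambda>z. det (mat 1 + t *\<^sub>R A z)) has_derivative
        (\<lambda>v. \<Sum>r\<le>CARD('n). s r v * t ^ r)) (at y)"
      by (rule has_derivative_transform_within_open[OF D2 S y]) (simp add: det_mat_1_plus dA)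
    from fun_cong[OF has_derivative_unique[OF this D1], of v]
    have "(\<Sum>r\<le>CARD('n). s r v * t ^ r) = d * (\<Sum>i\<in>UNIV. \<Sum>j\<in>UNIV. t * a i j v * R $ j $ i)"
      .
    also have "\<dots> = (\<Sum>i\<in>UNIV. \<Sum>j\<in>UNIV. (t * a i j v) * (d * R $ j $ i))"
      unfolding sum_distrib_left by (intro sum.cong refl) (simp add: mult.left_commute)
    also have "\<dots> = (\<Sum>i\<in>UNIV. \<Sum>j\<in>UNIV. \<Sum>r<CARD('n). t ^ Suc r * (a i j v * newton_mat (A y) r $ j $ i))"
    proof -
      have "d * R $ j $ i = (\<Sum>r<CARD('n). t ^ r * newton_mat (A y) r $ j $ i)" for i j
        using t unfolding d_def[symmetric] R_def by simp
      then show ?thesis unfolding sum_distrib_left by (intro sum.cong refl) (simp add: sum_distrib_left mult_ac)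
    qed
    also have "\<dots> = (\<Sum>i\<in>UNIV. \<Sum>r<CARD('n). \<Sum>j\<in>UNIV. t ^ Suc r * (a i j v * newton_mat (A y) r $ j $ i))"
      by (intro sum.cong refl sum.swap)
    also have "\<dots> = (\<Sum>r<CARD('n). t ^ Suc r * c r)"
      unfolding c_def sum_distrib_left by (rule sum.swap)
    finally show ?thesis by (simp add: p_def q_def poly_sum poly_monom mult.commute)
  qed
  have "finite {t. det (mat 1 + t *\<^sub>R A y) = 0}"
  proof -
    define P where "P = (\<Sum>r\<le>CARD('n). monom (sym_curv (A y) r) r)"
    have P: "det (mat 1 + t *\<^sub>R A y) = poly P t" for t
      by (simp add: P_def poly_sum poly_monom det_mat_1_plus dA y)
    from this[of 0] have "P \<noteq> 0" by auto
    then show ?thesis by (simp add: P poly_roots_finite)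
  qed
  then have "infinite (UNIV - {t. det (mat 1 + t *\<^sub>R A y) = 0})"
    by (intro Diff_infinite_finite) (auto simp: infinite_UNIV_char_0)
  then have "p = q" by (rule poly_eqI_infinite) (use eq in auto)
  then have "coeff p (Suc r) = coeff q (Suc r)" by simp
  moreover have "coeff p (Suc r) = s (Suc r) v"
    using r by (simp add: p_def coeff_sum)
  moreover have "coeff q (Suc r) = c r"
    using r by (simp add: q_def coeff_sum)
  ultimately show ?thesis by (simp add: s_def c_def a_def)
qed

section \<open>Hypersurfaces in a chart\<close>

lemma Ck_on_sqrt:
  fixes f :: "'e::euclidean_space \<Rightarrow> real"
  assumes "open S" "Ck_on k S f" "\<And>y. y \<in> S \<Longrightarrow> f y > 0"
  shows "Ck_on k S (\<lambda>y. sqrt (f y))"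
  using assms(2,3)
proof (induction k arbitrary: f)
  case 0
  then show ?case by (auto intro: continuous_on_real_sqrt)
next
  case (Suc k)
  have d: "((\<lambda>y. sqrt (f y)) has_derivative
      (\<lambda>v. frechet_derivative f (at y) v * (inverse (sqrt (f y)) / 2))) (at y)"
    if "y \<in> S" for y
    using Suc.prems that by (intro has_derivative_real_sqrt has_frechet_derivative) auto
  have "Ck_on k S (\<lambda>y. frechet_derivative (\<lambda>y. sqrt (f y)) (at y) v)" for v
  proof (rule Ck_on_cong[OF assms(1), where
        f="\<lambda>y. frechet_derivative f (at y) v * (inverse (sqrt (f y)) * (1 / 2))"])
    have "sqrt (f y) \<noteq> 0" if "y \<in> S" for y using Suc.prems(2)[OF that] by simp
    then show "Ck_on k S (\<lambda>y. frechet_derivative f (at y) v * (inverse (sqrt (f y)) * (1 / 2)))"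
      using Suc.prems Ck_on_Suc_imp_Ck_on[OF Suc.prems(1)]
      by (intro Ck_on_mult Ck_on_inverse assms(1) Suc.IH) simp_all
  qed (use d in \<open>auto simp: frechet_derivative_at[OF d, symmetric]\<close>)
  then show ?case using d by (auto simp: differentiable_def)
qed

section \<open>Calculus in a coordinate chart\<close>

definition Ck_chart ::
  "('a, 'n::finite) chart \<Rightarrow> nat \<Rightarrow> ('a \<Rightarrow> 'b::real_normed_vector) \<Rightarrow> bool"
where
  "Ck_chart c k f \<longleftrightarrow> Ck_on k (snd c ` fst c) (f \<circ> param c)"

lemma Ck_chart_mono: "Ck_chart c k f \<Longrightarrow> j \<le> k \<Longrightarrow> Ck_chart c j f"
  unfolding Ck_chart_def by (rule Ck_on_mono)

locale coord_chart =
  fixes c :: "('a, 'n::finite) chart"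
  assumes open_image: "open (snd c ` fst c)" and inj_coord: "inj_on (snd c) (fst c)"
begin

lemma param_coord [simp]: "p \<in> fst c \<Longrightarrow> param c (snd c p) = p"
  using inj_coord by (rule inv_into_f_f)

lemma coord_param [simp]: "y \<in> snd c ` fst c \<Longrightarrow> snd c (param c y) = y"
  by (rule f_inv_into_f)

lemma param_in [simp]: "y \<in> snd c ` fst c \<Longrightarrow> param c y \<in> fst c"
  by (rule inv_into_into)

lemma Ck_chart_cong:
  assumes "\<And>p. p \<in> fst c \<Longrightarrow> f p = g p" "Ck_chart c k f"
  shows "Ck_chart c k g"
  using assms(2) unfolding Ck_chart_def
  by (rule Ck_on_cong[OF open_image, rotated]) (use assms(1) param_in in auto)

lemma pd_cong:
  assumes "\<And>p. p \<in> fst c \<Longrightarrow> f p = g p" "p \<in> fst c"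
  shows "pd c i f p = pd c i g p"
  unfolding pd_def
  by (rule fun_cong[OF frechet_derivative_cong_open[OF open_image]]) (use assms param_in in auto)

lemma Ck_chart_const: "Ck_chart c k (\<lambda>_. a)"
  by (simp add: Ck_chart_def o_def)

lemma Ck_chart_add: "Ck_chart c k f \<Longrightarrow> Ck_chart c k g \<Longrightarrow> Ck_chart c k (\<lambda>p. f p + g p)"
  using Ck_on_add[OF open_image] by (simp add: Ck_chart_def o_def)

lemma Ck_chart_diff: "Ck_chart c k f \<Longrightarrow> Ck_chart c k g \<Longrightarrow> Ck_chart c k (\<lambda>p. f p - g p)"
  using Ck_on_diff[OF open_image] by (simp add: Ck_chart_def o_def)

lemma Ck_chart_minus: "Ck_chart c k f \<Longrightarrow> Ck_chart c k (\<lambda>p. - f p)"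
  using Ck_on_minus[OF open_image] by (simp add: Ck_chart_def o_def)

lemma Ck_chart_mult:
  "Ck_chart c k f \<Longrightarrow> Ck_chart c k g \<Longrightarrow> Ck_chart c k (\<lambda>p. f p * g p :: real)"
  using Ck_on_mult[OF open_image] by (simp add: Ck_chart_def o_def)

lemma Ck_chart_scaleR: "Ck_chart c k f \<Longrightarrow> Ck_chart c k g \<Longrightarrow> Ck_chart c k (\<lambda>p. f p *\<^sub>R g p)"
  using Ck_on_scaleR[OF open_image] by (simp add: Ck_chart_def o_def)

lemma Ck_chart_inner: "Ck_chart c k f \<Longrightarrow> Ck_chart c k g \<Longrightarrow> Ck_chart c k (\<lambda>p. f p \<bullet> g p)"
  using Ck_on_inner[OF open_image] by (simp add: Ck_chart_def o_def)

lemma Ck_chart_sum: "(\<And>i. i \<in> I \<Longrightarrow> Ck_chart c k (f i)) \<Longrightarrow> Ck_chart c k (\<lambda>p. \<Sum>i\<in>I. f i p)"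
  unfolding Ck_chart_def o_def by (rule Ck_on_sum[OF open_image])

lemma Ck_chart_inverse:
  "Ck_chart c k f \<Longrightarrow> (\<And>p. p \<in> fst c \<Longrightarrow> f p \<noteq> 0) \<Longrightarrow> Ck_chart c k (\<lambda>p. inverse (f p :: real))"
  using Ck_on_inverse[OF open_image] param_in by (simp add: Ck_chart_def o_def)

lemma Ck_chart_sqrt:
  "Ck_chart c k f \<Longrightarrow> (\<And>p. p \<in> fst c \<Longrightarrow> f p > 0) \<Longrightarrow> Ck_chart c k (\<lambda>p. sqrt (f p))"
  using Ck_on_sqrt[OF open_image] param_in by (simp add: Ck_chart_def o_def)

lemma Ck_chart_det:
  "(\<And>i j. Ck_chart c k (\<lambda>p. M p $ i $ j)) \<Longrightarrow> Ck_chart c k (\<lambda>p. det (M p :: real^'k^'k))"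
  unfolding Ck_chart_def o_def by (rule Ck_on_det[OF open_image])

lemma Ck_chart_matrix_inv:
  "(\<And>i j. Ck_chart c k (\<lambda>p. M p $ i $ j)) \<Longrightarrow> (\<And>p. p \<in> fst c \<Longrightarrow> det (M p) \<noteq> 0)
    \<Longrightarrow> Ck_chart c k (\<lambda>p. matrix_inv (M p :: real^'k^'k) $ i $ j)"
  unfolding Ck_chart_def o_def by (rule Ck_on_matrix_inv[OF open_image]) (use param_in in auto)

lemma Ck_chart_sym_curv:
  "(\<And>i j. Ck_chart c k (\<lambda>p. A p $ i $ j)) \<Longrightarrow> (\<And>p. p \<in> fst c \<Longrightarrow> diagonalizable (A p))
    \<Longrightarrow> Ck_chart c k (\<lambda>p. sym_curv (A p) r)"
  unfolding Ck_chart_def o_def by (rule Ck_on_sym_curv[OF open_image]) (use param_in in auto)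

lemma Ck_chart_newton_mat:
  "(\<And>i j. Ck_chart c k (\<lambda>p. A p $ i $ j)) \<Longrightarrow> (\<And>p. p \<in> fst c \<Longrightarrow> diagonalizable (A p))
    \<Longrightarrow> Ck_chart c k (\<lambda>p. newton_mat (A p) r $ i $ j)"
  unfolding Ck_chart_def o_def by (rule Ck_on_newton_mat[OF open_image]) (use param_in in auto)

lemma Ck_chart_pd: "Ck_chart c (Suc k) f \<Longrightarrow> Ck_chart c k (pd c i f)"
  unfolding Ck_chart_def
  by (rule Ck_on_cong[OF open_image, of "\<lambda>y. frechet_derivative (f \<circ> param c) (at y) (axis i 1)"])
    (auto simp: pd_def)

lemma has_derivative_chart:
  assumes "Ck_chart c 1 f" "p \<in> fst c"
  shows "((\<lambda>y. f (param c y)) has_derivative frechet_derivative (f \<circ> param c) (at (snd c p))) (at (snd c p))"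
  using assms by (auto simp: Ck_chart_def o_def intro!: has_frechet_derivative)

lemma pd_eqI:
  assumes "((\<lambda>y. f (param c y)) has_derivative D) (at (snd c p))"
  shows "pd c i f p = D (axis i 1)"
  using frechet_derivative_at[OF assms] by (simp add: pd_def o_def)

lemma pd_const: "pd c i (\<lambda>_. a) p = 0"
  by (simp add: pd_def o_def)

context
  fixes p assumes p: "p \<in> fst c"
begin

lemma pd_add:
  assumes f: "Ck_chart c 1 f" and g: "Ck_chart c 1 g"
  shows "pd c i (\<lambda>q. f q + g q) p = pd c i f p + pd c i g p"
  using pd_eqI[OF has_derivative_add[OF has_derivative_chart[OF f p] has_derivative_chart[OF g p]]] p
  by (simp add: pd_def)

lemma pd_diff:
  assumes f: "Ck_chart c 1 f" and g: "Ck_chart c 1 g"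
  shows "pd c i (\<lambda>q. f q - g q) p = pd c i f p - pd c i g p"
  using pd_eqI[OF has_derivative_diff[OF has_derivative_chart[OF f p] has_derivative_chart[OF g p]]] p
  by (simp add: pd_def)

lemma pd_minus:
  assumes f: "Ck_chart c 1 f"
  shows "pd c i (\<lambda>q. - f q) p = - pd c i f p"
  using pd_eqI[OF has_derivative_minus[OF has_derivative_chart[OF f p]]] p
  by (simp add: pd_def)

lemma pd_mult:
  fixes f g :: "'a \<Rightarrow> real"
  assumes f: "Ck_chart c 1 f" and g: "Ck_chart c 1 g"
  shows "pd c i (\<lambda>q. f q * g q) p = pd c i f p * g p + f p * pd c i g p"
  using pd_eqI[OF has_derivative_mult[OF has_derivative_chart[OF f p] has_derivative_chart[OF g p]]] p
  by (simp add: pd_def)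

lemma pd_scaleR:
  assumes f: "Ck_chart c 1 f" and g: "Ck_chart c 1 g"
  shows "pd c i (\<lambda>q. f q *\<^sub>R g q) p = pd c i f p *\<^sub>R g p + f p *\<^sub>R pd c i g p"
  using pd_eqI[OF has_derivative_scaleR[OF has_derivative_chart[OF f p] has_derivative_chart[OF g p]]] p
  by (simp add: pd_def)

lemma pd_inner:
  assumes f: "Ck_chart c 1 f" and g: "Ck_chart c 1 g"
  shows "pd c i (\<lambda>q. f q \<bullet> g q) p = pd c i f p \<bullet> g p + f p \<bullet> pd c i g p"
  using pd_eqI[OF has_derivative_inner[OF has_derivative_chart[OF f p] has_derivative_chart[OF g p]]] p
  by (simp add: pd_def)

lemma pd_sum:
  assumes f: "\<And>j. j \<in> I \<Longrightarrow> Ck_chart c 1 (f j)"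
  shows "pd c i (\<lambda>q. \<Sum>j\<in>I. f j q) p = (\<Sum>j\<in>I. pd c i (f j) p)"
  using pd_eqI[OF has_derivative_sum[OF has_derivative_chart[OF f p]], of I "\<lambda>j. j" i]
  by (simp add: pd_def)

lemma pd_cmult:
  fixes f :: "'a \<Rightarrow> real"
  shows "Ck_chart c 1 f \<Longrightarrow> pd c i (\<lambda>q. a * f q) p = a * pd c i f p"
  using pd_mult[OF Ck_chart_const[of 1 a], of f i] by (simp add: pd_const)

lemma pd_sqrt:
  assumes "Ck_chart c 1 f" "f p > 0"
  shows "pd c i (\<lambda>q. sqrt (f q)) p = pd c i f p / (2 * sqrt (f p))"
proof -
  have "f (param c (snd c p)) > 0" using assms(2) p by simp
  from pd_eqI[OF has_derivative_real_sqrt[OF this has_derivative_chart[OF assms(1) p]]]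
  have "pd c i (\<lambda>q. sqrt (f q)) p = pd c i f p * (inverse (sqrt (f p)) / 2)"
    using p by (simp add: pd_def)
  then show ?thesis using assms(2) by (simp add: field_simps)
qed

lemma pd_det:
  fixes M :: "'a \<Rightarrow> real^'k^'k"
  assumes "\<And>i j. Ck_chart c 1 (\<lambda>p. M p $ i $ j)" "R ** M p = mat 1"
  shows "pd c i (\<lambda>q. det (M q)) p
    = det (M p) * (\<Sum>a\<in>UNIV. \<Sum>b\<in>UNIV. pd c i (\<lambda>q. M q $ a $ b) p * R $ b $ a)"
  using pd_eqI[OF has_derivative_det[OF has_derivative_chart[OF assms(1) p], of R]] assms(2) p
  by (simp add: pd_def)

lemma pd_sym_curv:
  fixes A :: "'a \<Rightarrow> real^'k^'k"
  assumes "\<And>i j. Ck_chart c 1 (\<lambda>p. A p $ i $ j)" "\<And>p. p \<in> fst c \<Longrightarrow> diagonalizable (A p)" "r < CARD('k)"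
  shows "pd c i (\<lambda>q. sym_curv (A q) (Suc r)) p
    = (\<Sum>a\<in>UNIV. \<Sum>b\<in>UNIV. pd c i (\<lambda>q. A q $ a $ b) p * newton_mat (A p) r $ b $ a)"
  using frechet_derivative_sym_curv[OF open_image, of "\<lambda>y. A (param c y)" "snd c p" r "axis i 1"] assms p
  by (simp add: pd_def Ck_chart_def o_def)

lemma pd_commute:
  fixes f :: "'a \<Rightarrow> 'b::euclidean_space"
  assumes "Ck_chart c 2 f"
  shows "pd c i (pd c j f) p = pd c j (pd c i f) p"
proof -
  have "pd c i (pd c j f) p
      = frechet_derivative (\<lambda>y. frechet_derivative (f \<circ> param c) (at y) (axis j 1)) (at (snd c p)) (axis i 1)" for i j
    unfolding pd_def[of c i]
    by (rule fun_cong[OF frechet_derivative_cong_open[OF open_image]]) (use p in \<open>auto simp: pd_def\<close>)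
  then show ?thesis
    using second_derivative_symmetric[OF open_image, of "f \<circ> param c" "snd c p"] assms p
    by (simp add: Ck_chart_def)
qed

end

lemma frechet_derivative_eq_sum_pd:
  assumes "Ck_chart c 1 f" "p \<in> fst c"
  shows "frechet_derivative (f \<circ> param c) (at (snd c p)) v = (\<Sum>i\<in>UNIV. v $ i *\<^sub>R pd c i f p)"
proof -
  have l: "linear (frechet_derivative (f \<circ> param c) (at (snd c p)))"
    using has_derivative_linear[OF has_derivative_chart[OF assms]] .
  have "v = (\<Sum>i\<in>UNIV. v $ i *\<^sub>R axis i 1)"
    by (simp add: vec_eq_iff axis_def if_distrib cong: if_cong)
  then have "frechet_derivative (f \<circ> param c) (at (snd c p)) v
      = frechet_derivative (f \<circ> param c) (at (snd c p)) (\<Sum>i\<in>UNIV. v $ i *\<^sub>R axis i 1)" by simp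
  also have "\<dots> = (\<Sum>i\<in>UNIV. v $ i *\<^sub>R pd c i f p)"
    unfolding pd_def using l by (simp add: linear_sum linear_cmul)
  finally show ?thesis .
qed

end

lemma inner_metric:
  "u \<bullet> (metric c x p *v v) = (\<Sum>i\<in>UNIV. u $ i *\<^sub>R pd c i x p) \<bullet> (\<Sum>j\<in>UNIV. v $ j *\<^sub>R pd c j x p)"
proof -
  have "u \<bullet> (metric c x p *v v) = (\<Sum>i\<in>UNIV. \<Sum>j\<in>UNIV. u $ i * (v $ j * metric c x p $ i $ j))"
    by (simp add: inner_vec_def matrix_vector_mult_def sum_distrib_left mult.commute)
  then show ?thesis
    unfolding inner_sum_left inner_sum_right
    by (subst sum.swap) (simp add: metric_def mult.left_commute)
qed

section \<open>Metric, shape operator and connection in one chart\<close>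

locale hypersurface_chart = coord_chart c for c :: "('a, 'n::finite) chart" +
  fixes x N :: "'a \<Rightarrow> real ^ 'm::finite"
  assumes x_smooth: "\<And>k. Ck_chart c k x" and N_smooth: "\<And>k. Ck_chart c k N"
    and immersed: "\<And>p. p \<in> fst c \<Longrightarrow> inj (frechet_derivative (x \<circ> param c) (at (snd c p)))"
    and norm_N: "\<And>p. p \<in> fst c \<Longrightarrow> norm (N p) = 1"
    and N_pd_x: "\<And>p i. p \<in> fst c \<Longrightarrow> N p \<bullet> pd c i x p = 0"
    and card_m: "CARD('m) = CARD('n) + 1"
begin

abbreviation "X i \<equiv> pd c i x"
abbreviation "g p \<equiv> metric c x p"
abbreviation "G p \<equiv> matrix_inv (metric c x p)"
abbreviation "A p \<equiv> shape_operator c x N p"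
abbreviation "P r p \<equiv> newton_mat (shape_operator c x N p) r"
abbreviation "W p \<equiv> sqrt (det (metric c x p))"

lemma X_smooth: "Ck_chart c k (X i)"
  by (rule Ck_chart_pd[OF x_smooth])

lemma g_nth: "g p $ i $ j = X i p \<bullet> X j p"
  by (simp add: metric_def)

lemma g_smooth: "Ck_chart c k (\<lambda>p. g p $ i $ j)"
  unfolding g_nth by (intro Ck_chart_inner X_smooth)

lemma g_sym: "g p $ i $ j = g p $ j $ i"
  by (simp add: g_nth inner_commute)

lemma inner_g_sym: "u \<bullet> (g p *v v) = v \<bullet> (g p *v u)"
  unfolding inner_metric by (rule inner_commute)

lemma X_independent:
  assumes "p \<in> fst c" "(\<Sum>i\<in>UNIV. v $ i *\<^sub>R X i p) = 0"
  shows "v = 0"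
proof -
  have "frechet_derivative (x \<circ> param c) (at (snd c p)) v = frechet_derivative (x \<circ> param c) (at (snd c p)) 0"
    using assms by (simp add: frechet_derivative_eq_sum_pd[OF x_smooth assms(1)])
  then show ?thesis using immersed[OF assms(1)] by (simp add: inj_eq)
qed

lemma g_pos: "p \<in> fst c \<Longrightarrow> v \<noteq> 0 \<Longrightarrow> 0 < v \<bullet> (g p *v v)"
  using X_independent[of p v] by (auto simp: inner_metric)

text \<open>The metric matrix is symmetric for the standard inner product, hence diagonalizable.
  Evaluating the metric on an eigenvector shows that the eigenvalue is positive, and the determinant
  is the product of the eigenvalues.\<close>

lemma det_g_pos:
  assumes "p \<in> fst c"
  shows "0 < det (g p)"
proof -
  have "(g p *v u) \<bullet> (mat 1 *v v) = (g p *v v) \<bullet> (mat 1 *v u)" for u v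
    using inner_g_sym[of u p v] by (simp add: inner_commute)
  then have "diagonalizable (g p)"
    by (intro self_adjoint_diagonalizable[of "mat 1"]) (auto simp: inner_commute)
  then obtain E E' \<kappa> where "diagonalized E E' \<kappa> (g p)"
    unfolding diagonalizable_def diagonalized_def by blast
  then interpret D: diagonalized E E' \<kappa> "g p" .
  have "\<kappa> i > 0" for i
  proof -
    define e where "e = column i E"
    have "g p ** E = E ** diag_mat \<kappa>"
      by (metis D.A D.E'E matrix_mul_assoc matrix_mul_rid)
    then have "g p *v e = (E ** diag_mat \<kappa>) *v axis i 1"
      unfolding e_def by (metis matrix_vector_mul_assoc matrix_vector_mult_basis)
    also have "\<dots> = \<kappa> i *\<^sub>R e"
      by (simp add: matrix_vector_mult_basis vec_eq_iff column_def matrix_matrix_mult_def diag_mat_def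
          e_def if_distrib mult.commute cong: if_cong)
    finally have 1: "e \<bullet> (g p *v e) = \<kappa> i * (e \<bullet> e)" by simp
    have "E' *v e = axis i 1"
      unfolding e_def by (metis D.E'E matrix_vector_mul_assoc matrix_vector_mul_lid matrix_vector_mult_basis)
    then have "e \<noteq> 0" by (metis axis_eq_0_iff matrix_vector_mult_0_right zero_neq_one)
    then show ?thesis using g_pos[OF assms, of e] 1 inner_ge_zero[of e]
      by (simp add: zero_less_mult_iff del: inner_ge_zero)
  qed
  then show ?thesis by (simp add: D.A_eq_D D.det_D prod_pos)
qed

lemma G_g: "p \<in> fst c \<Longrightarrow> G p ** g p = mat 1" and g_G: "p \<in> fst c \<Longrightarrow> g p ** G p = mat 1"
  using matrix_inv_left_right[of "g p"] det_g_pos[of p] by auto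

lemma G_sym:
  assumes "p \<in> fst c"
  shows "G p $ i $ j = G p $ j $ i"
proof -
  have t: "transpose (g p) = g p" by (simp add: transpose_def vec_eq_iff g_sym[of p])
  have "transpose (G p) ** g p = mat 1"
    using arg_cong[OF g_G[OF assms], of transpose] by (simp add: matrix_transpose_mul t transpose_mat)
  then have "transpose (G p) = G p"
    using g_G[OF assms] by (metis matrix_mul_assoc matrix_mul_lid matrix_mul_rid)
  then have "transpose (G p) $ j $ i = G p $ j $ i" by simp
  then show ?thesis by (simp add: transpose_def)
qed

lemma G_smooth: "Ck_chart c k (\<lambda>p. G p $ i $ j)"
  using det_g_pos by (intro Ck_chart_matrix_inv g_smooth) force

text \<open>Raising and lowering an index: identities obtained by pairing with the fields
  \<open>X l\<close> are converted into identities for components.\<close>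

lemma sum_g_eq_iff:
  assumes "p \<in> fst c"
  shows "(\<forall>l. (\<Sum>k\<in>UNIV. g p $ l $ k * a k) = b l) \<longleftrightarrow> (\<forall>k. a k = (\<Sum>l\<in>UNIV. G p $ k $ l * b l))"
proof -
  define u v where "u = (\<chi> k. a k)" and "v = (\<chi> l. b l)"
  have "g p *v u = v \<longleftrightarrow> u = G p *v v"
    using G_g[OF assms] g_G[OF assms] by (metis matrix_vector_mul_assoc matrix_vector_mul_lid)
  then show ?thesis by (simp add: u_def v_def vec_eq_iff matrix_vector_mult_def)
qed

text \<open>A dimension count. The coordinate fields span an n-dimensional space and the normal adds
  one dimension, so a nonzero remainder orthogonal to all of them would give n + 2 dimensions inside
  an (n + 1)-dimensional space.\<close>

lemma tangent_normal_decomposition: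
  assumes "p \<in> fst c"
  shows "w = (\<Sum>k\<in>UNIV. (\<Sum>l\<in>UNIV. G p $ k $ l * (w \<bullet> X l p)) *\<^sub>R X k p) + (w \<bullet> N p) *\<^sub>R N p"
proof -
  define a where "a k = (\<Sum>l\<in>UNIV. G p $ k $ l * (w \<bullet> X l p))" for k
  have a: "(\<Sum>k\<in>UNIV. g p $ l $ k * a k) = w \<bullet> X l p" for l
    using sum_g_eq_iff[OF assms, of a "\<lambda>l. w \<bullet> X l p"] by (simp add: a_def)
  define r where "r = w - (\<Sum>k\<in>UNIV. a k *\<^sub>R X k p) - (w \<bullet> N p) *\<^sub>R N p"
  have NN: "N p \<bullet> N p = 1" using norm_N[OF assms] by (simp add: norm_eq_1)
  have rX: "r \<bullet> X l p = 0" for l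
    using a[of l] N_pd_x[OF assms, of l]
    by (simp add: r_def inner_diff_left inner_sum_left g_nth inner_commute[of "X l p"] mult.commute)
  have XN: "X l p \<bullet> N p = 0" for l using N_pd_x[OF assms, of l] by (simp add: inner_commute)
  have rN: "r \<bullet> N p = 0"
    by (simp add: r_def inner_diff_left inner_sum_left XN NN)
  define L where "L v = (\<Sum>i\<in>UNIV. v $ i *\<^sub>R X i p)" for v :: "real^'n"
  have linL: "linear L"
    by (auto simp: L_def linear_iff algebra_simps sum.distrib scaleR_sum_right)
  have injL: "inj L"
    using X_independent[OF assms] by (subst linear_injective_0[OF linL]) (auto simp: L_def)
  define S where "S = range L"
  have subS: "subspace S" unfolding S_def by (rule linear_subspace_image[OF linL subspace_UNIV])
  have dimS: "dim S = CARD('n)"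
    unfolding S_def using dim_image_eq[OF linL, of UNIV] injL by (simp add: inj_on_subset)
  have orthS: "v \<bullet> s = 0" if "s \<in> S" "\<And>l. v \<bullet> X l p = 0" for s v
    using that by (auto simp: S_def L_def inner_sum_right)
  have "r = 0"
  proof (rule ccontr)
    assume "r \<noteq> 0"
    have Nn: "N p \<notin> span S"
    proof
      assume "N p \<in> span S"
      then have "N p \<in> S" using subS by (simp add: span_eq_iff[THEN iffD2])
      then show False using orthS[of "N p" "N p"] N_pd_x[OF assms] NN by simp
    qed
    have rn: "r \<notin> span (insert (N p) S)"
    proof
      assume "r \<in> span (insert (N p) S)"
      then obtain k where "r - k *\<^sub>R N p \<in> span S" using span_breakdown_eq by blast
      then have "r - k *\<^sub>R N p \<in> S" using subS by (simp add: span_eq_iff[THEN iffD2])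
      from orthS[OF this, of r] have "r \<bullet> r = 0" using rX rN by (simp add: inner_diff_right)
      then show False using \<open>r \<noteq> 0\<close> by simp
    qed
    have "dim (insert r (insert (N p) S)) = CARD('n) + 2"
      using Nn rn dimS by (simp add: dim_insert)
    then show False using dim_subset_UNIV[of "insert r (insert (N p) S)"] card_m by simp
  qed
  then show ?thesis unfolding r_def a_def by (simp add: algebra_simps)
qed

lemma N_pd_N:
  assumes "p \<in> fst c"
  shows "pd c j N p \<bullet> N p = 0"
proof -
  have "pd c j (\<lambda>q. N q \<bullet> N q) p = pd c j (\<lambda>_. 1) p"
    using norm_N by (intro pd_cong assms) (simp add: norm_eq_1)
  then show ?thesis
    by (simp add: pd_const pd_inner[OF assms N_smooth N_smooth] inner_commute[of "N p"])
qed

text \<open>The definite description denotes: the decomposition of the derivatives of N, which are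
  tangential, provides a solution of the Weingarten equations, and independence of the coordinate
  fields makes it unique.\<close>

lemma shape_operator_eq:
  assumes "p \<in> fst c"
  shows "A p = (\<chi> k j. - (\<Sum>l\<in>UNIV. G p $ k $ l * (pd c j N p \<bullet> X l p)))" (is "_ = ?a")
  unfolding shape_operator_def
proof (rule the_equality)
  show *: "\<forall>j. (\<Sum>i\<in>UNIV. ?a $ i $ j *\<^sub>R X i p) = - pd c j N p"
    using tangent_normal_decomposition[OF assms, of "pd c _ N p"] N_pd_N[OF assms]
    by (simp add: sum_negf)
  fix a assume a: "\<forall>j. (\<Sum>i\<in>UNIV. a $ i $ j *\<^sub>R X i p) = - pd c j N p"
  have "(\<chi> i. a $ i $ j - ?a $ i $ j) = 0" (is "?d j = 0") for j
    proof (rule X_independent[OF assms])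
    show "(\<Sum>i\<in>UNIV. (\<chi> i. a $ i $ j - ?a $ i $ j) $ i *\<^sub>R X i p) = 0"
      using a[rule_format, of j] *[rule_format, of j]
      unfolding vec_lambda_beta scaleR_diff_left sum_subtractf by (metis diff_self)
  qed
  then have "?d j $ i = 0" for i j by (simp only: zero_index)
  then have "a $ i $ j = ?a $ i $ j" for i j by (simp only: vec_lambda_beta right_minus_eq)
  then show "a = ?a" by (intro vec_eq_iff[THEN iffD2] allI)
qed

lemma A_smooth: "Ck_chart c k (\<lambda>p. A p $ i $ j)"
  by (rule Ck_chart_cong[of "\<lambda>p. - (\<Sum>l\<in>UNIV. G p $ i $ l * (pd c j N p \<bullet> X l p))"])
    (auto simp: shape_operator_eq intro!: Ck_chart_minus Ck_chart_sum Ck_chart_mult Ck_chart_inner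
      G_smooth X_smooth Ck_chart_pd N_smooth)

lemma sum_A_X: "p \<in> fst c \<Longrightarrow> (\<Sum>i\<in>UNIV. A p $ i $ j *\<^sub>R X i p) = - pd c j N p"
  using tangent_normal_decomposition[of p "pd c j N p"] N_pd_N[of p]
  by (simp add: shape_operator_eq sum_negf)

lemma N_pd_X: "p \<in> fst c \<Longrightarrow> N p \<bullet> pd c j (X i) p = - (pd c j N p \<bullet> X i p)"
proof -
  assume p: "p \<in> fst c"
  have "pd c j (\<lambda>q. N q \<bullet> X i q) p = pd c j (\<lambda>_. 0) p"
    using N_pd_x by (intro pd_cong p) simp
  then show ?thesis by (simp add: pd_const pd_inner[OF p N_smooth X_smooth])
qed

lemma X_commute: "p \<in> fst c \<Longrightarrow> pd c i (X j) p = pd c j (X i) p"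
  by (rule pd_commute[OF _ x_smooth])

lemma g_A: "p \<in> fst c \<Longrightarrow> (\<Sum>k\<in>UNIV. g p $ l $ k * A p $ k $ j) = N p \<bullet> pd c j (X l) p"
  using arg_cong[OF sum_A_X, of p "\<lambda>w. X l p \<bullet> w" j] N_pd_X[of p j l]
  by (simp add: inner_sum_right g_nth mult.commute inner_commute)

text \<open>Lowering an index of A gives the second fundamental form N . d_j X_l, which is symmetric
  because second derivatives of x commute.\<close>

lemma A_self_adjoint:
  assumes "p \<in> fst c"
  shows "(A p *v u) \<bullet> (g p *v v) = (A p *v v) \<bullet> (g p *v u)"
proof -
  have *: "v \<bullet> (g p *v (A p *v u)) = (\<Sum>l\<in>UNIV. \<Sum>j\<in>UNIV. v $ l * u $ j * (N p \<bullet> pd c j (X l) p))" for u v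
    unfolding matrix_vector_mul_assoc
    by (simp add: inner_vec_def matrix_vector_mult_def matrix_matrix_mult_def g_A[OF assms] sum_distrib_left mult_ac)
  have "v \<bullet> (g p *v (A p *v u)) = u \<bullet> (g p *v (A p *v v))"
    unfolding * by (subst sum.swap) (simp add: X_commute[OF assms] mult_ac)
  then show ?thesis using inner_g_sym by metis
qed

lemma A_diagonalizable: "p \<in> fst c \<Longrightarrow> diagonalizable (A p)"
  by (rule self_adjoint_diagonalizable[OF inner_g_sym g_pos A_self_adjoint])


abbreviation "\<Gamma> k i j p \<equiv> christoffel c x k i j p"

lemma pd_g: "p \<in> fst c \<Longrightarrow> pd c k (\<lambda>q. g q $ i $ j) p = pd c k (X i) p \<bullet> X j p + X i p \<bullet> pd c k (X j) p"
  unfolding g_nth by (rule pd_inner[OF _ X_smooth X_smooth])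

text \<open>The tangential part of the flat derivative is determined by the metric. This links
  \<open>christoffel\<close>, defined through the metric, with the projection of second derivatives
  of x.\<close>

lemma koszul:
  assumes "p \<in> fst c"
  shows "pd c i (X j) p \<bullet> X l p = (pd c i (\<lambda>q. g q $ j $ l) p + pd c j (\<lambda>q. g q $ i $ l) p
          - pd c l (\<lambda>q. g q $ i $ j) p) / 2"
  by (simp add: pd_g[OF assms] X_commute[OF assms, of j i] X_commute[OF assms, of l]
      inner_commute[of "X _ p"])

lemma christoffel_eq:
  "p \<in> fst c \<Longrightarrow> \<Gamma> k i j p = (\<Sum>l\<in>UNIV. G p $ k $ l * (pd c i (X j) p \<bullet> X l p))"
  unfolding christoffel_def by (simp add: koszul)

lemma christoffel_sym: "p \<in> fst c \<Longrightarrow> \<Gamma> k i j p = \<Gamma> k j i p"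
  by (simp add: christoffel_eq X_commute[of p i j])

lemma g_christoffel: "p \<in> fst c \<Longrightarrow> (\<Sum>k\<in>UNIV. g p $ l $ k * \<Gamma> k i j p) = pd c i (X j) p \<bullet> X l p"
  using sum_g_eq_iff[of p "\<lambda>k. \<Gamma> k i j p" "\<lambda>l. pd c i (X j) p \<bullet> X l p"] by (simp add: christoffel_eq)

lemma pd_X_decomposition:
  "p \<in> fst c \<Longrightarrow> pd c i (X j) p = (\<Sum>k\<in>UNIV. \<Gamma> k i j p *\<^sub>R X k p) + (N p \<bullet> pd c i (X j) p) *\<^sub>R N p"
  using tangent_normal_decomposition[of p "pd c i (X j) p"] by (simp add: christoffel_eq inner_commute)

text \<open>Differentiate the Weingarten equation for the j-th field in direction k and take the
  tangential part: it is given by -(d_k d_j N) . X_l, which is symmetric in k and j.\<close>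

lemma codazzi:
  assumes "p \<in> fst c"
  shows "pd c k (\<lambda>q. A q $ a $ j) p + (\<Sum>i\<in>UNIV. \<Gamma> a k i p * A p $ i $ j)
    = pd c j (\<lambda>q. A q $ a $ k) p + (\<Sum>i\<in>UNIV. \<Gamma> a j i p * A p $ i $ k)"
proof -
  define F where "F a k j = pd c k (\<lambda>q. A q $ a $ j) p + (\<Sum>i\<in>UNIV. \<Gamma> a k i p * A p $ i $ j)" for a k j
  have F: "(\<Sum>a\<in>UNIV. g p $ l $ a * F a k j) = - (pd c k (pd c j N) p \<bullet> X l p)" for l k j
  proof -
    have "pd c k (\<lambda>q. \<Sum>i\<in>UNIV. A q $ i $ j *\<^sub>R X i q) p = pd c k (\<lambda>q. - pd c j N q) p"
      by (rule pd_cong[OF _ assms]) (rule sum_A_X)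
    moreover have "pd c k (\<lambda>q. - pd c j N q) p = - pd c k (pd c j N) p"
      by (rule pd_minus[OF assms Ck_chart_pd[OF N_smooth]])
    moreover have "pd c k (\<lambda>q. \<Sum>i\<in>UNIV. A q $ i $ j *\<^sub>R X i q) p
        = (\<Sum>i\<in>UNIV. pd c k (\<lambda>q. A q $ i $ j) p *\<^sub>R X i p + A p $ i $ j *\<^sub>R pd c k (X i) p)"
      by (subst pd_sum[OF assms Ck_chart_scaleR[OF A_smooth X_smooth]])
        (simp add: pd_scaleR[OF assms A_smooth X_smooth])
    ultimately have "- (pd c k (pd c j N) p \<bullet> X l p)
        = (\<Sum>i\<in>UNIV. pd c k (\<lambda>q. A q $ i $ j) p *\<^sub>R X i p + A p $ i $ j *\<^sub>R pd c k (X i) p) \<bullet> X l p"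
      by (metis inner_minus_left)
    also have "\<dots> = (\<Sum>i\<in>UNIV. g p $ l $ i * pd c k (\<lambda>q. A q $ i $ j) p)
        + (\<Sum>i\<in>UNIV. A p $ i $ j * (pd c k (X i) p \<bullet> X l p))"
      by (simp add: inner_sum_left inner_add_left sum.distrib g_nth inner_commute[of "X l p"] mult.commute)
    also have "(\<Sum>i\<in>UNIV. A p $ i $ j * (pd c k (X i) p \<bullet> X l p))
        = (\<Sum>i\<in>UNIV. \<Sum>a\<in>UNIV. g p $ l $ a * (\<Gamma> a k i p * A p $ i $ j))"
      unfolding g_christoffel[OF assms, symmetric] by (simp add: sum_distrib_left sum_distrib_right mult_ac)
    also have "\<dots> = (\<Sum>a\<in>UNIV. g p $ l $ a * (\<Sum>i\<in>UNIV. \<Gamma> a k i p * A p $ i $ j))"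
      unfolding sum_distrib_left by (rule sum.swap)
    finally show ?thesis unfolding F_def by (simp add: distrib_left sum.distrib)
  qed
  have "(\<Sum>a\<in>UNIV. g p $ l $ a * F a k j) = (\<Sum>a\<in>UNIV. g p $ l $ a * F a j k)" for l
    unfolding F using pd_commute[OF assms N_smooth, of k j] by simp
  then have "\<forall>a. F a k j = (\<Sum>l\<in>UNIV. G p $ a $ l * (\<Sum>a\<in>UNIV. g p $ l $ a * F a j k))"
    using sum_g_eq_iff[OF assms, of "\<lambda>a. F a k j" "\<lambda>l. \<Sum>a\<in>UNIV. g p $ l $ a * F a j k"] by blast
  moreover have "\<forall>a. F a j k = (\<Sum>l\<in>UNIV. G p $ a $ l * (\<Sum>a\<in>UNIV. g p $ l $ a * F a j k))"
    using sum_g_eq_iff[OF assms, of "\<lambda>a. F a j k" "\<lambda>l. \<Sum>a\<in>UNIV. g p $ l $ a * F a j k"] by blast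
  ultimately have "F a k j = F a j k" by metis
  then show ?thesis by (simp add: F_def)
qed

section \<open>Volume density and divergence of the Newton transformations\<close>

lemma W_pos: "p \<in> fst c \<Longrightarrow> W p > 0"
  using det_g_pos by simp

lemma W_smooth: "Ck_chart c k W"
  by (rule Ck_chart_sqrt[OF Ck_chart_det[OF g_smooth] det_g_pos])

text \<open>By Jacobi's formula the logarithmic derivative of the density is half the trace of G d_i
  g. Each of the two terms of d_i g contributes the trace of the Christoffel symbols once.\<close>

lemma pd_W:
  assumes "p \<in> fst c"
  shows "pd c i (\<lambda>q. W q) p = W p * (\<Sum>a\<in>UNIV. \<Gamma> a i a p)"
proof -
  have "pd c i (\<lambda>q. det (g q)) p
      = det (g p) * (\<Sum>a\<in>UNIV. \<Sum>b\<in>UNIV. pd c i (\<lambda>q. g q $ a $ b) p * G p $ b $ a)"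
    by (rule pd_det[OF assms g_smooth G_g[OF assms]])
  also have "(\<Sum>a\<in>UNIV. \<Sum>b\<in>UNIV. pd c i (\<lambda>q. g q $ a $ b) p * G p $ b $ a)
      = (\<Sum>a\<in>UNIV. \<Sum>b\<in>UNIV. G p $ a $ b * (pd c i (X a) p \<bullet> X b p))
        + (\<Sum>a\<in>UNIV. \<Sum>b\<in>UNIV. G p $ b $ a * (pd c i (X b) p \<bullet> X a p))"
    by (simp add: pd_g[OF assms] distrib_left sum.distrib mult.commute inner_commute[of "X _ p"]
        G_sym[OF assms, of _ _])
  also have "\<dots> = 2 * (\<Sum>a\<in>UNIV. \<Gamma> a i a p)"
    by (subst (2) sum.swap) (simp add: christoffel_eq[OF assms])
  finally have "pd c i (\<lambda>q. W q) p = (W p * W p) * (2 * (\<Sum>a\<in>UNIV. \<Gamma> a i a p)) / (2 * W p)"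
    using pd_sqrt[OF assms Ck_chart_det[OF g_smooth] det_g_pos[OF assms], of i] det_g_pos[OF assms]
    by simp
  also have "\<dots> = W p * (\<Sum>a\<in>UNIV. \<Gamma> a i a p)"
  proof -
    have "(w * w) * (2 * s) / (2 * w) = w * s" if "w > 0" for w s :: real using that by simp
    from this[OF W_pos[OF assms]] show ?thesis .
  qed
  finally show ?thesis .
qed

definition pdm :: "'n \<Rightarrow> ('a \<Rightarrow> real^'n^'n) \<Rightarrow> 'a \<Rightarrow> real^'n^'n" where
  "pdm i M p = (\<chi> a b. pd c i (\<lambda>q. M q $ a $ b) p)"

definition conn :: "'n \<Rightarrow> 'a \<Rightarrow> real^'n^'n" where
  "conn i p = (\<chi> k j. \<Gamma> k i j p)"

text \<open>Covariant derivative of an endomorphism field: the upper index contributes the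
  connection matrix from the left, the lower index subtracts it from the right.\<close>

definition nabla :: "'n \<Rightarrow> ('a \<Rightarrow> real^'n^'n) \<Rightarrow> 'a \<Rightarrow> real^'n^'n" where
  "nabla i M p = pdm i M p + conn i p ** M p - M p ** conn i p"

lemma pdm_mult:
  assumes p: "p \<in> fst c" and M: "\<And>a b. Ck_chart c 1 (\<lambda>q. M q $ a $ b)" and L: "\<And>a b. Ck_chart c 1 (\<lambda>q. L q $ a $ b)"
  shows "pdm i (\<lambda>q. M q ** L q) p = pdm i M p ** L p + M p ** pdm i L p"
  by (simp add: pdm_def vec_eq_iff matrix_matrix_mult_def pd_sum[OF p Ck_chart_mult[OF M L]]
      pd_mult[OF p M L] sum.distrib)

lemma nabla_mult:
  assumes p: "p \<in> fst c" and M: "\<And>a b. Ck_chart c 1 (\<lambda>q. M q $ a $ b)" and L: "\<And>a b. Ck_chart c 1 (\<lambda>q. L q $ a $ b)"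
  shows "nabla i (\<lambda>q. M q ** L q) p = nabla i M p ** L p + M p ** nabla i L p"
  unfolding nabla_def pdm_mult[OF assms]
  by (simp add: matrix_add_rdistrib matrix_add_ldistrib matrix_diff_ldistrib matrix_diff_rdistrib
      matrix_mul_assoc)

lemma P_smooth: "Ck_chart c k (\<lambda>q. P r q $ a $ b)"
  by (rule Ck_chart_newton_mat[OF A_smooth A_diagonalizable])

lemma S_smooth: "Ck_chart c k (\<lambda>q. sym_curv (A q) r)"
  by (rule Ck_chart_sym_curv[OF A_smooth A_diagonalizable])

lemma nabla_A_codazzi:
  assumes "p \<in> fst c"
  shows "nabla i A p $ j $ l = nabla l A p $ j $ i"
  using codazzi[OF assms, of i j l]
  by (simp add: nabla_def pdm_def conn_def matrix_matrix_mult_def christoffel_sym[OF assms, of _ i l])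

text \<open>The commutator of the connection matrix with A has zero trace against P_r, since P_r
  commutes with A. Only the partial derivatives of A remain, and they give the derivative of
  S_{r+1}.\<close>

lemma trace_P_nabla_A:
  assumes "p \<in> fst c" "r < CARD('n)"
  shows "trace (P r p ** nabla l A p) = pd c l (\<lambda>q. sym_curv (A q) (Suc r)) p"
proof -
  have "trace (P r p ** (conn l p ** A p)) = trace (A p ** (P r p ** conn l p))"
    by (metis matrix_mul_assoc trace_mul_sym)
  also have "A p ** (P r p ** conn l p) = P r p ** (A p ** conn l p)"
    by (simp add: matrix_mul_assoc newton_mat_commute[OF A_diagonalizable[OF assms(1)]])
  finally have "trace (P r p ** nabla l A p) = trace (P r p ** pdm l A p)"
    by (simp add: nabla_def matrix_diff_ldistrib matrix_add_ldistrib trace_add trace_sub)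
  also have "\<dots> = trace (pdm l A p ** P r p)" by (rule trace_mul_sym)
  also have "\<dots> = pd c l (\<lambda>q. sym_curv (A q) (Suc r)) p"
    using pd_sym_curv[OF assms(1) A_smooth A_diagonalizable assms(2), of l]
    by (simp add: trace_def matrix_matrix_mult_def pdm_def)
  finally show ?thesis .
qed

text \<open>Induction using P_{r+1} = S_{r+1} - P_r A. The divergence of P_r vanishes by hypothesis;
  Codazzi turns the sum of P_r (nabla_i A) over i into tr (P_r nabla_l A), which is the derivative
  of S_{r+1} and cancels the one of the first summand.\<close>

lemma newton_divergence_free:
  assumes p: "p \<in> fst c" and "r \<le> CARD('n)"
  shows "(\<Sum>i\<in>UNIV. nabla i (P r) p $ i $ l) = 0"
  using assms(2)
proof (induction r arbitrary: l)
  case 0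
  have "nabla i (P 0) p = 0" for i
    by (simp add: nabla_def pdm_def pd_const vec_eq_iff)
  then show ?case by simp
next
  case (Suc r)
  define s where "s q = sym_curv (A q) (Suc r)" for q
  have "nabla i (P (Suc r)) p = mat (pd c i s p) - (nabla i (P r) p ** A p + P r p ** nabla i A p)" for i
  proof -
    have e: "P (Suc r) q $ a $ b = mat (s q) $ a $ b - (P r q ** A q) $ a $ b" if "q \<in> fst c" for q a b
      using newton_mat_commute[OF A_diagonalizable[OF that], of r] by (simp add: s_def)
    have PA: "Ck_chart c 1 (\<lambda>q. (P r q ** A q) $ a $ b)" for a b
      by (simp add: matrix_matrix_mult_def Ck_chart_sum Ck_chart_mult P_smooth A_smooth)
    have ms: "Ck_chart c 1 (\<lambda>q. mat (s q) $ a $ b)" "pd c i (\<lambda>q. mat (s q) $ a $ b) p = mat (pd c i s p) $ a $ b" for a b :: 'n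
      by (cases "a = b"; simp add: mat_def Ck_chart_const pd_const S_smooth s_def[abs_def])+
    have "pdm i (P (Suc r)) p $ a $ b = (mat (pd c i s p) - pdm i (\<lambda>q. P r q ** A q) p) $ a $ b" for a b
      unfolding pdm_def vec_lambda_beta
      by (subst pd_cong[OF e p]) (simp_all add: pd_diff[OF p ms(1) PA] ms(2))
    then have "pdm i (P (Suc r)) p = mat (pd c i s p) - pdm i (\<lambda>q. P r q ** A q) p"
      by (simp add: vec_eq_iff)
    moreover have "P (Suc r) p = mat (s p) - P r p ** A p"
      using e[OF p] by (simp add: vec_eq_iff)
    moreover have "conn i p ** mat (s p) = mat (s p) ** conn i p"
      by (simp add: mat_eq_scaleR_mat_1[of "s p"] matrix_mult_scaleR_left matrix_mult_scaleR_right)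
    ultimately have "nabla i (P (Suc r)) p = mat (pd c i s p) - nabla i (\<lambda>q. P r q ** A q) p"
      by (simp add: nabla_def matrix_diff_ldistrib matrix_diff_rdistrib)
    then show ?thesis unfolding nabla_mult[OF p P_smooth A_smooth] .
  qed
  then have "(\<Sum>i\<in>UNIV. nabla i (P (Suc r)) p $ i $ l)
    = (\<Sum>i\<in>UNIV. mat (pd c i s p) $ i $ l) - (\<Sum>i\<in>UNIV. (nabla i (P r) p ** A p) $ i $ l)
      - (\<Sum>i\<in>UNIV. (P r p ** nabla i A p) $ i $ l)"
    by (simp add: sum.distrib sum_subtractf)
  also have "(\<Sum>i\<in>UNIV. mat (pd c i s p) $ i $ l) = pd c l s p"
    by (simp add: mat_def)
  also have "(\<Sum>i\<in>UNIV. (nabla i (P r) p ** A p) $ i $ l)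
      = (\<Sum>j\<in>UNIV. (\<Sum>i\<in>UNIV. nabla i (P r) p $ i $ j) * A p $ j $ l)"
    unfolding matrix_matrix_mult_def vec_lambda_beta sum_distrib_right by (rule sum.swap)
  also have "\<dots> = 0" using Suc by simp
  also have "(\<Sum>i\<in>UNIV. (P r p ** nabla i A p) $ i $ l) = trace (P r p ** nabla l A p)"
    by (simp add: trace_def matrix_matrix_mult_def nabla_A_codazzi[OF p, of _ _ l])
  also have "\<dots> = pd c l s p"
    using trace_P_nabla_A[OF p, of r l] Suc.prems by (simp add: s_def[abs_def])
  finally show ?case by simp
qed

text \<open>Since P_r is divergence free, the sum of its partial derivatives is a difference of two
  Christoffel sums. One cancels the derivative of the density, the other completes the partial
  derivative of v to the covariant one.\<close>

lemma divergence_newton_field: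
  assumes p: "p \<in> fst c" and r: "r \<le> CARD('n)" and v: "\<And>l. Ck_chart c 1 (\<lambda>q. v q $ l)"
  shows "(\<Sum>i\<in>UNIV. pd c i (\<lambda>q. W q * (P r q *v v q) $ i) p)
    = W p * (\<Sum>i\<in>UNIV. \<Sum>l\<in>UNIV. P r p $ i $ l * (pd c i (\<lambda>q. v q $ l) p + (\<Sum>j\<in>UNIV. \<Gamma> l i j p * v p $ j)))"
proof -
  have Pv: "(P r q *v v q) $ i = (\<Sum>l\<in>UNIV. P r q $ i $ l * v q $ l)" for q i
    by (simp add: matrix_vector_mult_def)
  note CW = W_smooth[of 1]
  have CPv: "Ck_chart c 1 (\<lambda>q. (P r q *v v q) $ i)" for i
    unfolding Pv by (intro Ck_chart_sum Ck_chart_mult P_smooth v)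
  have "pd c i (\<lambda>q. W q * (P r q *v v q) $ i) p
      = W p * ((\<Sum>a\<in>UNIV. \<Gamma> a i a p) * (\<Sum>l\<in>UNIV. P r p $ i $ l * v p $ l)
        + (\<Sum>l\<in>UNIV. pd c i (\<lambda>q. P r q $ i $ l) p * v p $ l + P r p $ i $ l * pd c i (\<lambda>q. v q $ l) p))" for i
    by (simp add: pd_mult[OF p CW CPv] pd_W[OF p])
      (simp add: Pv pd_sum[OF p Ck_chart_mult[OF P_smooth v]] pd_mult[OF p P_smooth v] distrib_left mult.assoc)
  then have "(\<Sum>i\<in>UNIV. pd c i (\<lambda>q. W q * (P r q *v v q) $ i) p)
    = W p * ((\<Sum>i\<in>UNIV. (\<Sum>a\<in>UNIV. \<Gamma> a i a p) * (\<Sum>l\<in>UNIV. P r p $ i $ l * v p $ l))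
        + (\<Sum>i\<in>UNIV. \<Sum>l\<in>UNIV. pd c i (\<lambda>q. P r q $ i $ l) p * v p $ l)
        + (\<Sum>i\<in>UNIV. \<Sum>l\<in>UNIV. P r p $ i $ l * pd c i (\<lambda>q. v q $ l) p))"
    by (simp add: sum_distrib_left[symmetric] sum.distrib distrib_left)
  moreover have "(\<Sum>i\<in>UNIV. \<Sum>l\<in>UNIV. pd c i (\<lambda>q. P r q $ i $ l) p * v p $ l)
    = (\<Sum>l\<in>UNIV. (\<Sum>i\<in>UNIV. \<Sum>k\<in>UNIV. P r p $ i $ k * \<Gamma> k i l p) * v p $ l)
      - (\<Sum>l\<in>UNIV. (\<Sum>i\<in>UNIV. \<Sum>k\<in>UNIV. \<Gamma> i i k p * P r p $ k $ l) * v p $ l)"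
  proof -
    have "(\<Sum>i\<in>UNIV. pd c i (\<lambda>q. P r q $ i $ l) p)
      = (\<Sum>i\<in>UNIV. \<Sum>k\<in>UNIV. P r p $ i $ k * \<Gamma> k i l p) - (\<Sum>i\<in>UNIV. \<Sum>k\<in>UNIV. \<Gamma> i i k p * P r p $ k $ l)" for l
      using newton_divergence_free[OF p r, of l]
      by (simp add: nabla_def pdm_def conn_def matrix_matrix_mult_def sum.distrib sum_subtractf)
    then show ?thesis
      by (subst sum.swap) (simp add: sum_distrib_right[symmetric] left_diff_distrib sum_subtractf)
  qed
  moreover have "(\<Sum>l\<in>UNIV. (\<Sum>i\<in>UNIV. \<Sum>k\<in>UNIV. \<Gamma> i i k p * P r p $ k $ l) * v p $ l)
    = (\<Sum>i\<in>UNIV. (\<Sum>a\<in>UNIV. \<Gamma> a i a p) * (\<Sum>l\<in>UNIV. P r p $ i $ l * v p $ l))"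
  proof -
    have "(\<Sum>l\<in>UNIV. (\<Sum>i\<in>UNIV. \<Sum>k\<in>UNIV. \<Gamma> i i k p * P r p $ k $ l) * v p $ l)
      = (\<Sum>l\<in>UNIV. \<Sum>k\<in>UNIV. (\<Sum>i\<in>UNIV. \<Gamma> i i k p) * (P r p $ k $ l * v p $ l))"
      by (simp only: sum.swap[of _ UNIV UNIV, where g="\<lambda>i k. \<Gamma> i i k p * P r p $ k $ _"])
        (simp add: sum_distrib_right mult.assoc)
    also have "\<dots> = (\<Sum>k\<in>UNIV. (\<Sum>i\<in>UNIV. \<Gamma> i i k p) * (\<Sum>l\<in>UNIV. P r p $ k $ l * v p $ l))"
      by (subst sum.swap) (simp add: sum_distrib_left)
    finally show ?thesis by (simp add: christoffel_sym[OF p])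
  qed
  moreover have "(\<Sum>l\<in>UNIV. (\<Sum>i\<in>UNIV. \<Sum>k\<in>UNIV. P r p $ i $ k * \<Gamma> k i l p) * v p $ l)
    = (\<Sum>i\<in>UNIV. \<Sum>l\<in>UNIV. P r p $ i $ l * (\<Sum>j\<in>UNIV. \<Gamma> l i j p * v p $ j))"
  proof -
    have "(\<Sum>l\<in>UNIV. (\<Sum>i\<in>UNIV. \<Sum>k\<in>UNIV. P r p $ i $ k * \<Gamma> k i l p) * v p $ l)
      = (\<Sum>i\<in>UNIV. \<Sum>l\<in>UNIV. \<Sum>k\<in>UNIV. P r p $ i $ k * (\<Gamma> k i l p * v p $ l))"
      by (subst sum.swap) (simp add: sum_distrib_right mult.assoc)
    also have "\<dots> = (\<Sum>i\<in>UNIV. \<Sum>k\<in>UNIV. \<Sum>l\<in>UNIV. P r p $ i $ k * (\<Gamma> k i l p * v p $ l))"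
      by (intro sum.cong refl sum.swap)
    finally show ?thesis by (simp add: sum_distrib_left)
  qed
  ultimately show ?thesis by (simp add: distrib_left sum.distrib)
qed

end

section \<open>The operators \<open>L\<^sub>r\<close> and the Gauss equation\<close>

lemma mean_curvature_1: "mean_curvature c x N 1 p = sym_curv (shape_operator c x N p) 1 / CARD('n)"
  for c :: "('a, 'n::finite) chart"
  by (simp add: mean_curvature_def S_curv_def sym_curv_def)

text \<open>The Christoffel symbols of the first kind, with the index l lowered.\<close>

definition koszul_form ::
  "('a, 'n::finite) chart \<Rightarrow> ('a \<Rightarrow> real ^ 'm::finite) \<Rightarrow> 'n \<Rightarrow> 'n \<Rightarrow> 'n \<Rightarrow> 'a \<Rightarrow> real"
where
  "koszul_form c x i j l p = (pd c i (\<lambda>q. metric c x q $ j $ l) p + pd c j (\<lambda>q. metric c x q $ i $ l) p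
          - pd c l (\<lambda>q. metric c x q $ i $ j) p) / 2"

text \<open>The curvature tensor with all indices lowered, assembled from the metric coefficients
  alone. It therefore agrees for isometric immersions, as \<open>riemann_form_cong\<close> records;
  the signs are such that \<open>gauss_equation\<close> reads b_ij b_lk - b_il b_jk.\<close>

definition riemann_form ::
  "('a, 'n::finite) chart \<Rightarrow> ('a \<Rightarrow> real ^ 'm::finite) \<Rightarrow> 'n \<Rightarrow> 'n \<Rightarrow> 'n \<Rightarrow> 'n \<Rightarrow> 'a \<Rightarrow> real"
where
  "riemann_form c x i j l k p = pd c l (koszul_form c x i j k) p - pd c j (koszul_form c x i l k) p
    - (\<Sum>a\<in>UNIV. \<Sum>b\<in>UNIV. metric c x p $ a $ b *
        (christoffel c x a i j p * christoffel c x b l k p - christoffel c x a i l p * christoffel c x b j k p))"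

lemma (in coord_chart) riemann_form_cong:
  assumes m: "\<And>p. p \<in> fst c \<Longrightarrow> metric c x p = metric c y p" and p: "p \<in> fst c"
  shows "riemann_form c x i j l k p = riemann_form c y i j l k p"
proof -
  have 1: "pd c i (\<lambda>q. metric c x q $ a $ b) p = pd c i (\<lambda>q. metric c y q $ a $ b) p"
    if "p \<in> fst c" for p i a b
    by (rule pd_cong[OF _ that]) (simp add: m)
  have "koszul_form c x i j k p = koszul_form c y i j k p" if "p \<in> fst c" for p i j k
    by (simp add: koszul_form_def 1[OF that])
  then have 2: "pd c l (koszul_form c x i j k) p = pd c l (koszul_form c y i j k) p" for l i j k
    by (intro pd_cong p)
  have "christoffel c x a i j p = christoffel c y a i j p" for a i j
    by (simp add: christoffel_def 1[OF p] m[OF p])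
  then show ?thesis by (simp add: riemann_form_def 2 m[OF p])
qed

context hypersurface_chart
begin

definition grad :: "('a \<Rightarrow> real) \<Rightarrow> 'a \<Rightarrow> real^'n" where
  "grad u p = G p *v (\<chi> k. pd c k u p)"

lemma grad_nth: "grad u p $ l = (\<Sum>k\<in>UNIV. G p $ l $ k * pd c k u p)"
  by (simp add: grad_def matrix_vector_mult_def)

lemma g_grad: "p \<in> fst c \<Longrightarrow> g p *v grad u p = (\<chi> k. pd c k u p)"
  unfolding grad_def matrix_vector_mul_assoc by (simp add: g_G)

lemma g_grad_nth: "p \<in> fst c \<Longrightarrow> (\<Sum>l\<in>UNIV. g p $ m $ l * grad u p $ l) = pd c m u p"
  using arg_cong[OF g_grad, of p "\<lambda>w. w $ m" u] by (simp add: matrix_vector_mult_def)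

lemma grad_smooth: "Ck_chart c (Suc k) u \<Longrightarrow> Ck_chart c k (\<lambda>p. grad u p $ l)"
  unfolding grad_nth by (intro Ck_chart_sum Ck_chart_mult G_smooth Ck_chart_pd)

text \<open>Differentiate g grad u = du. The two terms in the derivative of the metric supply the
  Christoffel correction of the gradient and that of the Hessian; raising the index
  finishes.\<close>

lemma covariant_derivative_grad:
  assumes p: "p \<in> fst c" and u: "Ck_chart c 2 u"
  shows "pd c i (\<lambda>q. grad u q $ l) p + (\<Sum>j\<in>UNIV. \<Gamma> l i j p * grad u p $ j)
    = hessian_operator c x u p $ l $ i"
proof -
  have u': "Ck_chart c (Suc 1) u" using u by (simp add: numeral_2_eq_2)
  note gs = grad_smooth[OF u']
  have "(\<Sum>l\<in>UNIV. g p $ m $ l * (pd c i (\<lambda>q. grad u q $ l) p + (\<Sum>j\<in>UNIV. \<Gamma> l i j p * grad u p $ j)))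
    = hessian_form c x u p $ m $ i" for m
  proof -
    have "pd c i (pd c m u) p = pd c i (\<lambda>q. \<Sum>l\<in>UNIV. g q $ m $ l * grad u q $ l) p"
      by (rule pd_cong[OF _ p]) (simp add: g_grad_nth)
    also have "\<dots> = (\<Sum>l\<in>UNIV. (pd c i (X m) p \<bullet> X l p + X m p \<bullet> pd c i (X l) p) * grad u p $ l
        + g p $ m $ l * pd c i (\<lambda>q. grad u q $ l) p)"
      by (subst pd_sum[OF p Ck_chart_mult[OF g_smooth gs]]) (simp add: pd_mult[OF p g_smooth gs] pd_g[OF p])
    also have "\<dots> = (\<Sum>l\<in>UNIV. (pd c i (X m) p \<bullet> X l p) * grad u p $ l)
      + (\<Sum>l\<in>UNIV. (pd c i (X l) p \<bullet> X m p) * grad u p $ l)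
      + (\<Sum>l\<in>UNIV. g p $ m $ l * pd c i (\<lambda>q. grad u q $ l) p)"
      by (simp add: sum.distrib distrib_right inner_commute)
    finally have 1: "pd c i (pd c m u) p = \<dots>" .
    have 2: "(\<Sum>l\<in>UNIV. (pd c i (X l) p \<bullet> X m p) * grad u p $ l)
        = (\<Sum>l\<in>UNIV. g p $ m $ l * (\<Sum>j\<in>UNIV. \<Gamma> l i j p * grad u p $ j))"
      unfolding g_christoffel[OF p, symmetric] sum_distrib_left sum_distrib_right
      by (subst sum.swap) (simp add: mult.assoc)
    have 3: "(\<Sum>l\<in>UNIV. (pd c i (X m) p \<bullet> X l p) * grad u p $ l) = (\<Sum>k\<in>UNIV. \<Gamma> k m i p * pd c k u p)"
      unfolding christoffel_eq[OF p] grad_nth sum_distrib_left sum_distrib_right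
      by (subst sum.swap) (simp add: mult_ac G_sym[OF p, of _ _] X_commute[OF p, of i m])
    have 4: "hessian_form c x u p $ m $ i = pd c i (pd c m u) p - (\<Sum>k\<in>UNIV. \<Gamma> k m i p * pd c k u p)"
      using pd_commute[OF p u, of m i] by (simp add: hessian_form_def)
    show ?thesis unfolding 4 1 2 3 by (simp add: distrib_left sum.distrib)
  qed
  then show ?thesis
    unfolding hessian_operator_def matrix_matrix_mult_def vec_lambda_beta
    using sum_g_eq_iff[OF p, of "\<lambda>l. pd c i (\<lambda>q. grad u q $ l) p + (\<Sum>j\<in>UNIV. \<Gamma> l i j p * grad u p $ j)"
        "\<lambda>m. hessian_form c x u p $ m $ i"] by blast
qed

lemma divergence_newton_grad:
  assumes p: "p \<in> fst c" and r: "r \<le> CARD('n)" and u: "Ck_chart c 2 u" and \<phi>: "Ck_chart c 1 \<phi>"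
  shows "(\<Sum>i\<in>UNIV. pd c i (\<lambda>q. W q * (\<phi> q *\<^sub>R (P r q *v grad u q)) $ i) p)
    = W p * (\<phi> p * L_op c x N r u p + (\<Sum>i\<in>UNIV. pd c i \<phi> p * (P r p *v grad u p) $ i))"
proof -
  have u': "Ck_chart c (Suc 1) u" using u by (simp add: numeral_2_eq_2)
  note gs = grad_smooth[OF u']
  have v: "Ck_chart c 1 (\<lambda>q. (\<phi> q *\<^sub>R grad u q) $ l)" for l
    using Ck_chart_mult[OF \<phi> gs] by simp
  have "(\<Sum>i\<in>UNIV. pd c i (\<lambda>q. W q * (\<phi> q *\<^sub>R (P r q *v grad u q)) $ i) p)
    = (\<Sum>i\<in>UNIV. pd c i (\<lambda>q. W q * (P r q *v (\<phi> q *\<^sub>R grad u q)) $ i) p)"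
    by (simp add: matrix_vector_mult_scaleR)
  also have "\<dots> = W p * (\<Sum>i\<in>UNIV. \<Sum>l\<in>UNIV. P r p $ i $ l *
      (pd c i (\<lambda>q. (\<phi> q *\<^sub>R grad u q) $ l) p + (\<Sum>j\<in>UNIV. \<Gamma> l i j p * (\<phi> p *\<^sub>R grad u p) $ j)))"
    by (rule divergence_newton_field[OF p r v])
  also have "\<dots> = W p * (\<Sum>i\<in>UNIV. \<Sum>l\<in>UNIV. P r p $ i $ l *
      (pd c i \<phi> p * grad u p $ l + \<phi> p * hessian_operator c x u p $ l $ i))"
    unfolding covariant_derivative_grad[OF p u, symmetric]
    by (simp add: pd_mult[OF p \<phi> gs] distrib_left sum_distrib_left mult.left_commute add.assoc)
  also have "(\<Sum>i\<in>UNIV. \<Sum>l\<in>UNIV. P r p $ i $ l *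
      (pd c i \<phi> p * grad u p $ l + \<phi> p * hessian_operator c x u p $ l $ i))
    = \<phi> p * L_op c x N r u p + (\<Sum>i\<in>UNIV. pd c i \<phi> p * (P r p *v grad u p) $ i)"
    by (simp add: L_op_def newton_eq_newton_mat trace_def matrix_matrix_mult_def matrix_vector_mult_def
        distrib_left sum.distrib sum_distrib_left mult.left_commute)
  finally show ?thesis .
qed

lemma inner_grad_pos:
  assumes "p \<in> fst c"
  shows "(\<Sum>i\<in>UNIV. pd c i u p * w $ i) = w \<bullet> (g p *v grad u p)"
  by (simp add: g_grad[OF assms] inner_vec_def mult.commute)

lemma grad_eq_0_iff:
  assumes "p \<in> fst c"
  shows "grad u p = 0 \<longleftrightarrow> (\<forall>i. pd c i u p = 0)"
proof
  assume "grad u p = 0"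
  then have "(\<chi> k. pd c k u p) = 0" using g_grad[OF assms, of u] by simp
  then show "\<forall>i. pd c i u p = 0" by (simp add: vec_eq_iff)
qed (simp add: grad_nth vec_eq_iff)

text \<open>Second partial derivatives of half the squared norm are g_ij + x . d_i X_j. The
  tangential part of d_i X_j cancels against the Christoffel term of the Hessian, and the normal
  part leaves rho times the second fundamental form.\<close>

lemma position_hessian:
  assumes p: "p \<in> fst c"
  shows "hessian_operator c x (\<lambda>q. (x q \<bullet> x q) / 2) p = mat 1 + support_function x N p *\<^sub>R A p"
proof -
  define u where "u q = (x q \<bullet> x q) / 2" for q
  have pdu: "pd c j u q = x q \<bullet> X j q" if "q \<in> fst c" for q j
  proof -
    have "pd c j (\<lambda>q. (1/2) * (x q \<bullet> x q)) q = (1/2) * (X j q \<bullet> x q + x q \<bullet> X j q)"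
      by (subst pd_cmult[OF that Ck_chart_inner[OF x_smooth x_smooth]])
        (simp only: pd_inner[OF that x_smooth x_smooth])
    then show ?thesis by (simp add: u_def[abs_def] inner_commute)
  qed
  have pd2: "pd c i (pd c j u) p = g p $ i $ j + x p \<bullet> pd c i (X j) p" for i j
  proof -
    have "pd c i (pd c j u) p = pd c i (\<lambda>q. x q \<bullet> X j q) p"
      by (rule pd_cong[OF _ p]) (rule pdu)
    then show ?thesis by (simp add: pd_inner[OF p x_smooth X_smooth] g_nth)
  qed
  have "x p \<bullet> pd c i (X j) p - (\<Sum>k\<in>UNIV. \<Gamma> k i j p * (x p \<bullet> X k p)) = (N p \<bullet> pd c i (X j) p) * (x p \<bullet> N p)" for i j
    using arg_cong[OF pd_X_decomposition[OF p, of i j], of "\<lambda>w. x p \<bullet> w"]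
    by (simp add: inner_add_right inner_sum_right)
  then have "hessian_form c x u p = g p + support_function x N p *\<^sub>R (g p ** A p)"
    by (simp add: vec_eq_iff hessian_form_def pd2 pdu[OF p] matrix_matrix_mult_def g_A[OF p]
        support_function_def X_commute[OF p] algebra_simps)
  then show ?thesis
    unfolding u_def[abs_def] hessian_operator_def
    by (simp add: matrix_add_ldistrib matrix_mult_scaleR_right matrix_mul_assoc G_g[OF p])
qed

lemma L_op_position:
  assumes "p \<in> fst c"
  shows "L_op c x N r (\<lambda>q. (x q \<bullet> x q) / 2) p
    = trace (P r p) + support_function x N p * trace (P r p ** A p)"
  by (simp add: L_op_def newton_eq_newton_mat position_hessian[OF assms] matrix_add_ldistrib trace_add
      matrix_mult_scaleR_right) (simp add: trace_def sum_distrib_left)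

lemma L_op_position_0:
  assumes "p \<in> fst c"
  shows "L_op c x N 0 (\<lambda>q. (x q \<bullet> x q) / 2) p = CARD('n) + support_function x N p * trace (A p)"
  by (simp add: L_op_position[OF assms] trace_I)

lemma L_op_position_1:
  assumes "p \<in> fst c"
  shows "L_op c x N 1 (\<lambda>q. (x q \<bullet> x q) / 2) p
    = (CARD('n) - 1) * trace (A p) + support_function x N p * ((trace (A p))\<^sup>2 - trace (A p ** A p))"
proof -
  have P1: "P 1 p = trace (A p) *\<^sub>R mat 1 - A p"
    using sym_curv_1[OF A_diagonalizable[OF assms]] by (simp add: mat_eq_scaleR_mat_1[of "trace _"])
  have tr: "trace (t *\<^sub>R M) = t * trace M" for t and M :: "real^'n^'n"
    by (simp add: trace_def sum_distrib_left)
  show ?thesis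
    unfolding L_op_position[OF assms] P1
    by (simp add: trace_sub matrix_diff_rdistrib matrix_mult_scaleR_left tr trace_I power2_eq_square
        algebra_simps)
qed

lemma koszul_form_eq: "p \<in> fst c \<Longrightarrow> koszul_form c x i j l p = pd c i (X j) p \<bullet> X l p"
  unfolding koszul_form_def by (rule koszul[symmetric])

text \<open>Differentiating the products d_i X_j . X_k and antisymmetrizing removes the third
  derivatives of x, which commute. The remaining products of second derivatives split into
  tangential parts, which are the Christoffel terms, and normal parts, which are the products of
  second fundamental forms.\<close>

lemma gauss_equation:
  assumes p: "p \<in> fst c"
  shows "(N p \<bullet> pd c i (X j) p) * (N p \<bullet> pd c l (X k) p) - (N p \<bullet> pd c i (X l) p) * (N p \<bullet> pd c j (X k) p)
    = riemann_form c x i j l k p"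
proof -
  have X2: "Ck_chart c k (pd c i (X j))" for i j k by (rule Ck_chart_pd[OF X_smooth])
  have d: "pd c l (koszul_form c x i j k) p = pd c l (pd c i (X j)) p \<bullet> X k p + pd c i (X j) p \<bullet> pd c l (X k) p" for i j k l
  proof -
    have "pd c l (koszul_form c x i j k) p = pd c l (\<lambda>q. pd c i (X j) q \<bullet> X k q) p"
      by (rule pd_cong[OF _ p]) (rule koszul_form_eq)
    then show ?thesis by (simp add: pd_inner[OF p X2 X_smooth])
  qed
  have third: "pd c l (pd c i (X j)) p = pd c j (pd c i (X l)) p"
  proof -
    have "pd c l (pd c i (X j)) p = pd c l (pd c j (X i)) p"
      by (rule pd_cong[OF X_commute p])
    also have "\<dots> = pd c j (pd c l (X i)) p" by (rule pd_commute[OF p X_smooth])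
    also have "\<dots> = pd c j (pd c i (X l)) p" by (rule pd_cong[OF X_commute p])
    finally show ?thesis .
  qed
  have NN: "N p \<bullet> N p = 1" using norm_N[OF p] by (simp add: norm_eq_1)
  have XN: "X a p \<bullet> N p = 0" for a using N_pd_x[OF p, of a] by (simp add: inner_commute)
  have t: "pd c i (X j) p \<bullet> pd c l (X k) p
    = (\<Sum>a\<in>UNIV. \<Sum>b\<in>UNIV. g p $ a $ b * (\<Gamma> a i j p * \<Gamma> b l k p))
      + (N p \<bullet> pd c i (X j) p) * (N p \<bullet> pd c l (X k) p)" for i j k l
  proof -
    have "pd c i (X j) p \<bullet> pd c l (X k) p
      = ((\<Sum>a\<in>UNIV. \<Gamma> a i j p *\<^sub>R X a p) + (N p \<bullet> pd c i (X j) p) *\<^sub>R N p)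
        \<bullet> ((\<Sum>b\<in>UNIV. \<Gamma> b l k p *\<^sub>R X b p) + (N p \<bullet> pd c l (X k) p) *\<^sub>R N p)"
      using pd_X_decomposition[OF p] by metis
    also have "\<dots> = (\<Sum>a\<in>UNIV. \<Gamma> a i j p *\<^sub>R X a p) \<bullet> (\<Sum>b\<in>UNIV. \<Gamma> b l k p *\<^sub>R X b p)
      + (N p \<bullet> pd c i (X j) p) * (N p \<bullet> pd c l (X k) p)"
      by (simp add: inner_add_left inner_add_right inner_sum_left inner_sum_right N_pd_x[OF p] XN NN)
    also have "(\<Sum>a\<in>UNIV. \<Gamma> a i j p *\<^sub>R X a p) \<bullet> (\<Sum>b\<in>UNIV. \<Gamma> b l k p *\<^sub>R X b p)
      = (\<Sum>a\<in>UNIV. \<Sum>b\<in>UNIV. g p $ a $ b * (\<Gamma> a i j p * \<Gamma> b l k p))"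
      unfolding inner_sum_left inner_sum_right by (subst sum.swap) (simp add: g_nth mult_ac)
    finally show ?thesis .
  qed
  show ?thesis
    unfolding riemann_form_def d third t by (simp add: right_diff_distrib sum_subtractf)
qed

text \<open>The full contraction of the Gauss equation. Its right-hand side sees only the metric, so
  the left-hand side, which is defined by the immersion, is an isometry invariant.\<close>

lemma trace_gauss_equation:
  assumes p: "p \<in> fst c"
  shows "(trace (A p))\<^sup>2 - trace (A p ** A p)
    = (\<Sum>i\<in>UNIV. \<Sum>j\<in>UNIV. \<Sum>k\<in>UNIV. \<Sum>l\<in>UNIV. G p $ i $ j * G p $ l $ k * riemann_form c x i j l k p)"
proof -
  define b where "b i j = N p \<bullet> pd c i (X j) p" for i j
  have bs: "b i j = b j i" for i j by (simp add: b_def X_commute[OF p, of i j])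
  have A_eq: "A p $ i $ k = (\<Sum>j\<in>UNIV. G p $ i $ j * b j k)" for i k
    using sum_g_eq_iff[OF p, of "\<lambda>i. A p $ i $ k" "\<lambda>l. b l k"] g_A[OF p, of _ k]
    by (simp add: b_def X_commute[OF p, of k])
  have t1: "trace (A p) = (\<Sum>i\<in>UNIV. \<Sum>j\<in>UNIV. G p $ i $ j * b i j)"
    unfolding trace_def A_eq by (simp add: bs)
  have "(\<Sum>i\<in>UNIV. \<Sum>j\<in>UNIV. \<Sum>k\<in>UNIV. \<Sum>l\<in>UNIV. G p $ i $ j * G p $ l $ k * (b i j * b l k))
      = (\<Sum>i\<in>UNIV. \<Sum>j\<in>UNIV. (G p $ i $ j * b i j) * (\<Sum>k\<in>UNIV. \<Sum>l\<in>UNIV. G p $ l $ k * b l k))"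
    by (simp add: sum_distrib_left mult_ac)
  also have "(\<Sum>k\<in>UNIV. \<Sum>l\<in>UNIV. G p $ l $ k * b l k) = trace (A p)"
    unfolding t1 by (rule sum.swap)
  finally have 1: "(\<Sum>i\<in>UNIV. \<Sum>j\<in>UNIV. \<Sum>k\<in>UNIV. \<Sum>l\<in>UNIV. G p $ i $ j * G p $ l $ k * (b i j * b l k)) = (trace (A p))\<^sup>2"
    unfolding t1 power2_eq_square by (simp add: sum_distrib_right)
  have "trace (A p ** A p) = (\<Sum>i\<in>UNIV. \<Sum>k\<in>UNIV. (\<Sum>j\<in>UNIV. G p $ i $ j * b j k) * (\<Sum>l\<in>UNIV. G p $ k $ l * b l i))"
    by (simp add: trace_def matrix_matrix_mult_def A_eq)
  also have "\<dots> = (\<Sum>i\<in>UNIV. \<Sum>k\<in>UNIV. \<Sum>j\<in>UNIV. \<Sum>l\<in>UNIV. G p $ i $ j * G p $ l $ k * (b i l * b j k))"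
    unfolding sum_product
  proof (intro sum.cong refl)
    show "G p $ i $ j * b j k * (G p $ k $ l * b l i) = G p $ i $ j * G p $ l $ k * (b i l * b j k)" for i j k l
      using G_sym[OF p, of k l] bs[of i l] by simp
  qed
  also have "\<dots> = (\<Sum>i\<in>UNIV. \<Sum>j\<in>UNIV. \<Sum>k\<in>UNIV. \<Sum>l\<in>UNIV. G p $ i $ j * G p $ l $ k * (b i l * b j k))"
    by (intro sum.cong refl sum.swap)
  finally show ?thesis
    unfolding gauss_equation[OF p, symmetric] b_def[symmetric] right_diff_distrib sum_subtractf 1 by simp
qed

lemma spherical_shape_operator:
  assumes p: "p \<in> fst c" and N: "\<And>p. p \<in> fst c \<Longrightarrow> N p = t *\<^sub>R (x p - z)"
  shows "A p = mat (- t)"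
proof -
  have "pd c j N p = t *\<^sub>R X j p" for j
  proof -
    have "pd c j N p = pd c j (\<lambda>q. t *\<^sub>R (x q - z)) p" by (rule pd_cong[OF N p])
    then show ?thesis
      by (simp add: pd_scaleR[OF p Ck_chart_const Ck_chart_diff[OF x_smooth Ck_chart_const]]
          pd_diff[OF p x_smooth Ck_chart_const] pd_const)
  qed
  then have "(\<Sum>i\<in>UNIV. A p $ i $ j *\<^sub>R X i p) = (\<Sum>i\<in>UNIV. mat (- t) $ i $ j *\<^sub>R X i p)" for j
    by (simp add: sum_A_X[OF p] mat_def if_distrib[of "\<lambda>a. a *\<^sub>R _"] cong: if_cong)
  then have "(\<chi> i. A p $ i $ j - mat (- t) $ i $ j) = 0" for j
    by (intro X_independent[OF p]) (simp add: scaleR_diff_left sum_subtractf)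
  then have "A p $ i $ j = mat (- t) $ i $ j" for i j
    by (metis (no_types, lifting) right_minus_eq vec_lambda_beta zero_index)
  then show ?thesis by (simp add: vec_eq_iff)
qed

lemma umbilic_pd_eq_0:
  assumes p: "p \<in> fst c" and A: "A p = mat t"
  shows "pd c j (\<lambda>q. N q + t *\<^sub>R x q) p = 0"
proof -
  have "pd c j N p = - (t *\<^sub>R X j p)"
    using sum_A_X[OF p, of j] unfolding A
    by (simp add: mat_def if_distrib[of "\<lambda>a. a *\<^sub>R _"] cong: if_cong)
  then show ?thesis
    by (simp add: pd_add[OF p N_smooth Ck_chart_scaleR[OF Ck_chart_const x_smooth]]
        pd_scaleR[OF p Ck_chart_const x_smooth] pd_const)
qed

end

section \<open>Change of variables for compactly supported integrands\<close>

text \<open>The change of variables theorem of the library is restricted to vectors whose index type is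
  well-ordered; it carries over to arbitrary finite index types along a well-ordered copy.\<close>

typedef 'a well_ordered = "UNIV :: 'a set" ..

declare Rep_well_ordered_inverse [simp] Abs_well_ordered_inverse [simplified, simp]

definition index_of :: "'a well_ordered \<Rightarrow> nat" where
  "index_of a = (SOME f. inj f) (Rep_well_ordered a)"

lemma inj_index_of: "inj (index_of :: 'a::finite well_ordered \<Rightarrow> nat)"
proof -
  obtain f :: "'a \<Rightarrow> nat" where "inj f"
    using finite_imp_inj_to_nat_seg[of "UNIV :: 'a set"] by auto
  then have "inj (SOME f :: 'a \<Rightarrow> nat. inj f)" by (rule someI[of inj])
  from inj_eq[OF this] show ?thesis
    by (intro injI) (simp add: index_of_def Rep_well_ordered_inject)
qed

instantiation well_ordered :: (finite) wellorder
begin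

definition "a \<le> b \<longleftrightarrow> index_of a \<le> index_of b" for a b :: "'a well_ordered"

definition "a < b \<longleftrightarrow> index_of a < index_of b" for a b :: "'a well_ordered"

instance
proof
  fix P :: "'a well_ordered \<Rightarrow> bool" and a :: "'a well_ordered"
  assume *: "\<And>a. (\<And>b. b < a \<Longrightarrow> P b) \<Longrightarrow> P a"
  show "P a"
    by (induction a rule: measure_induct_rule[of index_of]) (use * in \<open>auto simp: less_well_ordered_def\<close>)
next
  fix a b c :: "'a well_ordered"
  show "a < b \<longleftrightarrow> a \<le> b \<and> \<not> b \<le> a" "a \<le> a" "a \<le> b \<or> b \<le> a"
    by (auto simp: less_eq_well_ordered_def less_well_ordered_def)
  show "a \<le> c" if "a \<le> b" "b \<le> c" using that by (simp add: less_eq_well_ordered_def)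
  show "a = b" if "a \<le> b" "b \<le> a"
    by (rule injD[OF inj_index_of]) (use that in \<open>simp add: less_eq_well_ordered_def\<close>)
qed

end

instance well_ordered :: (finite) finite
proof
  show "finite (UNIV :: 'a well_ordered set)"
    by (rule finite_imageD[of Rep_well_ordered]) (auto simp: inj_on_def Rep_well_ordered_inject)
qed

abbreviation relabel :: "real^'n \<Rightarrow> real^('n::finite) well_ordered" where
  "relabel v \<equiv> (\<chi> k. v $ Rep_well_ordered k)"

abbreviation unrelabel :: "real^('n::finite) well_ordered \<Rightarrow> real^'n" where
  "unrelabel w \<equiv> (\<chi> i. w $ Abs_well_ordered i)"

lemma relabel_unrelabel [simp]: "relabel (unrelabel w) = w" "unrelabel (relabel v) = v"
  by (simp_all add: vec_eq_iff Rep_well_ordered_inverse Abs_well_ordered_inverse)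

lemma bij_Rep_well_ordered: "bij Rep_well_ordered"
  by (simp add: bij_def inj_def Rep_well_ordered_inject surjI[of _ Abs_well_ordered] Abs_well_ordered_inverse)

lemma linear_relabel: "linear relabel" and linear_unrelabel: "linear unrelabel"
  by (auto intro!: linearI simp: vec_eq_iff)

lemma mem_relabel_image: "w \<in> relabel ` T \<longleftrightarrow> unrelabel w \<in> T"
proof
  assume "unrelabel w \<in> T"
  then show "w \<in> relabel ` T" by (rule image_eqI[rotated]) simp
qed auto

lemma mem_unrelabel_image: "v \<in> unrelabel ` S \<longleftrightarrow> relabel v \<in> S"
proof
  assume "relabel v \<in> S"
  then show "v \<in> unrelabel ` S" by (rule image_eqI[rotated]) simp
qed auto

lemma relabel_mem_cbox: "relabel v \<in> cbox (relabel a) (relabel b) \<longleftrightarrow> v \<in> cbox a b"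
proof -
  have "(\<forall>k. Q (Rep_well_ordered k)) \<longleftrightarrow> (\<forall>i. Q i)" for Q :: "'a \<Rightarrow> bool"
    using bij_is_surj[OF bij_Rep_well_ordered] by (metis surjD)
  from this[of "\<lambda>i. a $ i \<le> v $ i \<and> v $ i \<le> b $ i"] show ?thesis by (simp add: mem_box_cart)
qed

lemma relabel_image_cbox: "relabel ` cbox a b = cbox (relabel a) (relabel b)"
proof (rule set_eqI)
  show "w \<in> relabel ` cbox a b \<longleftrightarrow> w \<in> cbox (relabel a) (relabel b)" for w
    unfolding mem_relabel_image relabel_mem_cbox[of "unrelabel w", symmetric] by simp
qed

lemma unrelabel_image_cbox: "unrelabel ` cbox c d = cbox (unrelabel c) (unrelabel d)"
proof (rule set_eqI)
  show "v \<in> unrelabel ` cbox c d \<longleftrightarrow> v \<in> cbox (unrelabel c) (unrelabel d)" for v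
    unfolding mem_unrelabel_image relabel_mem_cbox[of v "unrelabel c", symmetric] by simp
qed

lemma content_relabel: "measure lborel (cbox (unrelabel c) (unrelabel d)) = measure lborel (cbox c d)"
proof -
  have "cbox (unrelabel c) (unrelabel d) = {} \<longleftrightarrow> cbox c d = {}"
    unfolding unrelabel_image_cbox[symmetric] by simp
  moreover have "(\<Prod>i\<in>UNIV. unrelabel d $ i - unrelabel c $ i) = (\<Prod>k\<in>UNIV. d $ k - c $ k)"
    by (subst prod.reindex_bij_betw[OF bij_Rep_well_ordered, symmetric])
      (simp add: Rep_well_ordered_inverse)
  ultimately show ?thesis by (simp add: content_cbox_if_cart)
qed

text \<open>The integrand is extended by 0 to a box around S, since
  \<open>has_integral_twiddle\<close> transports integrals over boxes; boundedness of S provides the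
  box.\<close>

lemma has_integral_measure_preserving_boxes:
  fixes r :: "'a::euclidean_space \<Rightarrow> 'b::euclidean_space" and f :: "'a \<Rightarrow> 'c::euclidean_space"
  assumes ru: "\<And>w. r (u w) = w" "\<And>v. u (r v) = v" and "\<And>w. continuous (at w) u"
    and r: "\<And>a b. \<exists>c d. r ` cbox a b = cbox c d" and u: "\<And>c d. \<exists>a b. u ` cbox c d = cbox a b"
    and m: "\<And>c d. measure lborel (u ` cbox c d) = measure lborel (cbox c d)"
    and S: "bounded S" and f: "(f has_integral i) S"
  shows "((\<lambda>w. f (u w)) has_integral i) (r ` S)"
proof -
  obtain a where a: "S \<subseteq> cbox (- a) a" using bounded_subset_cbox_symmetric[OF S] by blast
  have "((\<lambda>x. if x \<in> S then f x else 0) has_integral i) (cbox (- a) a)"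
    using a f by simp
  then have "((\<lambda>w. if u w \<in> S then f (u w) else 0) has_integral (1 / 1) *\<^sub>R i) (r ` cbox (- a) a)"
    by (intro has_integral_twiddle[where f="\<lambda>x. if x \<in> S then f x else 0"]) (simp_all add: assms)
  moreover have "u w \<in> S \<longleftrightarrow> w \<in> r ` S" for w
    by (metis ru(1) ru(2) image_iff)
  ultimately have "((\<lambda>w. if w \<in> r ` S then f (u w) else 0) has_integral i) (r ` cbox (- a) a)"
    by simp
  then show ?thesis using a by (subst (asm) has_integral_restrict) auto
qed

lemma continuous_relabel: "continuous (at v) relabel" and continuous_unrelabel: "continuous (at w) unrelabel"
  using linear_relabel linear_unrelabel
  by (auto intro!: linear_continuous_at simp: linear_conv_bounded_linear)

lemma has_integral_relabel:
  fixes f :: "real^'n \<Rightarrow> 'b::euclidean_space"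
  assumes "bounded S" "(f has_integral i) S"
  shows "((\<lambda>w. f (unrelabel w)) has_integral i) (relabel ` S)"
  by (rule has_integral_measure_preserving_boxes[OF _ _ continuous_unrelabel _ _ _ assms])
    (auto simp: relabel_image_cbox unrelabel_image_cbox content_relabel)

lemma has_integral_unrelabel:
  fixes f :: "_ \<Rightarrow> 'b::euclidean_space"
  assumes "bounded S" "(f has_integral i) S"
  shows "((\<lambda>v. f (relabel v)) has_integral i) (unrelabel ` S)"
proof (rule has_integral_measure_preserving_boxes[OF _ _ continuous_relabel _ _ _ assms])
  show "measure lborel (relabel ` cbox a b) = measure lborel (cbox a b)" for a b :: "real^'n"
    using content_relabel[of "relabel a" "relabel b"] by (simp add: relabel_image_cbox)
qed (auto simp: relabel_image_cbox unrelabel_image_cbox)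

text \<open>Conjugating a product of transpositions gives a product of equally many transpositions
  with renamed entries.\<close>

lemma sign_conjugate:
  fixes h :: "'k \<Rightarrow> 'l"
  assumes "bij h" "permutation p"
  shows "sign (h \<circ> p \<circ> inv h) = sign p"
proof -
  have "swapidseq n (h \<circ> p \<circ> inv h)" if "swapidseq n p" for n
    using that
  proof (induction n p rule: swapidseq.induct)
    case id
    have eq: "h \<circ> id \<circ> inv h = id"
      unfolding comp_id by (rule surj_iff[THEN iffD1, OF bij_is_surj[OF assms(1)]])
    show ?case unfolding eq by (rule swapidseq.id)
  next
    case (comp_Suc n p a b)
    have eq: "h \<circ> (Transposition.transpose a b \<circ> p) \<circ> inv h = Transposition.transpose (h a) (h b) \<circ> (h \<circ> p \<circ> inv h)"
      using assms(1) by (auto simp: fun_eq_iff Transposition.transpose_def bij_is_inj inj_eq)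
    have "h a \<noteq> h b" using comp_Suc assms(1) by (simp add: bij_is_inj inj_eq)
    then show ?case unfolding eq by (rule swapidseq.comp_Suc[OF comp_Suc.IH])
  qed
  moreover obtain n where "swapidseq n p" using assms(2) by (auto simp: permutation_def)
  ultimately have "evenperm (h \<circ> p \<circ> inv h) = evenperm p"
    by (metis evenperm_unique)
  then show ?thesis by (simp add: sign_def)
qed

lemma det_reindex:
  fixes M :: "real^'n^'n" and h :: "'k::finite \<Rightarrow> 'n"
  assumes "bij h"
  shows "det (\<chi> a b. M $ h a $ h b) = det M"
proof -
  have inj: "inj h" and surj: "surj h" using assms by (auto simp: bij_def)
  have "bij_betw (\<lambda>p. h \<circ> p \<circ> inv h) {p. p permutes UNIV} {p. p permutes UNIV}"
  proof (rule bij_betwI[where g="\<lambda>q. inv h \<circ> q \<circ> h"])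
    have b: "p permutes UNIV \<longleftrightarrow> bij p" for p :: "'c \<Rightarrow> 'c"
      by (auto intro: permutes_bij bij_imp_permutes)
    have bi: "bij (inv h)" by (rule bij_imp_bij_inv[OF assms])
    show "(\<lambda>p. h \<circ> p \<circ> inv h) \<in> {p. p permutes UNIV} \<rightarrow> {p. p permutes UNIV}"
      using assms bi by (auto simp: b intro!: bij_comp)
    show "(\<lambda>q. inv h \<circ> q \<circ> h) \<in> {p. p permutes UNIV} \<rightarrow> {p. p permutes UNIV}"
      using assms bi by (auto simp: b intro!: bij_comp)
    show "inv h \<circ> (h \<circ> p \<circ> inv h) \<circ> h = p" for p
      using inj by (simp add: fun_eq_iff)
    show "h \<circ> (inv h \<circ> q \<circ> h) \<circ> inv h = q" for q
      using surj by (simp add: fun_eq_iff surj_f_inv_f)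
  qed
  then have "det M = (\<Sum>p | p permutes UNIV. of_int (sign (h \<circ> p \<circ> inv h)) *
      (\<Prod>i\<in>UNIV. M $ i $ (h \<circ> p \<circ> inv h) i))"
    unfolding det_def by (rule sum.reindex_bij_betw[symmetric])
  also have "\<dots> = (\<Sum>p | p permutes UNIV. of_int (sign p) * (\<Prod>a\<in>UNIV. M $ h a $ h (p a)))"
  proof (intro sum.cong refl)
    fix p :: "'k \<Rightarrow> 'k" assume "p \<in> {p. p permutes UNIV}"
    then have "permutation p" by (auto simp: permutation_permutes)
    moreover have "(\<Prod>i\<in>UNIV. M $ i $ (h \<circ> p \<circ> inv h) i) = (\<Prod>a\<in>UNIV. M $ h a $ h (p a))"
      by (subst prod.reindex_bij_betw[OF assms, symmetric]) (simp add: inj)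
    ultimately show "of_int (sign (h \<circ> p \<circ> inv h)) * (\<Prod>i\<in>UNIV. M $ i $ (h \<circ> p \<circ> inv h) i)
      = of_int (sign p) * (\<Prod>a\<in>UNIV. M $ h a $ h (p a))"
      by (simp add: sign_conjugate[OF assms])
  qed
  finally show ?thesis by (simp add: det_def)
qed

lemma absolutely_integrable_on_compact:
  fixes f :: "'a::euclidean_space \<Rightarrow> 'b::euclidean_space"
  assumes "compact S" "continuous_on S f"
  shows "f absolutely_integrable_on S"
proof -
  have "integrable lborel (\<lambda>x. indicator S x *\<^sub>R f x)" by (rule borel_integrable_compact[OF assms])
  then show ?thesis
    unfolding set_integrable_def by (subst integrable_completion) auto
qed

lemma integrable_on_compact:
  fixes f :: "'a::euclidean_space \<Rightarrow> 'b::euclidean_space"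
  shows "compact S \<Longrightarrow> continuous_on S f \<Longrightarrow> f integrable_on S"
  using absolutely_integrable_on_compact set_lebesgue_integral_eq_integral(1) by blast

lemma integral_change_of_variables_compact_well_ordered:
  fixes g :: "real^'k::{finite,wellorder} \<Rightarrow> real^'k::_" and f :: "real^'k::_ \<Rightarrow> real"
  assumes S: "compact S" and g': "\<And>y. y \<in> S \<Longrightarrow> (g has_derivative g' y) (at y within S)"
    and inj: "inj_on g S" and f: "continuous_on (g ` S) f"
  shows "((\<lambda>y. \<bar>det (matrix (g' y))\<bar> * f (g y)) has_integral integral (g ` S) f) S"
proof -
  \<comment> \<open>The theorem applied below is about integrands with values in a vector type, so
    the scalar function is wrapped into \<open>real^1\<close> and its component extracted
    afterwards.\<close>
  define F :: "real^'k::_ \<Rightarrow> real^1" where "F y = (\<chi> i. f y)" for y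
  have "continuous_on S g" using g' has_derivative_continuous_on by blast
  then have gS: "compact (g ` S)" using S compact_continuous_image by blast
  have F: "F absolutely_integrable_on g ` S"
    unfolding F_def by (intro absolutely_integrable_on_compact gS continuous_on_vec_lambda f)
  then have *: "(\<lambda>y. \<bar>det (matrix (g' y))\<bar> *\<^sub>R F (g y)) absolutely_integrable_on S \<and>
      integral S (\<lambda>y. \<bar>det (matrix (g' y))\<bar> *\<^sub>R F (g y)) = integral (g ` S) F"
    using has_absolute_integral_change_of_variables_compact[OF S g' inj, of F "integral (g ` S) F"]
    by blast
  then have "((\<lambda>y. \<bar>det (matrix (g' y))\<bar> *\<^sub>R F (g y)) has_integral integral (g ` S) F) S"
    using set_lebesgue_integral_eq_integral(1) has_integral_iff by blast
  then have "((\<lambda>y. (\<bar>det (matrix (g' y))\<bar> *\<^sub>R F (g y)) $ 1) has_integral integral (g ` S) F $ 1) S"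
    using has_integral_linear[OF _ bounded_linear_vec_nth] by (force simp: o_def)
  moreover have "integral (g ` S) F $ 1 = integral (g ` S) f"
    using integral_component_eq_cart[OF set_lebesgue_integral_eq_integral(1)[OF F], of 1]
    by (simp add: F_def)
  ultimately show ?thesis by (simp add: F_def)
qed

text \<open>Conjugate \<open>g\<close> by \<open>relabel\<close>, apply the well-ordered case and
  transport both integrals back. The Jacobian determinant does not change, by
  \<open>det_reindex\<close>.\<close>

lemma integral_change_of_variables_compact:
  fixes g :: "real^'n \<Rightarrow> real^'n" and f :: "real^'n \<Rightarrow> real"
  assumes S: "compact S" and g': "\<And>y. y \<in> S \<Longrightarrow> (g has_derivative g' y) (at y within S)"
    and inj: "inj_on g S" and f: "continuous_on (g ` S) f"
  shows "integral (g ` S) f = integral S (\<lambda>y. \<bar>det (matrix (g' y))\<bar> * f (g y))"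
proof -
  have blr: "bounded_linear (relabel :: real^'n \<Rightarrow> _)" "bounded_linear (unrelabel :: _ \<Rightarrow> real^'n)"
    using linear_relabel linear_unrelabel by (simp_all add: linear_conv_bounded_linear)
  define G where "G w = relabel (g (unrelabel w))" for w
  define G' where "G' w = (\<lambda>v. relabel (g' (unrelabel w) (unrelabel v)))" for w
  have gS: "compact (g ` S)"
    using S g' compact_continuous_image has_derivative_continuous_on by blast
  have lS: "compact (relabel ` S)"
    by (intro compact_continuous_image S linear_continuous_on blr)
  have ul: "unrelabel ` relabel ` T = T" for T :: "(real^'n) set" by (simp add: image_image)
  have GS: "G ` relabel ` S = relabel ` (g ` S)" by (simp add: G_def image_image)
  have "(G has_derivative G' w) (at w within relabel ` S)" if "w \<in> relabel ` S" for w
  proof -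
    have "unrelabel w \<in> S" using that by auto
    then have "(g has_derivative g' (unrelabel w)) (at (unrelabel w) within unrelabel ` relabel ` S)"
      using g' by (simp add: ul)
    from diff_chain_within[OF bounded_linear_imp_has_derivative[OF blr(2)] this]
    have "((\<lambda>w. g (unrelabel w)) has_derivative (\<lambda>v. g' (unrelabel w) (unrelabel v))) (at w within relabel ` S)"
      by (simp add: o_def)
    from bounded_linear.has_derivative[OF blr(1) this] show ?thesis by (simp add: G_def[abs_def] G'_def)
  qed
  moreover have "inj_on G (relabel ` S)"
  proof (rule inj_onI)
    fix w w' assume *: "w \<in> relabel ` S" "w' \<in> relabel ` S" "G w = G w'"
    then have "g (unrelabel w) = g (unrelabel w')" by (metis G_def relabel_unrelabel(2))
    then have "unrelabel w = unrelabel w'" using * inj by (auto simp: mem_relabel_image dest: inj_onD)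
    then show "w = w'" by (metis relabel_unrelabel(1))
  qed
  moreover have "continuous_on (G ` relabel ` S) (\<lambda>w. f (unrelabel w))"
    unfolding GS
    by (rule continuous_on_compose2[OF f linear_continuous_on[OF blr(2)]]) (simp add: ul)
  ultimately have "((\<lambda>w. \<bar>det (matrix (G' w))\<bar> * f (unrelabel (G w))) has_integral
      integral (G ` relabel ` S) (\<lambda>w. f (unrelabel w))) (relabel ` S)"
    by (rule integral_change_of_variables_compact_well_ordered[OF lS])
  also have "integral (G ` relabel ` S) (\<lambda>w. f (unrelabel w)) = integral (g ` S) f"
    unfolding GS
    using has_integral_relabel[OF compact_imp_bounded[OF gS] integrable_integral[OF integrable_on_compact[OF gS f]]]
    by (rule integral_unique)
  also have "(\<lambda>w. \<bar>det (matrix (G' w))\<bar> * f (unrelabel (G w)))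
      = (\<lambda>w. \<bar>det (matrix (g' (unrelabel w)))\<bar> * f (g (unrelabel w)))"
  proof
    fix w
    have "unrelabel (axis k 1) = axis (Rep_well_ordered k) 1" for k :: "'n well_ordered"
      by (auto simp: vec_eq_iff axis_def Rep_well_ordered_inverse Abs_well_ordered_inverse)
    then have "matrix (G' w) = (\<chi> a b. matrix (g' (unrelabel w)) $ Rep_well_ordered a $ Rep_well_ordered b)"
      by (simp add: matrix_def G'_def vec_eq_iff)
    then show "\<bar>det (matrix (G' w))\<bar> * f (unrelabel (G w))
        = \<bar>det (matrix (g' (unrelabel w)))\<bar> * f (g (unrelabel w))"
      by (simp add: det_reindex[OF bij_Rep_well_ordered] G_def)
  qed
  finally have 1: "((\<lambda>w. \<bar>det (matrix (g' (unrelabel w)))\<bar> * f (g (unrelabel w))) has_integral integral (g ` S) f) (relabel ` S)" .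
  define h where "h y = \<bar>det (matrix (g' y))\<bar> * f (g y)" for y
  have "(h has_integral integral (g ` S) f) S"
    using has_integral_unrelabel[OF compact_imp_bounded[OF lS] 1] by (simp add: ul h_def[abs_def])
  then show ?thesis unfolding h_def by (simp add: integral_unique)
qed


section \<open>Integrals of derivatives of compactly supported functions\<close>

lemma integral_translate_eq:
  fixes F :: "'a::euclidean_space \<Rightarrow> real"
  assumes F: "F integrable_on cbox a b" "\<And>y. y \<notin> cbox a b \<Longrightarrow> F y = 0"
    and C: "cbox (a - v) (b - v) \<subseteq> cbox c d"
  shows "((\<lambda>y. F (y + v)) has_integral integral (cbox a b) F) (cbox c d)"
proof -
  have "((\<lambda>y. F (y + v)) has_integral integral (cbox a b) F) (cbox (a - v) (b - v))"
    using has_integral_affinity'[OF integrable_integral[OF F(1)], of 1 v] by simp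
  moreover have "F (y + v) = 0" if "y \<notin> cbox (a - v) (b - v)" for y
    by (rule F(2)) (use that in \<open>auto simp: mem_box algebra_simps\<close>)
  ultimately show ?thesis using C by (rule has_integral_on_superset)
qed

text \<open>Translates of F along e have the same integral over a box containing all their supports.
  Differentiating this constant under the integral sign at translation 0 gives the integral of the
  derivative.\<close>

lemma integral_derivative_compact_support_UNIV:
  fixes F :: "'a::euclidean_space \<Rightarrow> real"
  assumes F: "Ck_on 1 UNIV F" and supp: "\<And>y. y \<notin> cbox a b \<Longrightarrow> F y = 0"
  shows "\<exists>c d. cbox a b \<subseteq> cbox c d \<and> integral (cbox c d) (\<lambda>y. frechet_derivative F (at y) e) = 0"
proof -
  \<comment> \<open>The region swept out by the support under translations with parameter between -1
    and 1; the enlarged box has to contain it.\<close>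
  define T where "T = (\<lambda>(s, y). y - s *\<^sub>R e) ` ({- 1..1} \<times> cbox a b)"
  have "compact T"
    unfolding T_def
    by (intro compact_continuous_image compact_Times) (auto intro!: continuous_intros simp: split_beta)
  then obtain d where d: "T \<subseteq> cbox (- d) d"
    using bounded_subset_cbox_symmetric compact_imp_bounded by blast
  define C where "C = cbox (- d) d"
  have sub: "cbox (a - s *\<^sub>R e) (b - s *\<^sub>R e) \<subseteq> C" if "s \<in> {- 1..1}" for s
  proof
    fix y assume "y \<in> cbox (a - s *\<^sub>R e) (b - s *\<^sub>R e)"
    then have "y + s *\<^sub>R e \<in> cbox a b" by (auto simp: mem_box algebra_simps)
    then have "y \<in> T" unfolding T_def using that by (force intro!: image_eqI[of _ _ "(s, y + s *\<^sub>R e)"])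
    then show "y \<in> C" using d by (auto simp: C_def)
  qed
  have dF: "(F has_derivative frechet_derivative F (at y)) (at y)" for y
    using F by (auto intro: has_frechet_derivative)
  have cF: "continuous_on UNIV F" by (rule Ck_on_imp_continuous_on[OF F])
  have cdF: "continuous_on UNIV (\<lambda>y. frechet_derivative F (at y) e)" using F by simp
  have int: "((\<lambda>y. F (y + s *\<^sub>R e)) has_integral integral (cbox a b) F) C" if "s \<in> {- 1..1}" for s
    unfolding C_def
    by (rule integral_translate_eq[OF _ supp]) (use sub[OF that] cF in \<open>auto simp: C_def
      intro!: integrable_continuous continuous_on_subset[OF cF]\<close>)
  have *: "((\<lambda>s. integral C (\<lambda>y. F (y + s *\<^sub>R e))) has_field_derivative
      integral C (\<lambda>y. frechet_derivative F (at (y + 0 *\<^sub>R e)) e)) (at 0 within {- 1<..<1})"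
    unfolding C_def
  proof (rule leibniz_rule_field_derivative[where fx="\<lambda>s y. frechet_derivative F (at (y + s *\<^sub>R e)) e"])
    fix s y
    have "((\<lambda>s. y + s *\<^sub>R e) has_derivative (\<lambda>t. t *\<^sub>R e)) (at s within {- 1<..<1})"
      by (auto intro!: derivative_eq_intros)
    from has_derivative_compose[OF this dF]
    have "((\<lambda>s. F (y + s *\<^sub>R e)) has_derivative (\<lambda>t. frechet_derivative F (at (y + s *\<^sub>R e)) (t *\<^sub>R e))) (at s within {- 1<..<1})" .
    moreover have "frechet_derivative F (at (y + s *\<^sub>R e)) (t *\<^sub>R e) = t * frechet_derivative F (at (y + s *\<^sub>R e)) e" for t
      using linear_cmul[OF has_derivative_linear[OF dF]] by simp
    ultimately show "((\<lambda>s. F (y + s *\<^sub>R e)) has_field_derivative frechet_derivative F (at (y + s *\<^sub>R e)) e) (at s within {- 1<..<1})"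
      unfolding has_field_derivative_def by (elim has_derivative_eq_rhs) (simp add: fun_eq_iff)
  next
    show "(\<lambda>y. F (y + s *\<^sub>R e)) integrable_on cbox (- d) d" if "s \<in> {- 1<..<1}" for s
      using int[of s] that unfolding C_def by (meson has_integral_integrable atLeastAtMost_iff greaterThanLessThan_iff less_imp_le)
    show "continuous_on ({- 1<..<1} \<times> cbox (- d) d) (\<lambda>(s, y). frechet_derivative F (at (y + s *\<^sub>R e)) e)"
      unfolding split_beta
      by (rule continuous_on_compose2[OF cdF]) (auto intro!: continuous_intros)
  qed auto
  have D1: "((\<lambda>s. integral C (\<lambda>y. F (y + s *\<^sub>R e))) has_field_derivative
      integral C (\<lambda>y. frechet_derivative F (at y) e)) (at 0)"
  proof -
    have "at 0 within {- 1<..<1::real} = at 0" by (rule at_within_open) auto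
    then show ?thesis using * by (simp only: scaleR_zero_left add_0_right)
  qed
  have "((\<lambda>s. integral C (\<lambda>y. F (y + s *\<^sub>R e))) has_field_derivative 0) (at 0)"
    by (rule has_field_derivative_transform_within_open[OF DERIV_const[of "integral (cbox a b) F"] open_greaterThanLessThan[of "-1" 1]])
      (use int in \<open>auto intro!: integral_unique[symmetric]\<close>)
  from DERIV_unique[OF D1 this] have "integral C (\<lambda>y. frechet_derivative F (at y) e) = 0" .
  moreover have "cbox a b \<subseteq> C" using sub[of 0] by simp
  ultimately show ?thesis unfolding C_def by blast
qed

text \<open>Extending G by zero keeps it of class C^1, because U and the complement of the box are
  open, cover the space, and the extension is G on one and 0 on the other.\<close>

lemma integral_derivative_compact_support:
  fixes G :: "'a::euclidean_space \<Rightarrow> real"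
  assumes U: "open U" "cbox a b \<subseteq> U" and G: "Ck_on 1 U G" and supp: "\<And>y. y \<in> U - cbox a b \<Longrightarrow> G y = 0"
  shows "integral (cbox a b) (\<lambda>y. frechet_derivative G (at y) e) = 0"
proof -
  define F where "F y = (if y \<in> U then G y else 0)" for y
  have FG: "F y = G y" if "y \<in> U" for y using that by (simp add: F_def)
  have F0: "F y = 0" if "y \<notin> cbox a b" for y using that supp[of y] by (simp add: F_def)
  have o: "open (- cbox a b)" by (simp add: open_Compl closed_cbox)
  have "Ck_on 1 UNIV F"
  proof (rule Ck_on_local)
    fix y
    show "\<exists>T. open T \<and> y \<in> T \<and> Ck_on 1 T F"
    proof (cases "y \<in> U")
      case True
      then show ?thesis using U(1) Ck_on_cong[OF U(1) _ G, of F] FG by metis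
    next
      case False
      then have "y \<in> - cbox a b" using U(2) by auto
      then show ?thesis using o Ck_on_cong[OF o _ Ck_on_const[of 1 _ 0], of F] F0 by (metis ComplD)
    qed
  qed
  then obtain c d where cd: "cbox a b \<subseteq> cbox c d" "integral (cbox c d) (\<lambda>y. frechet_derivative F (at y) e) = 0"
    using integral_derivative_compact_support_UNIV F0 by blast
  have 0: "frechet_derivative F (at y) e = 0" if "y \<in> - cbox a b" for y
    using frechet_derivative_cong_open[OF o that, of F "\<lambda>_. 0"] F0 by simp
  have "integral (cbox c d) (\<lambda>y. frechet_derivative F (at y) e)
      = integral (cbox c d) (\<lambda>y. if y \<in> cbox a b then frechet_derivative F (at y) e else 0)"
    using 0 by (intro integral_cong) auto
  also have "\<dots> = integral (cbox a b) (\<lambda>y. frechet_derivative F (at y) e)"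
    using cd(1) by (simp add: integral_restrict_Int inf_absorb1)
  also have "\<dots> = integral (cbox a b) (\<lambda>y. frechet_derivative G (at y) e)"
    by (intro integral_cong fun_cong[OF frechet_derivative_cong_open[OF U(1)]]) (use U(2) FG in auto)
  finally show ?thesis using cd by simp
qed

section \<open>The divergence theorem on a closed hypersurface\<close>

text \<open>A cutoff of class C^1 is enough: the weights of the partition of unity are
  differentiated only once.\<close>

lemma Ck_on_1_square_max_0: "Ck_on 1 UNIV (\<lambda>s::real. (max 0 s)\<^sup>2)"
proof -
  have D: "((\<lambda>s. (max 0 s)\<^sup>2) has_real_derivative 2 * max 0 s) (at s)" for s :: real
  proof -
    consider "s > 0" | "s < 0" | "s = 0" by linarith
    then show ?thesis
    proof cases
      case 1
      have "((\<lambda>s. s\<^sup>2) has_real_derivative 2 * s) (at s)" by (auto intro!: derivative_eq_intros)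
      then have "((\<lambda>s. (max 0 s)\<^sup>2) has_real_derivative 2 * s) (at s)"
        by (rule has_field_derivative_transform_within_open[where S="{0<..}"]) (use 1 in auto)
      then show ?thesis using 1 by simp
    next
      case 2
      have "((\<lambda>s. 0) has_real_derivative 0) (at s)" by simp
      then have "((\<lambda>s. (max 0 s)\<^sup>2) has_real_derivative 0) (at s)"
        by (rule has_field_derivative_transform_within_open[where S="{..<0}"]) (use 2 in auto)
      then show ?thesis using 2 by simp
    next
      case 3
      have "((\<lambda>h. \<bar>h\<bar>) \<longlongrightarrow> 0) (at (0::real))"
        using tendsto_rabs[OF tendsto_ident_at[of "0::real" UNIV]] by simp
      then have "((\<lambda>h. (max 0 h)\<^sup>2 / h) \<longlongrightarrow> 0) (at (0::real))"
        by (rule Lim_null_comparison[rotated])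
          (auto simp: max_def power2_eq_square eventually_at_filter)
      then show ?thesis using 3 by (simp add: has_field_derivative_iff)
    qed
  qed
  have e: "frechet_derivative (\<lambda>s::real. (max 0 s)\<^sup>2) (at s) v = 2 * max 0 s * v" for s v
    using frechet_derivative_at[OF D[of s, unfolded has_field_derivative_def]] by metis
  have "(\<lambda>s::real. (max 0 s)\<^sup>2) differentiable at s" for s
    using D[of s] real_differentiable_def differentiable_def has_field_derivative_def by blast
  moreover have "continuous_on UNIV (\<lambda>s. 2 * max 0 s * v)" for v :: real
    by (intro continuous_intros)
  ultimately show ?thesis by (simp add: e)
qed

text \<open>A product over the coordinates instead of a radial function, so that the set where it is
  positive is a box, the natural domain of integration.\<close>

definition cube_bump :: "real^'n \<Rightarrow> real \<Rightarrow> real^'n \<Rightarrow> real" where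
  "cube_bump a e y = (\<Prod>i\<in>UNIV. (max 0 (e\<^sup>2 - (y $ i - a $ i)\<^sup>2))\<^sup>2)"

lemma Ck_on_nth: "Ck_on k S (\<lambda>y :: real^'n. y $ i)"
proof (cases k)
  case (Suc j)
  have d: "((\<lambda>y :: real^'n. y $ i) has_derivative (\<lambda>v. v $ i)) (at y)" for y
    by (rule bounded_linear_imp_has_derivative[OF bounded_linear_vec_nth])
  show ?thesis
    using d by (auto simp: Suc frechet_derivative_at[OF d, symmetric] differentiable_def)
qed (simp add: continuous_on_component)

lemma Ck_on_cube_bump: "Ck_on 1 UNIV (cube_bump a e)"
  unfolding cube_bump_def[abs_def]
proof (intro Ck_on_prod open_UNIV)
  fix i
  have "Ck_on 1 UNIV (\<lambda>y. e\<^sup>2 - (y $ i - a $ i)\<^sup>2)"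
    unfolding power2_eq_square
    by (intro Ck_on_diff Ck_on_mult Ck_on_const Ck_on_nth open_UNIV)
  then show "Ck_on 1 UNIV (\<lambda>y. (max 0 (e\<^sup>2 - (y $ i - a $ i)\<^sup>2))\<^sup>2)"
    by (intro Ck_on_compose[OF _ _ _ Ck_on_1_square_max_0]) auto
qed

lemma cube_bump_nonneg: "0 \<le> cube_bump a e y"
  by (simp add: cube_bump_def prod_nonneg)

lemma cube_bump_pos_iff:
  assumes "e > 0"
  shows "0 < cube_bump a e y \<longleftrightarrow> y \<in> box (a - vec e) (a + vec e)"
proof -
  have "0 < cube_bump a e y \<longleftrightarrow> cube_bump a e y \<noteq> 0" using cube_bump_nonneg[of a e y] by linarith
  also have "\<dots> \<longleftrightarrow> (\<forall>i. (y $ i - a $ i)\<^sup>2 < e\<^sup>2)"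
  proof -
    have "(max 0 t)\<^sup>2 \<noteq> 0 \<longleftrightarrow> 0 < t" for t :: real by (auto simp: max_def)
    then show ?thesis by (simp add: cube_bump_def)
  qed
  also have "\<dots> \<longleftrightarrow> (\<forall>i. \<bar>y $ i - a $ i\<bar> < e)"
  proof -
    have "t\<^sup>2 < e\<^sup>2 \<longleftrightarrow> \<bar>t\<bar> < e" for t
      using assms abs_le_square_iff[of e t] by (simp add: not_le[symmetric])
    then show ?thesis by simp
  qed
  also have "\<dots> \<longleftrightarrow> y \<in> box (a - vec e) (a + vec e)"
    by (simp add: mem_box_cart abs_diff_less_iff)
  finally show ?thesis .
qed

section \<open>Charts and transition maps of a closed hypersurface\<close>

locale closed_hypersurface =
  fixes M :: "'a::t2_space set" and \<A> :: "('a, 'n::finite) chart set"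
    and x N :: "'a \<Rightarrow> real ^ 'm::finite"
  assumes closed_M: "closed_manifold M \<A>" and immersion_x: "immersion \<A> x"
    and normal_N: "unit_normal_field \<A> x N" and card_m: "CARD('m) = CARD('n) + 1"
begin

lemma atlas: "smooth_atlas M \<A>" and compact_M: "compact M" and connected_M: "connected M"
  and M_ne: "M \<noteq> {}"
  using closed_M by (auto simp: closed_manifold_def)

lemma M_eq: "M = (\<Union>c\<in>\<A>. fst c)"
  by (rule atlas[unfolded smooth_atlas_def, THEN conjunct1])

lemma chart_properties:
  "c \<in> \<A> \<Longrightarrow> openin (top_of_set M) (fst c) \<and> open (snd c ` fst c) \<and>
    homeomorphism (fst c) (snd c ` fst c) (snd c) (param c)"
  by (rule atlas[unfolded smooth_atlas_def, THEN conjunct2, THEN conjunct1, THEN bspec])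

lemma ex_chart: "p \<in> M \<Longrightarrow> \<exists>c\<in>\<A>. p \<in> fst c"
  by (simp add: M_eq)

context
  fixes c assumes c: "c \<in> \<A>"
begin

lemma dom_subset: "fst c \<subseteq> M" using c by (auto simp: M_eq)

lemma dom_openin: "openin (top_of_set M) (fst c)" using chart_properties[OF c] by blast

lemma chart_homeomorphism: "homeomorphism (fst c) (snd c ` fst c) (snd c) (param c)"
  using chart_properties[OF c] by blast

lemma coord_continuous: "continuous_on (fst c) (snd c)"
  and param_continuous: "continuous_on (snd c ` fst c) (param c)"
  using chart_homeomorphism by (auto simp: homeomorphism_def)

lemma hypersurface_chart: "hypersurface_chart c x N"
proof
  show "open (snd c ` fst c)" using chart_properties[OF c] by blast
  show "inj_on (snd c) (fst c)"
    by (rule inj_on_inverseI) (rule homeomorphism_apply1[OF chart_homeomorphism])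
  show "Ck_chart c k x" "Ck_chart c k N" for k
    using immersion_x normal_N c
    by (auto simp: immersion_def unit_normal_field_def smooth_map_def smooth_on_def Ck_chart_def)
  show "inj (frechet_derivative (x \<circ> param c) (at (snd c p)))" if "p \<in> fst c" for p
    using immersion_x c that by (auto simp: immersion_def)
  show "norm (N p) = 1" "N p \<bullet> pd c i x p = 0" if "p \<in> fst c" for p i
    using normal_N c that by (auto simp: unit_normal_field_def)
qed (rule card_m)

lemma coord_chart: "coord_chart c"
  using hypersurface_chart by (rule hypersurface_chart.axioms)

lemma open_coord_image:
  assumes "openin (top_of_set M) V"
  shows "open (snd c ` (fst c \<inter> V))"
proof -
  obtain T where T: "open T" "V = M \<inter> T" using assms by (auto simp: openin_open)
  then have "fst c \<inter> V = fst c \<inter> T" using dom_subset by auto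
  then have "openin (top_of_set (fst c)) (fst c \<inter> V)" using T(1) by auto
  then have "openin (top_of_set (snd c ` fst c)) (snd c ` (fst c \<inter> V))"
    by (rule homeomorphism_imp_open_map[OF chart_homeomorphism])
  then show ?thesis
    using openin_open_eq[OF coord_chart.open_image[OF coord_chart]] by blast
qed

lemma openin_coord_preimage:
  assumes "open B"
  shows "openin (top_of_set M) {p \<in> fst c. snd c p \<in> B}"
proof -
  have "openin (top_of_set (fst c)) (fst c \<inter> snd c -` B)"
    by (rule continuous_openin_preimage_gen[OF coord_continuous assms])
  then have "openin (top_of_set M) (fst c \<inter> snd c -` B)" using dom_openin by (rule openin_trans)
  moreover have "fst c \<inter> snd c -` B = {p \<in> fst c. snd c p \<in> B}" by auto
  ultimately show ?thesis by simp
qed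

end

definition jac :: "('a, 'n) chart \<Rightarrow> ('a, 'n) chart \<Rightarrow> 'a \<Rightarrow> real^'n^'n" where
  "jac c d p = matrix (frechet_derivative (snd d \<circ> param c) (at (snd c p)))"

context
  fixes c d assumes c: "c \<in> \<A>" and d: "d \<in> \<A>"
begin

interpretation C: coord_chart c by (rule coord_chart[OF c])
interpretation D: coord_chart d by (rule coord_chart[OF d])

lemma overlap_open: "open (snd c ` (fst c \<inter> fst d))"
  by (rule open_coord_image[OF c dom_openin[OF d]])

lemma transition_Ck: "Ck_on k (snd c ` (fst c \<inter> fst d)) (snd d \<circ> param c)"
  using atlas[unfolded smooth_atlas_def, THEN conjunct2, THEN conjunct2] c d
  by (simp add: smooth_on_def)

lemma transition_derivative:
  assumes "p \<in> fst c \<inter> fst d"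
  shows "((\<lambda>y. snd d (param c y)) has_derivative (\<lambda>v. jac c d p *v v)) (at (snd c p))"
proof -
  have "(snd d \<circ> param c) differentiable (at (snd c p))"
    using transition_Ck[of 1] assms by auto
  then have D: "((snd d \<circ> param c) has_derivative frechet_derivative (snd d \<circ> param c) (at (snd c p))) (at (snd c p))"
    by (rule has_frechet_derivative)
  then show ?thesis
    unfolding jac_def matrix_vector_mul(2)[OF has_derivative_linear[OF D]]
    using D by (simp add: o_def)
qed

lemma pd_chain:
  assumes f: "Ck_chart d 1 f" and p: "p \<in> fst c \<inter> fst d"
  shows "pd c j f p = (\<Sum>i\<in>UNIV. jac c d p $ i $ j *\<^sub>R pd d i f p)"
proof -
  have "(f \<circ> param d) differentiable at (snd d p)" using f p by (auto simp: Ck_chart_def)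
  then have "((f \<circ> param d) has_derivative frechet_derivative (f \<circ> param d) (at (snd d p))) (at (snd d (param c (snd c p))))"
    using p by (simp add: has_frechet_derivative)
  from has_derivative_compose[OF transition_derivative[OF p] this]
  have 1: "((\<lambda>y. (f \<circ> param d) (snd d (param c y))) has_derivative
      (\<lambda>v. frechet_derivative (f \<circ> param d) (at (snd d p)) (jac c d p *v v))) (at (snd c p))" .
  have "((\<lambda>y. f (param c y)) has_derivative
      (\<lambda>v. frechet_derivative (f \<circ> param d) (at (snd d p)) (jac c d p *v v))) (at (snd c p))"
    by (rule has_derivative_transform_within_open[OF 1 overlap_open]) (use p in auto)
  then have "pd c j f p = frechet_derivative (f \<circ> param d) (at (snd d p)) (jac c d p *v axis j 1)"
    by (rule C.pd_eqI)
  also have "\<dots> = (\<Sum>i\<in>UNIV. jac c d p $ i $ j *\<^sub>R pd d i f p)"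
    using p by (simp add: D.frechet_derivative_eq_sum_pd[OF f] matrix_vector_mult_basis column_def)
  finally show ?thesis .
qed

lemma metric_change:
  assumes "p \<in> fst c \<inter> fst d"
  shows "metric c x p = Finite_Cartesian_Product.transpose (jac c d p) ** metric d x p ** jac c d p"
proof -
  interpret HD: hypersurface_chart d x N by (rule hypersurface_chart[OF d])
  have "metric c x p $ i $ j = (\<Sum>l\<in>UNIV. \<Sum>k\<in>UNIV. (jac c d p $ k $ i * metric d x p $ k $ l) * jac c d p $ l $ j)" for i j
    unfolding metric_def vec_lambda_beta pd_chain[OF HD.x_smooth assms] inner_sum_left inner_sum_right
    by (simp add: mult_ac)
  then show ?thesis
    by (simp add: vec_eq_iff matrix_matrix_mult_def transpose_def sum_distrib_right)
qed

lemma volume_change: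
  assumes "p \<in> fst c \<inter> fst d"
  shows "sqrt (det (metric c x p)) = \<bar>det (jac c d p)\<bar> * sqrt (det (metric d x p))"
proof -
  have "det (metric c x p) = (det (jac c d p))\<^sup>2 * det (metric d x p)"
    unfolding metric_change[OF assms] det_mul det_transpose by (simp add: power2_eq_square)
  then show ?thesis by (simp add: real_sqrt_mult)
qed

text \<open>The Jacobian factor of the change of variables is exactly the ratio of the two
  Riemannian densities, by \<open>volume_change\<close>.\<close>

lemma integral_chart_change:
  assumes C: "compact C" "C \<subseteq> fst c \<inter> fst d" and f: "continuous_on (snd d ` C) (f \<circ> param d)"
  shows "integral (snd d ` C) (\<lambda>y. f (param d y) * sqrt (det (metric d x (param d y))))
    = integral (snd c ` C) (\<lambda>y. f (param c y) * sqrt (det (metric c x (param c y))))"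
proof -
  interpret HD: hypersurface_chart d x N by (rule hypersurface_chart[OF d])
  define F where "F y = f (param d y) * sqrt (det (metric d x (param d y)))" for y
  define \<tau> where "\<tau> y = snd d (param c y)" for y
  have im: "\<tau> ` snd c ` C = snd d ` C"
    unfolding image_image \<tau>_def using C(2) by (intro image_cong) auto
  have inj: "inj_on \<tau> (snd c ` C)"
    using C(2) D.inj_coord by (auto simp: inj_on_def \<tau>_def subset_iff)
  have com: "compact (snd c ` C)"
    using C continuous_on_subset[OF coord_continuous[OF c]] by (intro compact_continuous_image) auto
  have der: "(\<tau> has_derivative (\<lambda>v. jac c d (param c y) *v v)) (at y within snd c ` C)"
    if "y \<in> snd c ` C" for y
  proof -
    obtain p where "p \<in> C" "y = snd c p" using \<open>y \<in> snd c ` C\<close> by blast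
    moreover from this have "p \<in> fst c" "p \<in> fst d" using C(2) by auto
    ultimately have "param c y \<in> fst c \<inter> fst d" "snd c (param c y) = y" by simp_all
    then show ?thesis
      using transition_derivative[of "param c y"] unfolding \<tau>_def[abs_def]
      by (metis has_derivative_at_withinI)
  qed
  have "continuous_on (snd d ` fst d) (\<lambda>y. sqrt (det (metric d x (param d y))))"
    using Ck_on_imp_continuous_on HD.W_smooth[of 0] by (simp add: Ck_chart_def o_def)
  then have "continuous_on (snd d ` C) (\<lambda>y. sqrt (det (metric d x (param d y))))"
    by (rule continuous_on_subset) (use C(2) in auto)
  then have cont: "continuous_on (\<tau> ` snd c ` C) F"
    unfolding im F_def using f by (intro continuous_on_mult) (simp_all add: o_def)
  have "integral (snd d ` C) F = integral (snd c ` C) (\<lambda>y. \<bar>det (matrix (\<lambda>v. jac c d (param c y) *v v))\<bar> * F (\<tau> y))"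
    using integral_change_of_variables_compact[OF com der inj cont] unfolding im .
  also have "\<dots> = integral (snd c ` C) (\<lambda>y. f (param c y) * sqrt (det (metric c x (param c y))))"
  proof (rule integral_cong)
    fix y assume "y \<in> snd c ` C"
    then obtain q where "q \<in> C" "y = snd c q" by blast
    moreover from this have "q \<in> fst c" "q \<in> fst d" using C(2) by auto
    ultimately have p: "param c y \<in> fst c \<inter> fst d" by simp
    show "\<bar>det (matrix (\<lambda>v. jac c d (param c y) *v v))\<bar> * F (\<tau> y)
      = f (param c y) * sqrt (det (metric c x (param c y)))"
      using p by (simp add: matrix_of_matrix_vector_mul F_def \<tau>_def volume_change[OF p] mult_ac)
  qed
  finally show ?thesis by (simp add: F_def[abs_def])
qed

end

text \<open>The box inside one chart allows the bump to be integrated there, while containment of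
  the support in \<open>B\<close> serves \<open>embedding_over_x\<close>, where x is injective on
  \<open>B\<close>. Regularity is claimed in every chart of the atlas.\<close>

lemma bump_function:
  assumes B: "openin (top_of_set M) B" "p \<in> B"
  shows "\<exists>c a b (\<psi> :: 'a \<Rightarrow> real) V. c \<in> \<A> \<and> cbox a b \<subseteq> snd c ` (fst c \<inter> B) \<and> box a b \<noteq> {} \<and>
      (\<forall>q. 0 \<le> \<psi> q) \<and> (\<forall>q. q \<notin> param c ` cbox a b \<longrightarrow> \<psi> q = 0) \<and> (\<forall>d\<in>\<A>. Ck_chart d 1 \<psi>) \<and>
      openin (top_of_set M) V \<and> p \<in> V \<and> (\<forall>q\<in>V. 0 < \<psi> q)"
proof -
  have "p \<in> M" using B openin_subset[OF B(1)] by auto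
  then obtain c where c: "c \<in> \<A>" "p \<in> fst c" using ex_chart by blast
  interpret C: coord_chart c by (rule coord_chart[OF c(1)])
  define y where "y = snd c p"
  have "y \<in> snd c ` (fst c \<inter> B)" using c B(2) by (simp add: y_def)
  then obtain r where r: "r > 0" "cball y r \<subseteq> snd c ` (fst c \<inter> B)"
    using open_coord_image[OF c(1) B(1)] open_contains_cball by blast
  \<comment> \<open>The bound of the Euclidean norm by the sum of the coordinates then puts the cube
    of half-width e into the ball of radius r, because n e \<le> r.\<close>
  define e where "e = r / (CARD('n) + 1)"
  have e: "e > 0" using r by (simp add: e_def)
  define a b where "a = y - vec e" and "b = y + vec e"
  have "cbox a b \<subseteq> cball y r"
  proof
    fix z assume z: "z \<in> cbox a b"
    have "norm (z - y) \<le> (\<Sum>i\<in>UNIV. \<bar>(z - y) $ i\<bar>)" by (rule norm_le_l1_cart)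
    also have "\<dots> \<le> (\<Sum>i\<in>(UNIV::'n set). e)"
    proof (rule sum_mono)
      fix i
      have "y $ i - e \<le> z $ i" "z $ i \<le> y $ i + e" using z by (auto simp: mem_box_cart a_def b_def)
      then show "\<bar>(z - y) $ i\<bar> \<le> e" by (simp add: abs_le_iff)
    qed
    also have "\<dots> \<le> r" using r by (simp add: e_def field_simps)
    finally show "z \<in> cball y r" by (simp add: dist_norm norm_minus_commute)
  qed
  then have abB: "cbox a b \<subseteq> snd c ` (fst c \<inter> B)" using r by blast
  then have ab: "cbox a b \<subseteq> snd c ` fst c" by blast
  have yb: "y \<in> box a b" using e by (auto simp: mem_box_cart a_def b_def)
  define \<psi> where "\<psi> q = (if q \<in> fst c then cube_bump y e (snd c q) else 0)" for q
  have pos: "0 < \<psi> q \<longleftrightarrow> q \<in> fst c \<and> snd c q \<in> box a b" for q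
    using cube_bump_pos_iff[OF e, of y "snd c q"] by (simp add: \<psi>_def a_def b_def)
  have nn: "0 \<le> \<psi> q" for q by (simp add: \<psi>_def cube_bump_nonneg)
  define K where "K = param c ` cbox a b"
  have K0: "\<psi> q = 0" if "q \<notin> K" for q
  proof (rule ccontr)
    assume "\<psi> q \<noteq> 0"
    then have "q \<in> fst c" "snd c q \<in> box a b" using pos[of q] nn[of q] by auto
    then have "q = param c (snd c q)" "snd c q \<in> cbox a b" using box_subset_cbox by auto
    then show False using that unfolding K_def by blast
  qed
  have "compact K"
    unfolding K_def using continuous_on_subset[OF param_continuous[OF c(1)] ab] by (intro compact_continuous_image) auto
  then have clK: "closed K" by (rule compact_imp_closed)
  have CK: "Ck_chart d 1 \<psi>" if d: "d \<in> \<A>" for d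
    unfolding Ck_chart_def
  proof (rule Ck_on_local)
    interpret D: coord_chart d by (rule coord_chart[OF d])
    fix z assume z: "z \<in> snd d ` fst d"
    show "\<exists>T. open T \<and> z \<in> T \<and> Ck_on 1 T (\<psi> \<circ> param d)"
    proof (cases "param d z \<in> fst c")
      case True
      have "Ck_on 1 (snd d ` (fst d \<inter> fst c)) (\<lambda>y'. cube_bump y e ((snd c \<circ> param d) y'))"
        by (rule Ck_on_compose[OF overlap_open[OF d c(1)] open_UNIV transition_Ck[OF d c(1)] Ck_on_cube_bump]) simp
      then have "Ck_on 1 (snd d ` (fst d \<inter> fst c)) (\<psi> \<circ> param d)"
        by (rule Ck_on_cong[OF overlap_open[OF d c(1)], rotated]) (auto simp: \<psi>_def)
      moreover have "z \<in> snd d ` (fst d \<inter> fst c)"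
        using True z by (intro image_eqI[of _ _ "param d z"]) auto
      ultimately show ?thesis using overlap_open[OF d c(1)] by blast
    next
      \<comment> \<open>The set K is compact, hence closed in a Hausdorff space, so a point outside
        the domain of c has a neighbourhood on which the bump vanishes.\<close>
      case False
      have "K \<subseteq> fst c" using ab unfolding K_def by auto
      then have zK: "param d z \<notin> K" using False by auto
      define T where "T = snd d ` (fst d \<inter> (M \<inter> - K))"
      have T: "open T"
        unfolding T_def using clK by (intro open_coord_image[OF d]) (auto simp: open_Compl)
      have "z \<in> T"
        unfolding T_def using z zK dom_subset[OF d] by (intro image_eqI[of _ _ "param d z"]) auto
      moreover have "Ck_on 1 T (\<psi> \<circ> param d)"
        by (rule Ck_on_cong[OF T _ Ck_on_const[of 1 T 0]]) (auto simp: T_def K0)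
      ultimately show ?thesis using T by blast
    qed
  qed
  define V where "V = {q \<in> fst c. snd c q \<in> box a b}"
  have "openin (top_of_set M) V" unfolding V_def by (rule openin_coord_preimage[OF c(1) open_box])
  moreover have "p \<in> V" using c yb by (simp add: V_def y_def)
  moreover have "\<forall>q\<in>V. 0 < \<psi> q" using pos by (simp add: V_def)
  moreover have "box a b \<noteq> {}" using yb by auto
  moreover have "\<forall>q. q \<notin> param c ` cbox a b \<longrightarrow> \<psi> q = 0" using K0 by (simp add: K_def)
  moreover have "\<forall>q. 0 \<le> \<psi> q" "\<forall>d\<in>\<A>. Ck_chart d 1 \<psi>" using nn CK by auto
  ultimately show ?thesis using c(1) abB
    by (intro exI[of _ c] exI[of _ a] exI[of _ b] exI[of _ \<psi>] exI[of _ V] conjI)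
qed


text \<open>The local boundary terms cancel because the weights of a partition of unity sum to 1.\<close>

theorem divergence_nonneg_eq_0:
  fixes v :: "('a, 'n) chart \<Rightarrow> 'a \<Rightarrow> real^'n" and \<delta> :: "'a \<Rightarrow> real"
  assumes v: "\<And>c i. c \<in> \<A> \<Longrightarrow> Ck_chart c 1 (\<lambda>p. v c p $ i)"
    and compat: "\<And>c d p. \<lbrakk>c \<in> \<A>; d \<in> \<A>; p \<in> fst c \<inter> fst d\<rbrakk> \<Longrightarrow> v d p = jac c d p *v v c p"
    and div: "\<And>c p. \<lbrakk>c \<in> \<A>; p \<in> fst c\<rbrakk> \<Longrightarrow>
      (\<Sum>i\<in>UNIV. pd c i (\<lambda>q. sqrt (det (metric c x q)) * v c q $ i) p) = sqrt (det (metric c x p)) * \<delta> p"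
    and nonneg: "\<And>p. p \<in> M \<Longrightarrow> 0 \<le> \<delta> p" and p0: "p0 \<in> M"
  shows "\<delta> p0 = 0"
proof -
  define w :: "('a, 'n) chart \<Rightarrow> 'a \<Rightarrow> real" where "w c p = sqrt (det (metric c x p))" for c p
  have HC: "hypersurface_chart c x N" if "c \<in> \<A>" for c by (rule hypersurface_chart[OF that])
  have CC: "coord_chart c" if "c \<in> \<A>" for c by (rule coord_chart[OF that])
  have w_smooth: "Ck_chart c k (w c)" if "c \<in> \<A>" for c k
    using hypersurface_chart.W_smooth[OF HC[OF that]] by (simp add: w_def[abs_def])
  have w_pos: "0 < w c p" if "c \<in> \<A>" "p \<in> fst c" for c p
    using hypersurface_chart.W_pos[OF HC[OF that(1)] that(2)] by (simp add: w_def)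
  have "\<forall>p\<in>M. \<exists>c a b (\<psi> :: 'a \<Rightarrow> real) V. c \<in> \<A> \<and> cbox a b \<subseteq> snd c ` fst c \<and> box a b \<noteq> {} \<and>
      (\<forall>q. 0 \<le> \<psi> q) \<and> (\<forall>q. q \<notin> param c ` cbox a b \<longrightarrow> \<psi> q = 0) \<and> (\<forall>d\<in>\<A>. Ck_chart d 1 \<psi>) \<and>
      openin (top_of_set M) V \<and> p \<in> V \<and> (\<forall>q\<in>V. 0 < \<psi> q)"
  proof
    fix p assume p: "p \<in> M"
    have "openin (top_of_set M) M" by (rule openin_subtopology_self)
    from bump_function[OF this p] show "\<exists>c a b (\<psi> :: 'a \<Rightarrow> real) V. c \<in> \<A> \<and> cbox a b \<subseteq> snd c ` fst c \<and> box a b \<noteq> {} \<and>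
      (\<forall>q. 0 \<le> \<psi> q) \<and> (\<forall>q. q \<notin> param c ` cbox a b \<longrightarrow> \<psi> q = 0) \<and> (\<forall>d\<in>\<A>. Ck_chart d 1 \<psi>) \<and>
      openin (top_of_set M) V \<and> p \<in> V \<and> (\<forall>q\<in>V. 0 < \<psi> q)"
      by (elim ex_forward conj_forward) auto
  qed
  then obtain ch a b and \<psi> :: "'a \<Rightarrow> 'a \<Rightarrow> real" and V where bump:
    "\<forall>p\<in>M. ch p \<in> \<A> \<and> cbox (a p) (b p) \<subseteq> snd (ch p) ` fst (ch p) \<and> box (a p) (b p) \<noteq> {} \<and>
      (\<forall>q. 0 \<le> \<psi> p q) \<and> (\<forall>q. q \<notin> param (ch p) ` cbox (a p) (b p) \<longrightarrow> \<psi> p q = 0) \<and>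
      (\<forall>d\<in>\<A>. Ck_chart d 1 (\<psi> p)) \<and>
      openin (top_of_set M) (V p) \<and> p \<in> V p \<and> (\<forall>q\<in>V p. 0 < \<psi> p q)"
    unfolding bchoice_iff by blast
  have "\<exists>D\<subseteq>V ` M. finite D \<and> M \<subseteq> \<Union>D"
    by (rule compact_eq_openin_cover[THEN iffD1, OF compact_M, rule_format]) (use bump in auto)
  then obtain I where I: "I \<subseteq> M" "finite I" "M \<subseteq> \<Union> (V ` I)"
    by (metis finite_subset_image)
  have ch: "ch k \<in> \<A>" and cb: "cbox (a k) (b k) \<subseteq> snd (ch k) ` fst (ch k)" and bne: "box (a k) (b k) \<noteq> {}"
    and \<psi>0: "\<And>q. 0 \<le> \<psi> k q" and \<psi>_supp: "\<And>q. q \<notin> param (ch k) ` cbox (a k) (b k) \<Longrightarrow> \<psi> k q = 0"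
    and \<psi>C: "\<And>d. d \<in> \<A> \<Longrightarrow> Ck_chart d 1 (\<psi> k)" if "k \<in> I" for k
    using bump I(1) that by auto
  define \<Psi> where "\<Psi> q = (\<Sum>k\<in>I. \<psi> k q)" for q
  have \<Psi>_pos: "0 < \<Psi> q" if qM: "q \<in> M" for q
  proof -
    obtain k where k: "k \<in> I" "q \<in> V k" using I(3) qM by blast
    then have "0 < \<psi> k q" using bump I(1) by blast
    then show ?thesis unfolding \<Psi>_def using I(2) k(1) \<psi>0 by (intro sum_pos2[of _ k]) auto
  qed
  define \<phi> where "\<phi> k q = \<psi> k q * inverse (\<Psi> q)" for k q
  have \<Psi>C: "Ck_chart d 1 \<Psi>" if "d \<in> \<A>" for d
    unfolding \<Psi>_def[abs_def] using \<psi>C that by (intro coord_chart.Ck_chart_sum[OF CC[OF that]]) auto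
  have \<phi>C: "Ck_chart d 1 (\<phi> k)" if "d \<in> \<A>" "k \<in> I" for d k
    unfolding \<phi>_def[abs_def]
    using \<psi>C[OF that(2,1)] \<Psi>C[OF that(1)] \<Psi>_pos dom_subset[OF that(1)]
    by (intro coord_chart.Ck_chart_mult[OF CC[OF that(1)]] coord_chart.Ck_chart_inverse[OF CC[OF that(1)]])
      (auto simp: less_imp_neq[THEN not_sym])
  have \<phi>0: "0 \<le> \<phi> k q" if "k \<in> I" "q \<in> M" for k q
    using \<psi>0[OF that(1)] \<Psi>_pos[OF that(2)] by (simp add: \<phi>_def)
  have \<phi>_supp: "\<phi> k q = 0" if "k \<in> I" "q \<notin> param (ch k) ` cbox (a k) (b k)" for k q
    using \<psi>_supp[OF that] by (simp add: \<phi>_def)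
  have \<phi>1: "(\<Sum>k\<in>I. \<phi> k q) = 1" if "q \<in> M" for q
    using \<Psi>_pos[OF that] unfolding \<phi>_def sum_distrib_right[symmetric] \<Psi>_def[symmetric] by simp
  \<comment> \<open>The derivative of the k-th weight along the field v. The chosen chart is
    immaterial because differentials and fields transform inversely to each other;
    \<open>D_eq\<close> records this.\<close>
  define D where "D k p = (\<Sum>i\<in>UNIV. pd (SOME c. c \<in> \<A> \<and> p \<in> fst c) i (\<phi> k) p * v (SOME c. c \<in> \<A> \<and> p \<in> fst c) p $ i)" for k p
  have D_eq: "D k p = (\<Sum>i\<in>UNIV. pd d i (\<phi> k) p * v d p $ i)" if k: "k \<in> I" and d: "d \<in> \<A>" "p \<in> fst d" for k p d
  proof -
    define c where "c = (SOME c. c \<in> \<A> \<and> p \<in> fst c)"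
    have "c \<in> \<A> \<and> p \<in> fst c" unfolding c_def by (rule someI[of _ d]) (use d in simp)
    then have c: "c \<in> \<A>" "p \<in> fst c" by auto
    have "D k p = (\<Sum>i\<in>UNIV. \<Sum>j\<in>UNIV. jac c d p $ j $ i * pd d j (\<phi> k) p * v c p $ i)"
      unfolding D_def c_def[symmetric] using c d
      by (subst pd_chain[OF c(1) d(1) \<phi>C[OF d(1) k]]) (auto simp: sum_distrib_right)
    also have "\<dots> = (\<Sum>j\<in>UNIV. pd d j (\<phi> k) p * (\<Sum>i\<in>UNIV. jac c d p $ j $ i * v c p $ i))"
      by (subst sum.swap) (simp add: sum_distrib_left mult_ac)
    also have "\<dots> = (\<Sum>i\<in>UNIV. pd d i (\<phi> k) p * v d p $ i)"
      using compat[OF c(1) d(1), of p] c d by (simp add: matrix_vector_mult_def)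
    finally show ?thesis .
  qed
  define K where "K k = param (ch k) ` cbox (a k) (b k)" for k
  have K_dom: "K k \<subseteq> fst (ch k)" if "k \<in> I" for k
    using cb[OF that] coord_chart.param_in[OF CC[OF ch[OF that]]] unfolding K_def by blast
  have snd_K: "snd (ch k) ` K k = cbox (a k) (b k)" if "k \<in> I" for k
  proof -
    have "snd (ch k) (param (ch k) y) = y" if "y \<in> cbox (a k) (b k)" for y
      using coord_chart.coord_param[OF CC[OF ch[OF \<open>k \<in> I\<close>]]] cb[OF \<open>k \<in> I\<close>] that by blast
    then show ?thesis by (simp add: K_def image_image)
  qed
  have compact_K: "compact (K k)" if "k \<in> I" for k
    unfolding K_def using continuous_on_subset[OF param_continuous[OF ch[OF that]] cb[OF that]]
    by (intro compact_continuous_image) auto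
  have closed_K: "closed (K k)" if "k \<in> I" for k using compact_K[OF that] by (rule compact_imp_closed)
  have D_supp: "D k p = 0" if k: "k \<in> I" and p: "p \<in> M" "p \<notin> K k" for k p
  proof -
    obtain d where d: "d \<in> \<A>" "p \<in> fst d" using ex_chart[OF p(1)] by blast
    have op: "open (snd d ` (fst d \<inter> (M \<inter> - K k)))"
      using closed_K[OF k] by (intro open_coord_image[OF d(1)]) (auto simp: open_Compl)
    have "pd d i (\<phi> k) p = frechet_derivative (\<lambda>_. 0) (at (snd d p)) (axis i 1)" for i
      unfolding pd_def
      by (rule fun_cong[OF frechet_derivative_cong_open[OF op]])
        (use p d dom_subset[OF d(1)] coord_chart.param_coord[OF CC[OF d(1)]] \<phi>_supp[OF k] in \<open>auto simp: K_def\<close>)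
    then show ?thesis by (simp add: D_eq[OF k d])
  qed
  have D_cont: "Ck_chart d 0 (D k)" if k: "k \<in> I" and d: "d \<in> \<A>" for k d
  proof (rule coord_chart.Ck_chart_cong[OF CC[OF d]])
    show "Ck_chart d 0 (\<lambda>p. \<Sum>i\<in>UNIV. pd d i (\<phi> k) p * v d p $ i)"
      using \<phi>C[OF d k] Ck_chart_mono[OF v[OF d], of 0]
      by (intro coord_chart.Ck_chart_sum[OF CC[OF d]] coord_chart.Ck_chart_mult[OF CC[OF d]]
          coord_chart.Ck_chart_pd[OF CC[OF d]]) auto
  qed (use D_eq[OF k d] in simp)
  have \<delta>_cont: "Ck_chart d 0 \<delta>" if d: "d \<in> \<A>" for d
  proof (rule coord_chart.Ck_chart_cong[OF CC[OF d]])
    have "Ck_chart d (Suc 0) (\<lambda>q. w d q * v d q $ i)" for i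
      using w_smooth[OF d, of 1] v[OF d, of i] coord_chart.Ck_chart_mult[OF CC[OF d]] by simp
    then show "Ck_chart d 0 (\<lambda>p. (\<Sum>i\<in>UNIV. pd d i (\<lambda>q. w d q * v d q $ i) p) * inverse (w d p))"
      using w_smooth[OF d] w_pos[OF d] v[OF d]
      by (intro coord_chart.Ck_chart_mult[OF CC[OF d]] coord_chart.Ck_chart_sum[OF CC[OF d]]
          coord_chart.Ck_chart_inverse[OF CC[OF d]] coord_chart.Ck_chart_pd[OF CC[OF d]]) 
        (auto simp: less_imp_neq[THEN not_sym])
    show "(\<Sum>i\<in>UNIV. pd d i (\<lambda>q. w d q * v d q $ i) p) * inverse (w d p) = \<delta> p" if "p \<in> fst d" for p
      using div[OF d that] w_pos[OF d that] by (simp add: w_def)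
  qed
  have \<phi>_cont: "Ck_chart d 0 (\<phi> k)" if "d \<in> \<A>" "k \<in> I" for d k
    using Ck_chart_mono[OF \<phi>C[OF that]] by simp
  \<comment> \<open>The integral of f over the k-th support with respect to the Riemannian volume,
    computed in the k-th chart.\<close>
  define J where "J k f = integral (cbox (a k) (b k)) (\<lambda>y. f (param (ch k) y) * w (ch k) (param (ch k) y))" for k f
  have cont: "continuous_on (cbox (a k) (b k)) (\<lambda>y. f (param (ch k) y) * w (ch k) (param (ch k) y))"
    if k: "k \<in> I" and f: "Ck_chart (ch k) 0 f" for k f
    using f w_smooth[OF ch[OF k], of 0] continuous_on_subset[OF _ cb[OF k]]
    by (intro continuous_on_mult) (auto simp: Ck_chart_def o_def)
  have integrable: "(\<lambda>y. f (param (ch k) y) * w (ch k) (param (ch k) y)) integrable_on cbox (a k) (b k)"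
    if k: "k \<in> I" and f: "Ck_chart (ch k) 0 f" for k f
    by (rule integrable_continuous[OF cont[OF that]])
  have J_add: "J k (\<lambda>p. f p + h p) = J k f + J k h"
    if "k \<in> I" "Ck_chart (ch k) 0 f" "Ck_chart (ch k) 0 h" for k f h
    unfolding J_def distrib_right by (rule Henstock_Kurzweil_Integration.integral_add) (use that integrable in auto)
  have J_sum: "J k (\<lambda>p. \<Sum>l\<in>I. f l p) = (\<Sum>l\<in>I. J k (f l))"
    if "k \<in> I" "\<And>l. l \<in> I \<Longrightarrow> Ck_chart (ch k) 0 (f l)" for k f
    unfolding J_def sum_distrib_right
    by (rule Henstock_Kurzweil_Integration.integral_sum) (use that integrable I(2) in auto)
  have J_cong: "J k f = J k h" if "k \<in> I" "\<And>p. p \<in> M \<Longrightarrow> f p = h p" for k f h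
    unfolding J_def
  proof (rule Henstock_Kurzweil_Integration.integral_cong)
    fix y assume "y \<in> cbox (a k) (b k)"
    then have "param (ch k) y \<in> M" using K_dom[OF that(1)] dom_subset[OF ch[OF that(1)]] by (auto simp: K_def)
    then show "f (param (ch k) y) * w (ch k) (param (ch k) y) = h (param (ch k) y) * w (ch k) (param (ch k) y)"
      using that(2) by simp
  qed
  have J_restrict: "J k f = integral (snd (ch k) ` (K k \<inter> K l)) (\<lambda>y. f (param (ch k) y) * w (ch k) (param (ch k) y))"
    if k: "k \<in> I" and f: "\<And>p. p \<in> K k - K l \<Longrightarrow> f p = 0" for k l f
  proof -
    have C: "coord_chart (ch k)" by (rule CC[OF ch[OF k]])
    have sub: "snd (ch k) ` (K k \<inter> K l) \<subseteq> cbox (a k) (b k)" using snd_K[OF k] by blast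
    have "J k f = integral (cbox (a k) (b k))
      (\<lambda>y. if y \<in> snd (ch k) ` (K k \<inter> K l) then f (param (ch k) y) * w (ch k) (param (ch k) y) else 0)"
      unfolding J_def
    proof (rule Henstock_Kurzweil_Integration.integral_cong)
      fix y assume y: "y \<in> cbox (a k) (b k)"
      then have yK: "param (ch k) y \<in> K k" by (simp add: K_def)
      have e: "snd (ch k) (param (ch k) y) = y"
        by (rule coord_chart.coord_param[OF C subsetD[OF cb[OF k] y]])
      have "param (ch k) y \<notin> K l" if n: "y \<notin> snd (ch k) ` (K k \<inter> K l)"
      proof
        assume "param (ch k) y \<in> K l"
        then have "snd (ch k) (param (ch k) y) \<in> snd (ch k) ` (K k \<inter> K l)" using yK by (intro imageI IntI)
        then show False using n e by simp
      qed
      then show "f (param (ch k) y) * w (ch k) (param (ch k) y)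
        = (if y \<in> snd (ch k) ` (K k \<inter> K l) then f (param (ch k) y) * w (ch k) (param (ch k) y) else 0)"
        using f[of "param (ch k) y"] yK by auto
    qed
    then show ?thesis
      unfolding Henstock_Kurzweil_Integration.integral_restrict_Int using sub by (simp add: inf_absorb1)
  qed
  \<comment> \<open>An integrand living on the intersection of two supports may be integrated in
    either chart; both integrals are first restricted to that intersection.\<close>
  have J_change: "J k f = J l f"
    if k: "k \<in> I" and l: "l \<in> I" and f: "\<And>p. p \<in> M \<Longrightarrow> p \<notin> K k \<inter> K l \<Longrightarrow> f p = 0"
      and fl: "Ck_chart (ch l) 0 f" for k l f
  proof -
    have KM: "K k \<subseteq> M" "K l \<subseteq> M" using K_dom[OF k] K_dom[OF l] dom_subset[OF ch[OF k]] dom_subset[OF ch[OF l]] by auto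
    have sub: "K k \<inter> K l \<subseteq> fst (ch k) \<inter> fst (ch l)" using K_dom[OF k] K_dom[OF l] by auto
    have "continuous_on (snd (ch l) ` (K k \<inter> K l)) (f \<circ> param (ch l))"
      using fl sub unfolding Ck_chart_def by (auto elim!: continuous_on_subset)
    from integral_chart_change[OF ch[OF k] ch[OF l] compact_Int[OF compact_K[OF k] compact_K[OF l]] sub this]
    have eq: "integral (snd (ch l) ` (K l \<inter> K k)) (\<lambda>y. f (param (ch l) y) * w (ch l) (param (ch l) y))
      = integral (snd (ch k) ` (K k \<inter> K l)) (\<lambda>y. f (param (ch k) y) * w (ch k) (param (ch k) y))"
      by (simp add: w_def Int_commute)
    have "J k f = integral (snd (ch k) ` (K k \<inter> K l)) (\<lambda>y. f (param (ch k) y) * w (ch k) (param (ch k) y))"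
      by (rule J_restrict[OF k]) (rule f, use KM in auto)
    also note eq[symmetric]
    also have "integral (snd (ch l) ` (K l \<inter> K k)) (\<lambda>y. f (param (ch l) y) * w (ch l) (param (ch l) y)) = J l f"
      by (rule J_restrict[OF l, symmetric]) (rule f, use KM in auto)
    finally show ?thesis .
  qed
  \<comment> \<open>The integrand is the divergence of the field multiplied by the k-th weight,
    which is compactly supported in the chart, so every coordinate derivative integrates to
    0.\<close>
  have step1: "J k (\<lambda>p. \<phi> k p * \<delta> p + D k p) = 0" if k: "k \<in> I" for k
  proof -
    define c where "c = ch k"
    have c: "c \<in> \<A>" unfolding c_def by (rule ch[OF k])
    interpret C: coord_chart c by (rule CC[OF c])
    define F where "F i p = \<phi> k p * (w c p * v c p $ i)" for i p
    have wv: "Ck_chart c 1 (\<lambda>p. w c p * v c p $ i)" for i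
      by (intro C.Ck_chart_mult w_smooth[OF c] v[OF c])
    have FC: "Ck_chart c 1 (F i)" for i
      unfolding F_def[abs_def] by (intro C.Ck_chart_mult \<phi>C[OF c k] wv)
    have "integral (cbox (a k) (b k)) (\<lambda>y. frechet_derivative (F i \<circ> param c) (at y) (axis i 1)) = 0" for i
    proof (rule integral_derivative_compact_support[OF C.open_image])
      show "cbox (a k) (b k) \<subseteq> snd c ` fst c" using cb[OF k] by (simp add: c_def)
      show "Ck_on 1 (snd c ` fst c) (F i \<circ> param c)" using FC by (simp add: Ck_chart_def)
      fix y assume y: "y \<in> snd c ` fst c - cbox (a k) (b k)"
      have "param c y \<notin> K k"
      proof
        assume "param c y \<in> K k"
        then have "snd c (param c y) \<in> cbox (a k) (b k)" using snd_K[OF k] by (auto simp: c_def)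
        then show False using y by simp
      qed
      then show "(F i \<circ> param c) y = 0" using \<phi>_supp[OF k] by (simp add: F_def K_def)
    qed
    moreover have Fint: "(\<lambda>y. frechet_derivative (F i \<circ> param c) (at y) (axis i 1)) integrable_on cbox (a k) (b k)" for i
    proof (rule integrable_continuous)
      have "Ck_on 0 (snd c ` fst c) (\<lambda>y. frechet_derivative (F i \<circ> param c) (at y) (axis i 1))"
        using FC[of i] by (simp add: Ck_chart_def)
      then show "continuous_on (cbox (a k) (b k)) (\<lambda>y. frechet_derivative (F i \<circ> param c) (at y) (axis i 1))"
        using cb[OF k] by (auto simp: c_def intro: continuous_on_subset)
    qed
    ultimately have "integral (cbox (a k) (b k)) (\<lambda>y. \<Sum>i\<in>UNIV. frechet_derivative (F i \<circ> param c) (at y) (axis i 1)) = 0"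
      by (subst Henstock_Kurzweil_Integration.integral_sum) auto
    moreover have "(\<Sum>i\<in>UNIV. frechet_derivative (F i \<circ> param c) (at y) (axis i 1))
        = (\<phi> k (param c y) * \<delta> (param c y) + D k (param c y)) * w c (param c y)"
      if "y \<in> cbox (a k) (b k)" for y
    proof -
      define p where "p = param c y"
      have y: "y \<in> snd c ` fst c" using cb[OF k] that by (auto simp: c_def)
      then have p: "p \<in> fst c" "snd c p = y" by (simp_all add: p_def)
      have "(\<Sum>i\<in>UNIV. frechet_derivative (F i \<circ> param c) (at y) (axis i 1)) = (\<Sum>i\<in>UNIV. pd c i (F i) p)"
        by (simp add: pd_def p(2))
      also have "\<dots> = (\<Sum>i\<in>UNIV. pd c i (\<phi> k) p * (w c p * v c p $ i)
          + \<phi> k p * pd c i (\<lambda>p. w c p * v c p $ i) p)"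
        unfolding F_def by (intro sum.cong refl C.pd_mult p(1) \<phi>C[OF c k] wv)
      also have "\<dots> = D k p * w c p + \<phi> k p * (\<Sum>i\<in>UNIV. pd c i (\<lambda>p. w c p * v c p $ i) p)"
        by (simp add: sum.distrib D_eq[OF k c p(1)] sum_distrib_left sum_distrib_right mult_ac)
      also have "(\<Sum>i\<in>UNIV. pd c i (\<lambda>p. w c p * v c p $ i) p) = w c p * \<delta> p"
        using div[OF c p(1)] by (simp add: w_def[abs_def])
      finally show ?thesis by (simp add: p_def o_def algebra_simps)
    qed
    ultimately show ?thesis
      unfolding J_def c_def[symmetric]
      by (subst Henstock_Kurzweil_Integration.integral_cong[of _ _ "\<lambda>y. \<Sum>i\<in>UNIV. frechet_derivative (F i \<circ> param c) (at y) (axis i 1)"]) auto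
  qed
  have mult_cont: "Ck_chart c 0 (\<lambda>p. \<phi> l p * f p)" if "c \<in> \<A>" "l \<in> I" "Ck_chart c 0 f" for c l f
    by (intro coord_chart.Ck_chart_mult[OF CC[OF that(1)]] \<phi>_cont that)
  \<comment> \<open>Insert 1 as the sum of the weights and move the l-th piece to the chart of l.
    The derivatives of all weights then stand under the same integral, where their sum vanishes by
    \<open>D_sum\<close>.\<close>
  have step2: "J k (D k) = (\<Sum>l\<in>I. J l (\<lambda>p. \<phi> l p * D k p))" if k: "k \<in> I" for k
  proof -
    have "J k (D k) = J k (\<lambda>p. \<Sum>l\<in>I. \<phi> l p * D k p)"
      by (rule J_cong[OF k]) (simp add: sum_distrib_right[symmetric] \<phi>1)
    also have "\<dots> = (\<Sum>l\<in>I. J k (\<lambda>p. \<phi> l p * D k p))"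
      by (rule J_sum[OF k]) (intro mult_cont ch k D_cont)
    also have "\<dots> = (\<Sum>l\<in>I. J l (\<lambda>p. \<phi> l p * D k p))"
    proof (rule sum.cong[OF refl])
      fix l assume l: "l \<in> I"
      show "J k (\<lambda>p. \<phi> l p * D k p) = J l (\<lambda>p. \<phi> l p * D k p)"
        by (rule J_change[OF k l])
          (use D_supp[OF k] \<phi>_supp[OF l] in \<open>auto simp: K_def[symmetric] intro!: mult_cont ch l k D_cont\<close>)
    qed
    finally show ?thesis .
  qed
  have D_sum: "(\<Sum>k\<in>I. D k p) = 0" if pM: "p \<in> M" for p
  proof -
    obtain d where d: "d \<in> \<A>" "p \<in> fst d" using ex_chart[OF pM] by blast
    interpret D: coord_chart d by (rule CC[OF d(1)])
    have "(\<Sum>k\<in>I. pd d i (\<phi> k) p) = 0" for i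
    proof -
      have "(\<Sum>k\<in>I. pd d i (\<phi> k) p) = pd d i (\<lambda>q. \<Sum>k\<in>I. \<phi> k q) p"
        by (rule D.pd_sum[OF d(2), symmetric]) (rule \<phi>C[OF d(1)])
      also have "\<dots> = pd d i (\<lambda>q. 1) p"
        by (rule D.pd_cong[OF _ d(2)]) (use \<phi>1 dom_subset[OF d(1)] in auto)
      finally show ?thesis by (simp add: D.pd_const)
    qed
    moreover have "(\<Sum>k\<in>I. D k p) = (\<Sum>i\<in>UNIV. (\<Sum>k\<in>I. pd d i (\<phi> k) p) * v d p $ i)"
      by (simp add: D_eq[OF _ d] sum_distrib_right sum.swap[of _ UNIV I])
    ultimately show ?thesis by simp
  qed
  have "(\<Sum>k\<in>I. J k (\<lambda>p. \<phi> k p * \<delta> p)) = (\<Sum>k\<in>I. - J k (D k))"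
  proof (rule sum.cong[OF refl])
    fix k assume k: "k \<in> I"
    have "J k (\<lambda>p. \<phi> k p * \<delta> p) + J k (D k) = 0"
      using step1[OF k] J_add[OF k mult_cont[OF ch[OF k] k \<delta>_cont[OF ch[OF k]]] D_cont[OF k ch[OF k]]] by simp
    then show "J k (\<lambda>p. \<phi> k p * \<delta> p) = - J k (D k)" by simp
  qed
  also have "\<dots> = - (\<Sum>k\<in>I. \<Sum>l\<in>I. J l (\<lambda>p. \<phi> l p * D k p))"
    by (simp add: step2 sum_negf)
  also have "(\<Sum>k\<in>I. \<Sum>l\<in>I. J l (\<lambda>p. \<phi> l p * D k p)) = (\<Sum>l\<in>I. \<Sum>k\<in>I. J l (\<lambda>p. \<phi> l p * D k p))"
    by (rule sum.swap)
  also have "\<dots> = (\<Sum>l\<in>I. J l (\<lambda>p. \<Sum>k\<in>I. \<phi> l p * D k p))"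
    by (intro sum.cong refl J_sum[symmetric] mult_cont ch D_cont)
  also have "\<dots> = (\<Sum>l\<in>I. J l (\<lambda>p. 0))"
    by (intro sum.cong refl J_cong) (simp_all add: sum_distrib_left[symmetric] D_sum)
  finally have sum0: "(\<Sum>k\<in>I. J k (\<lambda>p. \<phi> k p * \<delta> p)) = 0" by (simp add: J_def)
  have KM: "param (ch k) y \<in> M" "param (ch k) y \<in> fst (ch k)" if "k \<in> I" "y \<in> cbox (a k) (b k)" for k y
    using K_dom[OF that(1)] dom_subset[OF ch[OF that(1)]] that(2) by (auto simp: K_def)
  have nn: "0 \<le> \<phi> k (param (ch k) y) * \<delta> (param (ch k) y) * w (ch k) (param (ch k) y)"
    if "k \<in> I" "y \<in> cbox (a k) (b k)" for k y
    using \<phi>0[OF that(1) KM(1)[OF that]] nonneg[OF KM(1)[OF that]] w_pos[OF ch[OF that(1)] KM(2)[OF that]] by simp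
  have "0 \<le> J k (\<lambda>p. \<phi> k p * \<delta> p)" if "k \<in> I" for k
    unfolding J_def
    by (rule Henstock_Kurzweil_Integration.integral_nonneg[OF integrable[OF that mult_cont[OF ch[OF that] that \<delta>_cont[OF ch[OF that]]]]])
      (use nn[OF that] in auto)
  then have J0: "J k (\<lambda>p. \<phi> k p * \<delta> p) = 0" if "k \<in> I" for k
    using sum0 sum_nonneg_eq_0_iff[OF I(2), of "\<lambda>k. J k (\<lambda>p. \<phi> k p * \<delta> p)"] that by auto
  obtain k where k: "k \<in> I" "p0 \<in> V k" using I(3) p0 by blast
  then have "0 < \<psi> k p0" using bump I(1) by blast
  then have \<phi>p: "0 < \<phi> k p0" using \<Psi>_pos[OF p0] by (simp add: \<phi>_def)
  then have "p0 \<in> K k" using \<phi>_supp[OF k(1), of p0] by (auto simp: K_def)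
  then obtain y where y: "y \<in> cbox (a k) (b k)" "p0 = param (ch k) y" by (auto simp: K_def)
  note c0 = mult_cont[OF ch[OF k(1)] k(1) \<delta>_cont[OF ch[OF k(1)]]]
  have hi0: "((\<lambda>y. \<phi> k (param (ch k) y) * \<delta> (param (ch k) y) * w (ch k) (param (ch k) y)) has_integral 0) (cbox (a k) (b k))"
    using integrable_integral[OF integrable[OF k(1) c0]] J0[OF k(1)] by (simp add: J_def)
  have "\<phi> k (param (ch k) y) * \<delta> (param (ch k) y) * w (ch k) (param (ch k) y) = 0"
    by (rule has_integral_0_cbox_imp_0[OF cont[OF k(1) c0] _ hi0 bne[OF k(1)] y(1)])
      (use nn[OF k(1)] box_subset_cbox in blast)
  then show ?thesis
    using \<phi>p w_pos[OF ch[OF k(1)] KM(2)[OF k(1) y(1)]] by (simp add: y(2))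
qed

end

section \<open>Covering maps and local injectivity\<close>

text \<open>Fibres are compact and discrete, hence finite. Around the points of a fibre choose
  disjoint neighbourhoods on which f is injective; intersecting their images and removing the
  compact image of the rest of C leaves an evenly covered neighbourhood.\<close>

lemma compact_local_homeomorphism_covering_space:
  fixes f :: "'a::metric_space \<Rightarrow> 'b::metric_space"
  assumes C: "compact C" and cont: "continuous_on C f"
    and inj: "\<And>x. x \<in> C \<Longrightarrow> \<exists>T. x \<in> T \<and> openin (top_of_set C) T \<and> inj_on f T"
    and om: "\<And>T. openin (top_of_set C) T \<Longrightarrow> openin (top_of_set (f ` C)) (f ` T)"
  shows "covering_space C f (f ` C)"
proof
  show "continuous_on C f" "f ` C = f ` C" using cont by auto
next
  fix y assume y: "y \<in> f ` C"
  obtain T where T: "\<And>x. x \<in> C \<Longrightarrow> x \<in> T x" "\<And>x. x \<in> C \<Longrightarrow> openin (top_of_set C) (T x)"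
    "\<And>x. x \<in> C \<Longrightarrow> inj_on f (T x)"
    using inj by metis
  define F where "F = {x \<in> C. f x = y}"
  have FC: "F \<subseteq> C" by (auto simp: F_def)
  have "compact F"
  proof -
    have "closedin (top_of_set C) F"
      unfolding F_def by (rule continuous_closedin_preimage_constant[OF cont])
    then show ?thesis using C closedin_compact by blast
  qed
  have TF: "T x \<inter> F = {x}" if "x \<in> F" for x
    using T[of x] that openin_subset[OF T(2)[of x]] by (auto simp: F_def inj_on_def)
  have "\<exists>D\<subseteq>(\<lambda>x. F \<inter> T x) ` F. finite D \<and> F \<subseteq> \<Union>D"
  proof (rule compact_eq_openin_cover[THEN iffD1, OF \<open>compact F\<close>, rule_format], intro conjI ballI)
    fix c assume "c \<in> (\<lambda>x. F \<inter> T x) ` F"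
    then obtain x where x: "x \<in> F" "c = F \<inter> T x" by blast
    then obtain S where "open S" "T x = C \<inter> S" using T(2)[of x] FC by (auto simp: openin_open)
    then have "c = F \<inter> S" using x FC by auto
    then show "openin (top_of_set F) c" using \<open>open S\<close> by auto
  qed (use T FC in blast)
  then obtain D where D: "D \<subseteq> (\<lambda>x. F \<inter> T x) ` F" "finite D" "F \<subseteq> \<Union>D" by blast
  have "finite (\<Union>D)"
  proof (rule finite_Union[OF D(2)])
    fix c assume "c \<in> D"
    then obtain x where "x \<in> F" "c = F \<inter> T x" using D(1) by blast
    then have "c = {x}" using TF[of x] by auto
    then show "finite c" by simp
  qed
  then have finF: "finite F" using D(3) finite_subset by blast
  have Fne: "F \<noteq> {}" using y by (auto simp: F_def)
  \<comment> \<open>The least distance between two points of the fibre; the value 1 is a default for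
    a fibre with a single point.\<close>
  obtain \<epsilon> where \<epsilon>: "\<epsilon> > 0" "\<And>x x'. x \<in> F \<Longrightarrow> x' \<in> F \<Longrightarrow> x \<noteq> x' \<Longrightarrow> \<epsilon> \<le> dist x x'"
  proof (cases "{dist x x' |x x'. x \<in> F \<and> x' \<in> F \<and> x \<noteq> x'} = {}")
    case True
    then show ?thesis by (intro that[of 1]) auto
  next
    case False
    let ?S = "{dist x x' |x x'. x \<in> F \<and> x' \<in> F \<and> x \<noteq> x'}"
    have "?S \<subseteq> (\<lambda>(x, x'). dist x x') ` (F \<times> F)" by auto
    then have fin: "finite ?S"
      by (rule finite_subset) (intro finite_imageI finite_cartesian_product finF)
    then have "Min ?S \<in> ?S" using False by (rule Min_in)
    then have "Min ?S > 0" by force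
    moreover have "Min ?S \<le> dist x x'" if "x \<in> F" "x' \<in> F" "x \<noteq> x'" for x x'
      by (rule Min_le[OF fin]) (use that in blast)
    ultimately show ?thesis by (rule that)
  qed
  define U where "U x = T x \<inter> ball x (\<epsilon> / 2)" for x
  have Uo: "openin (top_of_set C) (U x)" and Ux: "x \<in> U x" and Ui: "inj_on f (U x)" if "x \<in> F" for x
    using T[of x] that FC \<epsilon>(1) unfolding U_def by (auto intro: openin_Int_open inj_on_subset)
  have UC: "U x \<subseteq> C" if "x \<in> F" for x using openin_subset[OF Uo[OF that]] by simp
  have Ud: "U x \<inter> U x' = {}" if "x \<in> F" "x' \<in> F" "x \<noteq> x'" for x x'
  proof -
    have "q \<notin> U x'" if q: "q \<in> U x" for q
    proof
      assume "q \<in> U x'"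
      then have "dist x q < \<epsilon> / 2" "dist x' q < \<epsilon> / 2" using q by (auto simp: U_def)
      then have "dist x x' < \<epsilon>" using dist_triangle_half_r[of q x \<epsilon> x'] by (simp add: dist_commute)
      then show False using \<epsilon>(2)[OF \<open>x \<in> F\<close> \<open>x' \<in> F\<close> \<open>x \<noteq> x'\<close>] by simp
    qed
    then show ?thesis by blast
  qed
  \<comment> \<open>Outside the closed set R every preimage lies in one of the chosen
    neighbourhoods, so no further sheets appear.\<close>
  define R where "R = f ` (C - \<Union> (U ` F))"
  have "closedin (top_of_set C) (C - \<Union> (U ` F))"
    using openin_Union[of "U ` F" "top_of_set C"] Uo by (intro closedin_diff) auto
  then have "compact (C - \<Union> (U ` F))" using C closedin_compact by blast
  then have "compact R"
    unfolding R_def using continuous_on_subset[OF cont] by (intro compact_continuous_image) auto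
  then have Rc: "closed R" by (rule compact_imp_closed)
  have yR: "y \<notin> R" using Ux by (auto simp: R_def F_def)
  define V where "V = (\<Inter>x\<in>F. f ` U x) \<inter> - R"
  have "openin (top_of_set (f ` C)) (\<Inter>x\<in>F. f ` U x)"
    using finF Fne om[OF Uo] by (intro openin_Inter) auto
  then have Vo: "openin (top_of_set (f ` C)) V"
    unfolding V_def using Rc by (intro openin_Int_open) (auto simp: open_Compl)
  have yV: "y \<in> V" using Ux yR by (force simp: V_def F_def)
  define v where "v = (\<lambda>x. U x \<inter> f -` V) ` F"
  have vU: "\<Union>v = C \<inter> f -` V"
  proof
    show "\<Union>v \<subseteq> C \<inter> f -` V" using UC by (auto simp: v_def)
    show "C \<inter> f -` V \<subseteq> \<Union>v"
    proof
      fix q assume q: "q \<in> C \<inter> f -` V"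
      then have "f q \<notin> R" by (simp add: V_def)
      then have "q \<in> \<Union> (U ` F)" using q by (auto simp: R_def)
      then show "q \<in> \<Union>v" using q by (auto simp: v_def)
    qed
  qed
  have pre: "openin (top_of_set C) (C \<inter> f -` V)"
    using continuous_on_open_gen[of f C "f ` C"] cont Vo by auto
  have vo: "openin (top_of_set C) u" if uv: "u \<in> v" for u
  proof -
    obtain x where x: "x \<in> F" "u = U x \<inter> f -` V" using uv by (auto simp: v_def)
    then have "u = U x \<inter> (C \<inter> f -` V)" using UC by auto
    then show ?thesis using openin_Int[OF Uo[OF x(1)] pre] by simp
  qed
  have hom: "\<exists>q. homeomorphism u V f q" if uv: "u \<in> v" for u
  proof -
    obtain x where x: "x \<in> F" "u = U x \<inter> f -` V" using uv by (auto simp: v_def)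
    have uC: "u \<subseteq> C" using UC[OF x(1)] x(2) by blast
    have "V \<subseteq> f ` U x" using x(1) by (auto simp: V_def)
    then have im: "f ` u = V" unfolding x(2) by blast
    have "\<exists>g. homeomorphism u V f g"
    proof (rule homeomorphism_injective_open_map[of u f V])
      show "continuous_on u f" using cont uC by (rule continuous_on_subset)
      show "inj_on f u" using Ui[OF x(1)] x(2) by (auto intro: inj_on_subset)
      show "openin (top_of_set V) (f ` u')" if "openin (top_of_set u) u'" for u'
      proof -
        have "openin (top_of_set C) u'" using that vo[OF uv] by (rule openin_trans)
        then have "openin (top_of_set (f ` C)) (f ` u')" by (rule om)
        moreover have "f ` u' \<subseteq> V" using im openin_subset[OF that] by auto
        ultimately show ?thesis
          using openin_subset[OF Vo] by (auto elim!: openin_subset_trans)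
      qed
    qed (use im in blast)+
    then show ?thesis by blast
  qed
  have "pairwise disjnt v"
    unfolding pairwise_def disjnt_def v_def using Ud by blast
  then show "\<exists>T. y \<in> T \<and> openin (top_of_set (f ` C)) T \<and>
      (\<exists>v. \<Union>v = C \<inter> f -` T \<and> (\<forall>u\<in>v. openin (top_of_set C) u) \<and> pairwise disjnt v \<and> (\<forall>u\<in>v. \<exists>q. homeomorphism u T f q))"
    by (intro exI[of _ V] conjI exI[of _ v] ballI yV Vo vU vo hom)
qed

text \<open>The identity and the section followed by the covering map are two lifts of the covering map.\<close>

lemma covering_space_simply_connected_inj_on:
  fixes f :: "'a::real_normed_vector \<Rightarrow> 'b::real_normed_vector"
  assumes cov: "covering_space C f S" and C: "connected C"
    and S: "simply_connected S" "locally path_connected S"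
  shows "inj_on f C"
proof (cases "C = {}")
  case False
  then have "S \<noteq> {}" using covering_space_imp_surjective[OF cov] by auto
  obtain g where g: "continuous_on S g" "g \<in> S \<rightarrow> C" "\<And>y. y \<in> S \<Longrightarrow> f (g y) = y"
    using covering_space_lift[OF cov S continuous_on_id, of ] by auto
  obtain y where y: "y \<in> S" using \<open>S \<noteq> {}\<close> by blast
  have fC: "f ` C = S" by (rule covering_space_imp_surjective[OF cov])
  have cf: "continuous_on C f" by (rule covering_space_imp_continuous[OF cov])
  have "g (f x) = x" if "x \<in> C" for x
  proof (rule covering_space_lift_unique[OF cov, of "\<lambda>x. g (f x)" "g y" "\<lambda>x. x" C f])
    show "continuous_on C (\<lambda>x. g (f x))"
      using g(1) cf by (rule continuous_on_compose2) (use fC in auto)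
    show "(\<lambda>x. g (f x)) \<in> C \<rightarrow> C" using g(2) fC by auto
    show "f z = f (g (f z))" if "z \<in> C" for z using g(3)[of "f z"] fC that by auto
  qed (use g y fC cf C that in auto)
  then show ?thesis by (metis inj_onI)
qed simp

text \<open>Provides infinitely many independent coordinates in one fixed normed space. The number
  of bump functions needed for the embedding is found only inside a proof and cannot serve as the
  dimension of a vector type.\<close>

lemma indicator_bcontfun: "\<exists>e :: nat \<Rightarrow> nat \<Rightarrow>\<^sub>C real. \<forall>k n. apply_bcontfun (e k) n = (if n = k then 1 else 0)"
proof -
  have "(\<lambda>n. if n = k then 1 else 0 :: real) \<in> bcontfun" for k :: nat
    unfolding bcontfun_def
    by (auto simp: continuous_on_open_vimage open_discrete intro!: finite_imp_bounded finite_subset[of _ "{0, 1}"])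
  then show ?thesis
    by (intro exI[of _ "\<lambda>k. Bcontfun (\<lambda>n. if n = k then 1 else 0)"]) (simp add: Bcontfun_inverse)
qed

context closed_hypersurface
begin

section \<open>Local injectivity and an embedding of M into a normed space\<close>

lemma continuous_on_M:
  assumes "\<And>c. c \<in> \<A> \<Longrightarrow> Ck_chart c 0 f"
  shows "continuous_on M f"
  unfolding continuous_openin_preimage_eq
proof (intro allI impI)
  fix T :: "'b set" assume T: "open T"
  have "openin (top_of_set M) (fst c \<inter> f -` T)" if c: "c \<in> \<A>" for c
  proof -
    interpret C: coord_chart c by (rule coord_chart[OF c])
    have "continuous_on (snd c ` fst c) (f \<circ> param c)" using assms[OF c] by (simp add: Ck_chart_def)
    then have "continuous_on (fst c) (\<lambda>p. (f \<circ> param c) (snd c p))"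
      by (rule continuous_on_compose2[OF _ coord_continuous[OF c]]) auto
    then have "continuous_on (fst c) f" by (rule continuous_on_eq) simp
    then have "openin (top_of_set (fst c)) (fst c \<inter> f -` T)" using T by (simp add: continuous_openin_preimage_eq)
    then show ?thesis using dom_openin[OF c] by (rule openin_trans)
  qed
  then have "openin (top_of_set M) (\<Union>c\<in>\<A>. fst c \<inter> f -` T)" by (intro openin_Union) auto
  moreover have "M \<inter> f -` T = (\<Union>c\<in>\<A>. fst c \<inter> f -` T)" using M_eq by auto
  ultimately show "openin (top_of_set M) (M \<inter> f -` T)" by simp
qed

lemma x_continuous: "continuous_on M x"
  using hypersurface_chart.x_smooth[OF hypersurface_chart] hypersurface_chart.N_smooth[OF hypersurface_chart]
  by (auto intro: continuous_on_M)

text \<open>The derivative of the immersion has a left inverse and varies continuously in operator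
  norm, which is bounded by the sum of the norms of its values on the basis. A map that is strictly
  close to an injective linear one is injective nearby.\<close>

lemma locally_injective:
  assumes "p \<in> M"
  shows "\<exists>B. openin (top_of_set M) B \<and> p \<in> B \<and> inj_on x B"
proof -
  obtain c where c: "c \<in> \<A>" "p \<in> fst c" using ex_chart[OF assms] by blast
  interpret H: hypersurface_chart c x N by (rule hypersurface_chart[OF c(1)])
  define U where "U = snd c ` fst c"
  define f where "f = x \<circ> param c"
  define f' where "f' y = frechet_derivative f (at y)" for y
  define y where "y = snd c p"
  have yU: "y \<in> U" using c by (simp add: y_def U_def)
  have oU: "open U" using H.open_image by (simp add: U_def)
  have Cf: "Ck_on 1 U f" using H.x_smooth[of 1] by (simp add: Ck_chart_def f_def U_def)
  have df: "(f has_derivative f' z) (at z)" if "z \<in> U" for z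
    using Cf that unfolding f'_def by (auto intro: has_frechet_derivative)
  have lin: "linear (f' z)" if "z \<in> U" for z using df[OF that] has_derivative_linear by blast
  have "inj (f' y)" using H.immersed[OF c(2)] by (simp add: f'_def f_def y_def)
  then obtain g' where g': "linear g'" "g' \<circ> f' y = id"
    using linear_injective_left_inverse[OF lin[OF yU]] by blast
  have "\<exists>d>0. \<forall>z. dist y z < d \<longrightarrow> onorm (\<lambda>v. f' z v - f' y v) < e" if e: "e > 0" for e
  proof -
    define \<phi> where "\<phi> z = (\<Sum>b\<in>Basis. norm (f' z b - f' y b))" for z
    have "continuous_on U (\<lambda>z. f' z b)" for b using Cf by (simp add: f'_def)
    then have "continuous_on U \<phi>" unfolding \<phi>_def by (intro continuous_intros)
    then have "isCont \<phi> y" using oU yU by (simp add: continuous_on_eq_continuous_at)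
    then obtain d1 where d1: "d1 > 0" "\<And>z. dist z y < d1 \<Longrightarrow> dist (\<phi> z) (\<phi> y) < e"
      using e unfolding continuous_at_eps_delta by blast
    obtain d2 where d2: "d2 > 0" "ball y d2 \<subseteq> U" using oU yU open_contains_ball by blast
    have "onorm (\<lambda>v. f' z v - f' y v) < e" if z: "dist y z < min d1 d2" for z
    proof -
      have zU: "z \<in> U" using z d2 by auto
      have "linear (\<lambda>v. f' z v - f' y v)" by (intro linear_compose_sub lin zU yU)
      then have "onorm (\<lambda>v. f' z v - f' y v) \<le> \<phi> z"
      proof (intro onorm_le)
        fix v
        assume l: "linear (\<lambda>v. f' z v - f' y v)"
        have "norm (f' z v - f' y v) = norm (\<Sum>b\<in>Basis. (v \<bullet> b) *\<^sub>R (f' z b - f' y b))"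
          using linear_eq_sum_Basis[OF l, of v] by simp
        also have "\<dots> \<le> (\<Sum>b\<in>Basis. norm v * norm (f' z b - f' y b))"
          by (intro sum_norm_le) (auto intro!: mult_right_mono Basis_le_norm)
        finally show "norm (f' z v - f' y v) \<le> \<phi> z * norm v"
          by (simp add: \<phi>_def sum_distrib_left mult.commute)
      qed
      also have "\<phi> z < e" using d1(2)[of z] z by (simp add: \<phi>_def dist_commute dist_real_def)
      finally show ?thesis .
    qed
    then show ?thesis using d1 d2 by (intro exI[of _ "min d1 d2"]) auto
  qed
  note cont = this
  have bl: "bounded_linear g'" using g'(1) by (simp add: linear_conv_bounded_linear)
  obtain r where r: "r > 0" "ball y r \<subseteq> U" "inj_on f (ball y r)"
    by (rule has_derivative_locally_injective[OF yU oU bl g'(2) df cont])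
  define B where "B = {q \<in> fst c. snd c q \<in> ball y r}"
  have "openin (top_of_set M) B" unfolding B_def by (rule openin_coord_preimage[OF c(1) open_ball])
  moreover have "p \<in> B" using c r by (simp add: B_def y_def)
  moreover have "inj_on x B"
  proof (rule inj_onI)
    fix q q' assume q: "q \<in> B" "q' \<in> B" "x q = x q'"
    then have "f (snd c q) = f (snd c q')" by (simp add: B_def f_def)
    then have "snd c q = snd c q'" using r(3) q by (auto simp: B_def dest: inj_onD)
    then show "q = q'" using q H.inj_coord by (auto simp: B_def dest: inj_onD)
  qed
  ultimately show ?thesis by blast
qed

text \<open>The covering results are applied in normed spaces, whereas M is a Hausdorff space.
  Finitely many bumps separate the points that x identifies: if two points share a positive value of
  one bump, both lie in a set on which x is injective. Under this embedding x becomes the first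
  projection.\<close>

lemma embedding_over_x:
  "\<exists>\<eta> :: 'a \<Rightarrow> (nat \<Rightarrow>\<^sub>C real). continuous_on M \<eta> \<and> inj_on (\<lambda>p. (x p, \<eta> p)) M"
proof -
  have "\<forall>p\<in>M. \<exists>B (\<psi> :: 'a \<Rightarrow> real) V. inj_on x B \<and> (\<forall>q. \<psi> q > 0 \<longrightarrow> q \<in> B) \<and> (\<forall>q. 0 \<le> \<psi> q) \<and>
      (\<forall>d\<in>\<A>. Ck_chart d 1 \<psi>) \<and> openin (top_of_set M) V \<and> p \<in> V \<and> (\<forall>q\<in>V. 0 < \<psi> q)"
  proof
    fix p assume "p \<in> M"
    then obtain B where B: "openin (top_of_set M) B" "p \<in> B" "inj_on x B" using locally_injective by blast
    obtain c a b and \<psi> :: "'a \<Rightarrow> real" and V where h: "c \<in> \<A>" "cbox a b \<subseteq> snd c ` (fst c \<inter> B)"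
      "\<forall>q. 0 \<le> \<psi> q" "\<forall>q. q \<notin> param c ` cbox a b \<longrightarrow> \<psi> q = 0" "\<forall>d\<in>\<A>. Ck_chart d 1 \<psi>"
      "openin (top_of_set M) V" "p \<in> V" "\<forall>q\<in>V. 0 < \<psi> q"
      using bump_function[OF B(1,2)] by blast
    have "q \<in> B" if pos: "\<psi> q > 0" for q
    proof -
      obtain y where y: "y \<in> cbox a b" "q = param c y" using h(4) pos by (metis imageE less_irrefl)
      then obtain q' where "q' \<in> fst c \<inter> B" "y = snd c q'" using h(2) by blast
      then show ?thesis using y coord_chart.param_coord[OF coord_chart[OF h(1)], of q'] by simp
    qed
    then show "\<exists>B (\<psi> :: 'a \<Rightarrow> real) V. inj_on x B \<and> (\<forall>q. \<psi> q > 0 \<longrightarrow> q \<in> B) \<and> (\<forall>q. 0 \<le> \<psi> q) \<and>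
      (\<forall>d\<in>\<A>. Ck_chart d 1 \<psi>) \<and> openin (top_of_set M) V \<and> p \<in> V \<and> (\<forall>q\<in>V. 0 < \<psi> q)"
      using B(3) h by blast
  qed
  then obtain B and \<psi> :: "'a \<Rightarrow> 'a \<Rightarrow> real" and V where bump:
    "\<forall>p\<in>M. inj_on x (B p) \<and> (\<forall>q. \<psi> p q > 0 \<longrightarrow> q \<in> B p) \<and> (\<forall>q. 0 \<le> \<psi> p q) \<and>
      (\<forall>d\<in>\<A>. Ck_chart d 1 (\<psi> p)) \<and> openin (top_of_set M) (V p) \<and> p \<in> V p \<and> (\<forall>q\<in>V p. 0 < \<psi> p q)"
    unfolding bchoice_iff by blast
  have "\<exists>D\<subseteq>V ` M. finite D \<and> M \<subseteq> \<Union>D"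
    by (rule compact_eq_openin_cover[THEN iffD1, OF compact_M, rule_format]) (use bump in auto)
  then obtain I where I: "I \<subseteq> M" "finite I" "M \<subseteq> \<Union> (V ` I)"
    by (metis finite_subset_image)
  obtain num :: "'a \<Rightarrow> nat" where num: "inj_on num I" using finite_imp_inj_to_nat_seg[OF I(2)] by auto
  obtain e :: "nat \<Rightarrow> nat \<Rightarrow>\<^sub>C real" where e: "\<And>k n. apply_bcontfun (e k) n = (if n = k then 1 else 0)"
    using indicator_bcontfun by blast
  define \<eta> where "\<eta> p = (\<Sum>k\<in>I. \<psi> k p *\<^sub>R e (num k))" for p
  have c\<psi>: "continuous_on M (\<psi> k)" if "k \<in> I" for k
  proof (rule continuous_on_M)
    fix c assume "c \<in> \<A>"
    then have "Ck_chart c 1 (\<psi> k)" using bump I(1) \<open>k \<in> I\<close> by blast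
    then show "Ck_chart c 0 (\<psi> k)" by (rule Ck_chart_mono) simp
  qed
  have "continuous_on M \<eta>" unfolding \<eta>_def by (intro continuous_intros c\<psi>)
  moreover have ap: "apply_bcontfun (\<eta> p) (num k) = \<psi> k p" if k: "k \<in> I" for p k
  proof -
    have lin: "apply_bcontfun (\<Sum>k\<in>J. \<psi> k p *\<^sub>R e (num k)) n = (\<Sum>k\<in>J. \<psi> k p * apply_bcontfun (e (num k)) n)" if "finite J" for J n
      using that by induction (simp_all add: plus_bcontfun.rep_eq scaleR_bcontfun.rep_eq zero_bcontfun.rep_eq)
    have "apply_bcontfun (\<eta> p) (num k) = (\<Sum>l\<in>I. if l = k then \<psi> k p else 0)"
      unfolding \<eta>_def lin[OF I(2)] e using num k by (intro sum.cong) (auto dest: inj_onD)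
    then show ?thesis using I(2) k by simp
  qed
  moreover have "inj_on (\<lambda>p. (x p, \<eta> p)) M"
  proof (rule inj_onI)
    fix p q assume pq: "p \<in> M" "q \<in> M" "(x p, \<eta> p) = (x q, \<eta> q)"
    obtain k where k: "k \<in> I" "p \<in> V k" using I(3) pq(1) by blast
    then have "\<psi> k p > 0" using bump I(1) by blast
    moreover have "\<psi> k p = \<psi> k q" using ap[OF k(1)] pq(3) by (metis prod.inject)
    ultimately have "p \<in> B k" "q \<in> B k" using bump I(1) k(1) by auto
    moreover have "inj_on x (B k)" using bump I(1) k(1) by blast
    ultimately show "p = q" using pq(3) by (auto dest: inj_onD)
  qed
  ultimately show ?thesis by blast
qed

end

section \<open>Totally umbilic hypersurfaces\<close>

context closed_hypersurface
begin

text \<open>Balls in a chart are convex, which gives local constancy; connectedness of M does the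
  rest.\<close>

lemma zero_derivative_imp_constant:
  fixes f :: "'a \<Rightarrow> 'b::euclidean_space"
  assumes f: "\<And>c. c \<in> \<A> \<Longrightarrow> Ck_chart c 1 f"
    and 0: "\<And>c p i. c \<in> \<A> \<Longrightarrow> p \<in> fst c \<Longrightarrow> pd c i f p = 0"
  shows "f constant_on M"
proof (rule locally_constant_imp_constant[OF connected_M])
  fix p assume "p \<in> M"
  then obtain c where c: "c \<in> \<A>" "p \<in> fst c" using ex_chart by blast
  interpret C: coord_chart c by (rule coord_chart[OF c(1)])
  have "snd c p \<in> snd c ` fst c" using c by simp
  then obtain r where r: "r > 0" "ball (snd c p) r \<subseteq> snd c ` fst c"
    using C.open_image open_contains_ball by blast
  have D: "((\<lambda>y. f (param c y)) has_derivative (\<lambda>v. 0)) (at y within ball (snd c p) r)"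
    if "y \<in> ball (snd c p) r" for y
  proof -
    have y: "y \<in> snd c ` fst c" using r that by blast
    then have q: "param c y \<in> fst c" "snd c (param c y) = y" by simp_all
    have "frechet_derivative (f \<circ> param c) (at y) v = 0" for v
      using C.frechet_derivative_eq_sum_pd[OF f[OF c(1)] q(1), of v] 0[OF c(1) q(1)] q(2) by simp
    then have "frechet_derivative (f \<circ> param c) (at y) = (\<lambda>v. 0)" by blast
    then show ?thesis
      using has_derivative_at_withinI[OF C.has_derivative_chart[OF f[OF c(1)] q(1)]] q(2) by simp
  qed
  obtain a where a: "\<And>y. y \<in> ball (snd c p) r \<Longrightarrow> f (param c y) = a"
    using has_derivative_zero_constant[OF convex_ball D] by blast
  define T where "T = {q \<in> fst c. snd c q \<in> ball (snd c p) r}"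
  have "openin (top_of_set M) T" unfolding T_def by (rule openin_coord_preimage[OF c(1) open_ball])
  moreover have "p \<in> T" using c r by (simp add: T_def)
  moreover have "f q = f p" if "q \<in> T" for q
    using a[of "snd c q"] a[of "snd c p"] that c r by (simp add: T_def)
  ultimately show "\<exists>T. openin (top_of_set M) T \<and> p \<in> T \<and> (\<forall>q\<in>T. f q = f p)" by blast
qed

section \<open>Hypersurfaces whose normal is radial\<close>

context
  fixes t :: real and z :: "real ^ 'm"
  assumes t: "t > 0" and N_eq: "\<And>p. p \<in> M \<Longrightarrow> N p = t *\<^sub>R (x p - z)"
begin

lemma norm_x_minus_center: "p \<in> M \<Longrightarrow> norm (x p - z) = 1 / t"
proof -
  assume p: "p \<in> M"
  then obtain c where c: "c \<in> \<A>" "p \<in> fst c" using ex_chart by blast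
  have "norm (N p) = 1" by (rule hypersurface_chart.norm_N[OF hypersurface_chart[OF c(1)] c(2)])
  then have "t * norm (x p - z) = 1" using t unfolding N_eq[OF p] norm_scaleR by simp
  then show ?thesis using t by (simp add: field_simps)
qed

lemma x_image_subset_sphere: "x ` M \<subseteq> sphere z (1 / t)"
  using norm_x_minus_center by (auto simp: dist_norm norm_minus_commute)

text \<open>Openness is obtained from the cone map \<open>(y, s) \<mapsto> z + s (x y - z)\<close>, whose derivative is onto.\<close>

lemma sphere_open_map:
  assumes B: "openin (top_of_set M) B"
  shows "openin (top_of_set (sphere z (1 / t))) (x ` B)"
proof (subst openin_subopen, intro ballI)
  fix w assume "w \<in> x ` B"
  then obtain p where p: "p \<in> B" "w = x p" by blast
  have BM: "B \<subseteq> M" using openin_subset[OF B] by simp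
  then obtain c where c: "c \<in> \<A>" "p \<in> fst c" using ex_chart p by blast
  interpret H: hypersurface_chart c x N by (rule hypersurface_chart[OF c(1)])
  define U where "U = snd c ` fst c"
  define U' where "U' = snd c ` (fst c \<inter> B)"
  define f where "f = x \<circ> param c"
  define y where "y = snd c p"
  have oU: "open U" "open U'" using H.open_image open_coord_image[OF c(1) B] by (simp_all add: U_def U'_def)
  have yU: "y \<in> U" "y \<in> U'" using c p by (auto simp: y_def U_def U'_def)
  have fy: "f y = x p" using c by (simp add: f_def y_def)
  have pM: "p \<in> M" using p BM by blast
  define f' where "f' v = (\<Sum>i\<in>UNIV. v $ i *\<^sub>R pd c i x p)" for v
  have f': "(f has_derivative f') (at y)"
  proof -
    have e: "frechet_derivative (x \<circ> param c) (at (snd c p)) = f'"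
      using H.frechet_derivative_eq_sum_pd[OF H.x_smooth c(2)] by (simp add: f'_def fun_eq_iff)
    show ?thesis using H.has_derivative_chart[OF H.x_smooth c(2)] unfolding e by (simp add: f_def y_def o_def)
  qed
  define \<Phi> where "\<Phi> = (\<lambda>(y, s). z + s *\<^sub>R (f y - z))"
  define \<Phi>' where "\<Phi>' = (\<lambda>(v, s). f' v + s *\<^sub>R (f y - z))"
  \<comment> \<open>A right inverse of \<open>\<Phi>'\<close>, as
    \<open>sussmann_open_mapping\<close> requires: the tangential part of a vector is read off with
    the inverse metric, the radial part from N = t (x - z).\<close>
  define \<Xi> where "\<Xi> w = ((\<chi> k. \<Sum>l\<in>UNIV. matrix_inv (metric c x p) $ k $ l * (w \<bullet> pd c l x p)), t * (w \<bullet> N p))" for w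
  have d\<Phi>: "(\<Phi> has_derivative \<Phi>') (at (y, 1))"
  proof -
    have "(f has_derivative f') (at (fst (y, 1::real)))" using f' by simp
    from has_derivative_compose[OF has_derivative_fst[OF has_derivative_ident] this, of UNIV]
    have "((\<lambda>a. f (fst a)) has_derivative (\<lambda>a. f' (fst a))) (at (y, 1::real))" by simp
    from has_derivative_diff[OF this has_derivative_const[of z]]
    have "((\<lambda>a. f (fst a) - z) has_derivative (\<lambda>a. f' (fst a))) (at (y, 1::real))" by simp
    from has_derivative_add[OF has_derivative_const[of z] has_derivative_scaleR[OF has_derivative_snd[OF has_derivative_ident] this]]
    show ?thesis by (simp add: \<Phi>_def \<Phi>'_def case_prod_beta')
  qed
  have c\<Phi>: "continuous_on (U \<times> UNIV) \<Phi>"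
  proof -
    have "continuous_on U f" using Ck_on_imp_continuous_on H.x_smooth[of 0] by (simp add: Ck_chart_def f_def U_def)
    then have "continuous_on (U \<times> (UNIV :: real set)) (\<lambda>a. f (fst a))"
      by (rule continuous_on_compose2) (auto intro: continuous_intros)
    then show ?thesis unfolding \<Phi>_def case_prod_beta' by (intro continuous_intros)
  qed
  have "linear \<Xi>"
    by (auto intro!: linearI simp: \<Xi>_def vec_eq_iff inner_add_left distrib_left sum.distrib sum_distrib_left mult.left_commute)
  then have bl: "bounded_linear \<Xi>" by (simp add: linear_conv_bounded_linear)
  have inv: "\<Phi>' \<circ> \<Xi> = id"
  proof
    fix w
    have "(t * (w \<bullet> N p)) *\<^sub>R (f y - z) = (w \<bullet> N p) *\<^sub>R N p"
      using N_eq[OF pM] by (simp add: fy mult.commute)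
    then show "(\<Phi>' \<circ> \<Xi>) w = id w"
      using H.tangent_normal_decomposition[OF c(2), of w] by (simp add: \<Phi>'_def \<Xi>_def f'_def)
  qed
  \<comment> \<open>The second factor surrounds 1 and stays positive, so for an image point on the
    sphere the distance to z forces s = 1.\<close>
  define T where "T = U' \<times> {1/2<..<2::real}"
  have oT: "open T" unfolding T_def using oU by (intro open_Times) auto
  have yT: "(y, 1) \<in> interior T" using oT yU by (simp add: interior_open T_def)
  have "U' \<subseteq> U" by (auto simp: U_def U'_def)
  then have TU: "T \<subseteq> U \<times> UNIV" by (auto simp: T_def)
  have "\<Phi> (y, 1) \<in> interior (\<Phi> ` T)"
    by (rule sussmann_open_mapping[OF open_Times[OF oU(1) open_UNIV] c\<Phi> _ d\<Phi> bl inv TU yT]) (use yU in simp)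
  then have w: "w \<in> interior (\<Phi> ` T)" using fy p(2) by (simp add: \<Phi>_def)
  have sub: "sphere z (1 / t) \<inter> interior (\<Phi> ` T) \<subseteq> x ` B"
  proof
    fix u assume u: "u \<in> sphere z (1 / t) \<inter> interior (\<Phi> ` T)"
    then have "u \<in> \<Phi> ` T" using interior_subset by blast
    then obtain y' s where ys: "y' \<in> U'" "1/2 < s" "u = z + s *\<^sub>R (f y' - z)"
      by (auto simp: T_def \<Phi>_def)
    then obtain q where q: "q \<in> fst c" "q \<in> B" "y' = snd c q" by (auto simp: U'_def)
    then have fq: "f y' = x q" by (simp add: f_def)
    have "norm (u - z) = 1 / t" using u by (simp add: dist_norm norm_minus_commute)
    moreover have "norm (u - z) = s * (1 / t)"
      using ys(2,3) norm_x_minus_center[of q] q(2) BM unfolding fq by auto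
    ultimately have "s = 1" using t by simp
    then show "u \<in> x ` B" using ys fq q by simp
  qed
  show "\<exists>T. openin (top_of_set (sphere z (1 / t))) T \<and> w \<in> T \<and> T \<subseteq> x ` B"
  proof (intro exI conjI)
    show "openin (top_of_set (sphere z (1 / t))) (sphere z (1 / t) \<inter> interior (\<Phi> ` T))" by auto
    show "w \<in> sphere z (1 / t) \<inter> interior (\<Phi> ` T)" using w p(2) pM x_image_subset_sphere by blast
  qed (rule sub)
qed

text \<open>The image is open in the sphere by \<open>sphere_open_map\<close> and closed by
  compactness, and the sphere is connected.\<close>

lemma x_image_eq_sphere:
  assumes "CARD('n) \<ge> 2"
  shows "x ` M = sphere z (1 / t)"
proof -
  have "connected (sphere z (1 / t))" using assms card_m by (intro connected_sphere) simp
  moreover have "openin (top_of_set (sphere z (1 / t))) (x ` M)"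
    by (rule sphere_open_map) (rule openin_subtopology_self)
  moreover have "closedin (top_of_set (sphere z (1 / t))) (x ` M)"
    using compact_imp_closed[OF compact_continuous_image[OF x_continuous compact_M]] x_image_subset_sphere
    by (rule closed_subset[rotated])
  moreover have "x ` M \<noteq> {}" using M_ne by simp
  ultimately show ?thesis unfolding connected_clopen by blast
qed

text \<open>A connected covering of a simply connected sphere has one sheet. The argument runs on
  the copy C of M in the product with the space of bounded functions, where x is the projection
  \<open>fst\<close>. For a circle this would fail, as curves may wind around several times.\<close>

lemma x_inj_on:
  assumes n: "CARD('n) \<ge> 2"
  shows "inj_on x M"
proof -
  obtain \<eta> :: "'a \<Rightarrow> (nat \<Rightarrow>\<^sub>C real)" where \<eta>: "continuous_on M \<eta>" "inj_on (\<lambda>p. (x p, \<eta> p)) M"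
    using embedding_over_x by blast
  define h where "h p = (x p, \<eta> p)" for p
  define C where "C = h ` M"
  have ch: "continuous_on M h" unfolding h_def by (intro continuous_on_Pair x_continuous \<eta>(1))
  have ih: "inj_on h M" using \<eta>(2) by (simp add: h_def[abs_def])
  have cC: "compact C" unfolding C_def by (rule compact_continuous_image[OF ch compact_M])
  have conC: "connected C" unfolding C_def by (rule connected_continuous_image[OF ch connected_M])
  obtain g where g: "homeomorphism M C h g"
    using homeomorphism_compact[OF compact_M ch _ ih, of C] C_def by blast
  have gx: "fst q = x (g q)" if "q \<in> C" for q
    using homeomorphism_apply2[OF g that] by (metis fst_conv h_def)
  have fstC: "fst ` C = sphere z (1 / t)"
    unfolding C_def image_image h_def fst_conv by (rule x_image_eq_sphere[OF n])
  have gop: "openin (top_of_set M) (g ` T)" if "openin (top_of_set C) T" for T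
    by (rule homeomorphism_imp_open_map[OF homeomorphism_symD[OF g] that])
  have "covering_space C fst (fst ` C)"
  proof (rule compact_local_homeomorphism_covering_space[OF cC])
    show "continuous_on C fst" by (intro continuous_intros)
    show "openin (top_of_set (fst ` C)) (fst ` T)" if T: "openin (top_of_set C) T" for T
    proof -
      have "fst ` T = x ` g ` T" unfolding image_image
        by (rule image_cong) (use gx openin_subset[OF T] in auto)
      then show ?thesis unfolding fstC using sphere_open_map[OF gop[OF T]] by simp
    qed
    fix q assume q: "q \<in> C"
    then have "g q \<in> M" using g by (auto simp: homeomorphism_def)
    then obtain B where B: "openin (top_of_set M) B" "g q \<in> B" "inj_on x B" using locally_injective by blast
    have "openin (top_of_set C) (h ` B)" by (rule homeomorphism_imp_open_map[OF g B(1)])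
    moreover have "q \<in> h ` B" using homeomorphism_apply2[OF g q] B(2) by (metis imageI)
    moreover have "inj_on fst (h ` B)"
      using B(3) by (auto simp: inj_on_def h_def)
    ultimately show "\<exists>T. q \<in> T \<and> openin (top_of_set C) T \<and> inj_on fst T" by blast
  qed
  moreover have "simply_connected (fst ` C)"
    unfolding fstC using n card_m by (intro simply_connected_sphere) simp
  moreover have "locally path_connected (fst ` C)"
    unfolding fstC by (rule locally_path_connected_sphere)
  ultimately have "inj_on fst C"
    using covering_space_simply_connected_inj_on[OF _ conC] by blast
  then have "inj_on (fst \<circ> h) M" unfolding C_def by (intro comp_inj_on ih)
  moreover have "fst \<circ> h = x" by (simp add: fun_eq_iff h_def)
  ultimately show ?thesis by simp
qed

end

text \<open>The field N - k x has zero derivative, hence is a constant, and the centre is that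
  constant divided by -k.\<close>

lemma umbilic_imp_sphere:
  assumes k: "k > 0" and A: "\<And>c p. c \<in> \<A> \<Longrightarrow> p \<in> fst c \<Longrightarrow> shape_operator c x N p = mat (- k)"
  obtains z where "\<And>p. p \<in> M \<Longrightarrow> N p = k *\<^sub>R (x p - z)"
proof -
  have "(\<lambda>p. N p + (- k) *\<^sub>R x p) constant_on M"
  proof (rule zero_derivative_imp_constant)
    fix c assume c: "c \<in> \<A>"
    interpret H: hypersurface_chart c x N by (rule hypersurface_chart[OF c])
    show "Ck_chart c 1 (\<lambda>p. N p + (- k) *\<^sub>R x p)"
      by (intro H.Ck_chart_add H.Ck_chart_scaleR H.N_smooth H.x_smooth H.Ck_chart_const)
    show "pd c i (\<lambda>p. N p + (- k) *\<^sub>R x p) p = 0" if "p \<in> fst c" for p i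
      by (rule H.umbilic_pd_eq_0[OF that A[OF c that]])
  qed
  then obtain b where b: "\<And>p. p \<in> M \<Longrightarrow> N p + (- k) *\<^sub>R x p = b" by (auto simp: constant_on_def)
  show ?thesis
  proof (rule that[of "(- 1 / k) *\<^sub>R b"])
    fix p assume "p \<in> M"
    then show "N p = k *\<^sub>R (x p - (- 1 / k) *\<^sub>R b)"
      using b[of p] k by (simp add: scaleR_diff_right algebra_simps)
  qed
qed

lemma umbilic_isometric_to_round_sphere:
  assumes n: "CARD('n) \<ge> 2" and k: "k > 0" and N: "\<And>p. p \<in> M \<Longrightarrow> N p = k *\<^sub>R (x p - z)"
  shows "isometric_to_round_sphere M \<A> x"
  unfolding isometric_to_round_sphere_def
proof (intro exI conjI)
  show "bij_betw x M (sphere z (1 / k))"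
    using x_inj_on[OF k N n] x_image_eq_sphere[OF k N n] by (simp add: bij_betw_def)
  show "smooth_map \<A> x" using immersion_x by (simp add: immersion_def)
qed (use k in auto)

end

section \<open>Change of charts\<close>

text \<open>A and B are the matrices of one endomorphism in two charts with Jacobian J. Even the
  chosen enumerations of eigenvalues are equal, because the choice depends on the characteristic
  polynomial alone.\<close>

lemma intertwining_imp_conjugate:
  fixes A B J :: "real^'n^'n"
  assumes J: "det J \<noteq> 0" and JA: "J ** A = B ** J"
  shows "trace A = trace B" "eigenvalues A = eigenvalues B"
proof -
  have A: "A = matrix_inv J ** (B ** J)"
    using matrix_inv_left_right[OF J] by (simp add: JA[symmetric] matrix_mul_assoc)
  have "trace A = trace ((B ** J) ** matrix_inv J)" unfolding A by (rule trace_mul_sym)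
  also have "(B ** J) ** matrix_inv J = B"
    using matrix_inv_left_right[OF J] by (simp add: matrix_mul_assoc[symmetric])
  finally show "trace A = trace B" .
  have "J ** (mat t - A) = (mat t - B) ** J" for t
    by (simp add: matrix_diff_ldistrib matrix_diff_rdistrib JA mat_eq_scaleR_mat_1[of t]
        matrix_mult_scaleR_left matrix_mult_scaleR_right)
  then have "det J * det (mat t - A) = det (mat t - B) * det J" for t by (metis det_mul)
  then have "det (mat t - A) = det (mat t - B)" for t using J by simp
  then show "eigenvalues A = eigenvalues B" by (simp add: eigenvalues_def)
qed

lemma intertwining_newton_mat:
  fixes A B J :: "real^'n^'n"
  assumes J: "det J \<noteq> 0" and JA: "J ** A = B ** J"
  shows "J ** newton_mat A r = newton_mat B r ** J"
proof (induction r)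
  case (Suc r)
  have "sym_curv A (Suc r) = sym_curv B (Suc r)"
    using intertwining_imp_conjugate(2)[OF J JA] by (simp add: sym_curv_def)
  moreover have "J ** (A ** newton_mat A r) = B ** newton_mat B r ** J"
    using Suc JA by (metis matrix_mul_assoc)
  ultimately show ?case
    by (simp add: matrix_diff_ldistrib matrix_diff_rdistrib mat_eq_scaleR_mat_1[of "sym_curv B (Suc r)"]
        matrix_mult_scaleR_left matrix_mult_scaleR_right)
qed simp

text \<open>The two points of the first sphere on the line through both centres have distances
  \<bar>a - b\<bar> + r and \<bar>\<bar>a - b\<bar> - r\<bar> from the second centre, and these
  differ unless the centres agree.\<close>

lemma sphere_center_unique:
  fixes a b :: "'b::real_normed_vector"
  assumes eq: "sphere a r = sphere b s" and r: "r > 0"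
  shows "a = b"
proof (rule ccontr)
  assume "a \<noteq> b"
  then have n: "norm (a - b) > 0" by simp
  define u where "u = (1 / norm (a - b)) *\<^sub>R (a - b)"
  have u: "norm u = 1" "a - b = norm (a - b) *\<^sub>R u" using n by (simp_all add: u_def)
  have "a + r *\<^sub>R u \<in> sphere a r" "a - r *\<^sub>R u \<in> sphere a r" using u r by (simp_all add: dist_norm)
  then have "norm (a + r *\<^sub>R u - b) = s" "norm (a - r *\<^sub>R u - b) = s"
    unfolding eq by (simp_all add: dist_norm norm_minus_commute)
  moreover have "a + r *\<^sub>R u - b = (norm (a - b) + r) *\<^sub>R u"
  proof -
    have "a + r *\<^sub>R u - b = (a - b) + r *\<^sub>R u" by simp
    then show ?thesis unfolding scaleR_add_left u(2)[symmetric] .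
  qed
  moreover have "a - r *\<^sub>R u - b = (norm (a - b) - r) *\<^sub>R u"
  proof -
    have "a - r *\<^sub>R u - b = (a - b) - r *\<^sub>R u" by simp
    then show ?thesis unfolding scaleR_diff_left u(2)[symmetric] .
  qed
  ultimately show False using u(1) r n by auto
qed

lemma (in coord_chart) L_op_cong:
  assumes u: "\<And>q. q \<in> fst c \<Longrightarrow> u q = w q" and p: "p \<in> fst c"
  shows "L_op c x N r u p = L_op c x N r w p"
proof -
  have 1: "pd c j u q = pd c j w q" if "q \<in> fst c" for j q by (rule pd_cong[OF u that])
  have "pd c i (pd c j u) p = pd c i (pd c j w) p" for i j by (rule pd_cong[OF 1 p])
  then show ?thesis by (simp add: L_op_def hessian_operator_def hessian_form_def 1[OF p])
qed

lemma (in coord_chart) L_op_eq_0: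
  assumes u: "\<And>q i. q \<in> fst c \<Longrightarrow> pd c i u q = 0" and p: "p \<in> fst c"
  shows "L_op c x N r u p = 0"
proof -
  have "pd c i (pd c j u) p = pd c i (\<lambda>_. 0) p" for i j by (rule pd_cong[OF _ p]) (rule u)
  then have "hessian_form c x u p = 0" by (simp add: hessian_form_def u[OF p] pd_const vec_eq_iff)
  then show ?thesis by (simp add: L_op_def hessian_operator_def trace_def matrix_matrix_mult_def)
qed

context closed_hypersurface
begin

context
  fixes c d p assumes c: "c \<in> \<A>" and d: "d \<in> \<A>" and p: "p \<in> fst c \<inter> fst d"
begin

interpretation C: hypersurface_chart c x N by (rule hypersurface_chart[OF c])
interpretation D: hypersurface_chart d x N by (rule hypersurface_chart[OF d])

private abbreviation "J \<equiv> jac c d p"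

lemma det_jac: "det J \<noteq> 0"
  using volume_change[OF c d p] C.W_pos[of p] p by auto

text \<open>Expanded in the coordinate fields of d, the j-th columns of both sides represent the
  same vector, minus the j-th derivative of N in the chart c.\<close>

lemma shape_operator_change: "J ** shape_operator c x N p = shape_operator d x N p ** J"
proof -
  note ch = pd_chain[OF c d _ p]
  have pc: "p \<in> fst c" and pd: "p \<in> fst d" using p by auto
  have "(\<Sum>i\<in>UNIV. (J ** C.A p) $ i $ j *\<^sub>R D.X i p) = - pd c j N p" for j
    unfolding C.sum_A_X[OF pc, symmetric] ch[OF D.x_smooth] matrix_matrix_mult_def vec_lambda_beta
      scaleR_sum_left scaleR_sum_right
    by (subst sum.swap) (simp add: mult.commute)
  moreover have "(\<Sum>i\<in>UNIV. (D.A p ** J) $ i $ j *\<^sub>R D.X i p) = - pd c j N p" for j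
  proof -
    have "(\<Sum>i\<in>UNIV. (D.A p ** J) $ i $ j *\<^sub>R D.X i p) = (\<Sum>k\<in>UNIV. J $ k $ j *\<^sub>R (\<Sum>i\<in>UNIV. D.A p $ i $ k *\<^sub>R D.X i p))"
      unfolding matrix_matrix_mult_def vec_lambda_beta scaleR_sum_left scaleR_sum_right
      by (subst sum.swap) (simp add: mult.commute)
    then show ?thesis unfolding D.sum_A_X[OF pd] ch[OF D.N_smooth] by (simp add: sum_negf)
  qed
  ultimately have "(\<Sum>i\<in>UNIV. (\<chi> i. (J ** C.A p) $ i $ j - (D.A p ** J) $ i $ j) $ i *\<^sub>R D.X i p) = 0" for j
    by (simp add: scaleR_diff_left sum_subtractf)
  then have "(\<chi> i. (J ** C.A p) $ i $ j - (D.A p ** J) $ i $ j) = 0" for j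
    by (rule D.X_independent[OF pd])
  then show ?thesis by (simp add: vec_eq_iff)
qed

lemma newton_mat_change:
  "J ** newton_mat (shape_operator c x N p) r = newton_mat (shape_operator d x N p) r ** J"
  by (rule intertwining_newton_mat[OF det_jac shape_operator_change])

lemma trace_shape_operator_change:
  "trace (shape_operator c x N p) = trace (shape_operator d x N p)"
  "trace (shape_operator c x N p ** shape_operator c x N p) = trace (shape_operator d x N p ** shape_operator d x N p)"
proof -
  show "trace (C.A p) = trace (D.A p)"
    by (rule intertwining_imp_conjugate(1)[OF det_jac shape_operator_change])
  have "J ** (C.A p ** C.A p) = (D.A p ** D.A p) ** J"
    using shape_operator_change by (metis matrix_mul_assoc)
  then show "trace (C.A p ** C.A p) = trace (D.A p ** D.A p)"
    by (rule intertwining_imp_conjugate(1)[OF det_jac])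
qed

lemma pd_pairing_change:
  fixes u :: "'a \<Rightarrow> real"
  assumes "Ck_chart d 1 u"
  shows "(\<Sum>i\<in>UNIV. pd c i u p * v $ i) = (\<Sum>i\<in>UNIV. pd d i u p * (J *v v) $ i)"
  unfolding pd_chain[OF c d assms p] matrix_vector_mult_def vec_lambda_beta sum_distrib_left sum_distrib_right
  by (subst sum.swap) (simp add: mult_ac)

text \<open>The metric of c is J^T g J and the differential also transforms with J^T; cancelling the
  invertible matrix J^T g leaves the law for gradients.\<close>

lemma grad_change:
  assumes u: "Ck_chart d 1 u"
  shows "J *v C.grad u p = D.grad u p"
proof -
  have pc: "p \<in> fst c" and pd: "p \<in> fst d" using p by auto
  have "Finite_Cartesian_Product.transpose J *v (D.g p *v (J *v C.grad u p)) = C.g p *v C.grad u p"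
    unfolding metric_change[OF c d p] by (simp add: matrix_vector_mul_assoc matrix_mul_assoc)
  also have "\<dots> = (\<chi> k. pd c k u p)" by (rule C.g_grad[OF pc])
  also have "\<dots> = Finite_Cartesian_Product.transpose J *v (D.g p *v D.grad u p)"
    unfolding D.g_grad[OF pd] pd_chain[OF c d u p]
    by (simp add: vec_eq_iff matrix_vector_mult_def transpose_def)
  finally have e: "Finite_Cartesian_Product.transpose J *v (D.g p *v (J *v C.grad u p))
    = Finite_Cartesian_Product.transpose J *v (D.g p *v D.grad u p)" .
  have "det (Finite_Cartesian_Product.transpose J ** D.g p) \<noteq> 0"
    using det_jac D.det_g_pos[OF pd] by (simp add: det_mul)
  from matrix_inv_left_right(1)[OF this] e show ?thesis
    unfolding matrix_vector_mul_assoc[of "Finite_Cartesian_Product.transpose J"]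
    by (metis matrix_vector_mul_assoc matrix_vector_mul_lid)
qed

end

text \<open>\<open>\<delta>\<close> is the divergence of the field \<open>\<phi> P\<^sub>r(\<nabla>u) + \<phi>' P\<^sub>r'(\<nabla>u')\<close>.\<close>

lemma divergence_newton_grad_nonneg_eq_0:
  fixes \<phi> u \<phi>' u' \<delta> :: "'a \<Rightarrow> real"
  assumes smooth: "\<And>c. c \<in> \<A> \<Longrightarrow> Ck_chart c 1 \<phi> \<and> Ck_chart c 2 u \<and> Ck_chart c 1 \<phi>' \<and> Ck_chart c 2 u'"
    and r: "r \<le> CARD('n)" "r' \<le> CARD('n)"
    and \<delta>: "\<And>c p. c \<in> \<A> \<Longrightarrow> p \<in> fst c \<Longrightarrow> \<delta> p =
      (\<phi> p * L_op c x N r u p + (\<Sum>i\<in>UNIV. pd c i \<phi> p * (newton_mat (shape_operator c x N p) r *v hypersurface_chart.grad c x u p) $ i))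
      + (\<phi>' p * L_op c x N r' u' p + (\<Sum>i\<in>UNIV. pd c i \<phi>' p * (newton_mat (shape_operator c x N p) r' *v hypersurface_chart.grad c x u' p) $ i))"
    and nonneg: "\<And>p. p \<in> M \<Longrightarrow> 0 \<le> \<delta> p" and p0: "p0 \<in> M"
  shows "\<delta> p0 = 0"
proof -
  define F :: "('a \<Rightarrow> real) \<Rightarrow> nat \<Rightarrow> ('a \<Rightarrow> real) \<Rightarrow> ('a, 'n) chart \<Rightarrow> 'a \<Rightarrow> real^'n"
    where "F \<phi> r u c p = \<phi> p *\<^sub>R (newton_mat (shape_operator c x N p) r *v hypersurface_chart.grad c x u p)" for \<phi> r u c p
  have F_smooth: "Ck_chart c 1 (\<lambda>p. F \<phi> r u c p $ i)"
    if "c \<in> \<A>" "Ck_chart c 1 \<phi>" "Ck_chart c 2 u" for \<phi> r u c i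
  proof -
    interpret C: hypersurface_chart c x N by (rule hypersurface_chart[OF that(1)])
    have "Ck_chart c (Suc 1) u" using that(3) by (simp add: numeral_2_eq_2)
    then have "Ck_chart c 1 (\<lambda>p. \<phi> p * (\<Sum>j\<in>UNIV. C.P r p $ i $ j * C.grad u p $ j))"
      by (intro C.Ck_chart_mult that(2) C.Ck_chart_sum C.P_smooth C.grad_smooth)
    then show ?thesis by (simp add: F_def matrix_vector_mult_def)
  qed
  have F_change: "F \<phi> r u d p = jac c d p *v F \<phi> r u c p"
    if cd: "c \<in> \<A>" "d \<in> \<A>" "p \<in> fst c \<inter> fst d" and u: "Ck_chart d 2 u" for \<phi> r u c d p
  proof -
    have "Ck_chart d 1 u" using u by (rule Ck_chart_mono) simp
    from grad_change[OF cd this] show ?thesis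
      unfolding F_def matrix_vector_mult_scaleR
      by (simp add: matrix_vector_mul_assoc newton_mat_change[OF cd]) (simp flip: matrix_vector_mul_assoc)
  qed
  have v_smooth: "Ck_chart c 1 (\<lambda>p. (F \<phi> r u c p + F \<phi>' r' u' c p) $ i)" if "c \<in> \<A>" for c i
    using coord_chart.Ck_chart_add[OF coord_chart[OF that] F_smooth F_smooth] that smooth[OF that] by simp
  show ?thesis
  proof (rule divergence_nonneg_eq_0[OF v_smooth _ _ nonneg p0])
    show "F \<phi> r u d p + F \<phi>' r' u' d p = jac c d p *v (F \<phi> r u c p + F \<phi>' r' u' c p)"
      if cd: "c \<in> \<A>" "d \<in> \<A>" "p \<in> fst c \<inter> fst d" for c d p
      using smooth[OF cd(2)] by (simp add: F_change[OF cd] matrix_vector_right_distrib)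
    fix c p assume c: "c \<in> \<A>" and p: "p \<in> fst c"
    interpret C: hypersurface_chart c x N by (rule hypersurface_chart[OF c])
    have WF: "Ck_chart c 1 (\<lambda>q. C.W q * F \<phi> r u c q $ i)"
      if "Ck_chart c 1 \<phi>" "Ck_chart c 2 u" for \<phi> r u i
      by (intro C.Ck_chart_mult C.W_smooth F_smooth c that)
    have "(\<Sum>i\<in>UNIV. pd c i (\<lambda>q. C.W q * (F \<phi> r u c q + F \<phi>' r' u' c q) $ i) p)
      = (\<Sum>i\<in>UNIV. pd c i (\<lambda>q. C.W q * F \<phi> r u c q $ i) p)
        + (\<Sum>i\<in>UNIV. pd c i (\<lambda>q. C.W q * F \<phi>' r' u' c q $ i) p)"
      using smooth[OF c] by (simp add: distrib_left C.pd_add[OF p WF WF] sum.distrib)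
    also have "\<dots> = C.W p * \<delta> p"
      using smooth[OF c] unfolding F_def
      by (simp only: C.divergence_newton_grad[OF p] r \<delta>[OF c p] distrib_left)
    finally show "(\<Sum>i\<in>UNIV. pd c i (\<lambda>q. C.W q * (F \<phi> r u c q + F \<phi>' r' u' c q) $ i) p) = C.W p * \<delta> p" .
  qed
qed

end

section \<open>Rigidity\<close>

context closed_hypersurface
begin

text \<open>A selected chart turns the traces of the shape operator into functions on M, as
  \<open>zero_derivative_imp_constant\<close> and the divergence theorem require.
  \<open>H1_eq\<close> and \<open>scal_eq\<close> show that the selection does not matter.\<close>

definition chart_at :: "'a \<Rightarrow> ('a, 'n) chart" where
  "chart_at p = (SOME c. c \<in> \<A> \<and> p \<in> fst c)"

lemma chart_at: "c \<in> \<A> \<Longrightarrow> p \<in> fst c \<Longrightarrow> chart_at p \<in> \<A> \<and> p \<in> fst c \<inter> fst (chart_at p)"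
  unfolding chart_at_def by (rule someI2[of _ c]) auto

definition H1 :: "'a \<Rightarrow> real" where
  "H1 p = trace (shape_operator (chart_at p) x N p) / CARD('n)"

definition scal :: "'a \<Rightarrow> real" where
  "scal p = ((trace (shape_operator (chart_at p) x N p))\<^sup>2
      - trace (shape_operator (chart_at p) x N p ** shape_operator (chart_at p) x N p)) / (CARD('n) * (CARD('n) - 1))"

abbreviation "\<rho> \<equiv> support_function x N"

definition grad_term :: "nat \<Rightarrow> ('a, 'n) chart \<Rightarrow> ('a \<Rightarrow> real) \<Rightarrow> ('a \<Rightarrow> real) \<Rightarrow> 'a \<Rightarrow> real" where
  "grad_term r c \<phi> u p =
    (\<Sum>i\<in>UNIV. pd c i \<phi> p * (newton_mat (shape_operator c x N p) r *v hypersurface_chart.grad c x u p) $ i)"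

lemma grad_term_const: "grad_term r c (\<lambda>_. a) u p = 0"
  if "c \<in> \<A>" for c
  by (simp add: grad_term_def coord_chart.pd_const[OF coord_chart[OF that]])

lemma grad_term_chart_at:
  assumes c: "c \<in> \<A>" "p \<in> fst c" and u: "\<And>c. c \<in> \<A> \<Longrightarrow> Ck_chart c 1 \<phi>" "\<And>c. c \<in> \<A> \<Longrightarrow> Ck_chart c 1 u"
  shows "grad_term r (chart_at p) \<phi> u p = grad_term r c \<phi> u p"
proof -
  note cd = c(1) chart_at[OF c, THEN conjunct1] chart_at[OF c, THEN conjunct2]
  show ?thesis
    unfolding grad_term_def pd_pairing_change[OF cd u(1)[OF cd(2)]] matrix_vector_mul_assoc newton_mat_change[OF cd]
    unfolding matrix_vector_mul_assoc[symmetric] grad_change[OF cd u(2)[OF cd(2)]] ..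
qed

lemma H1_eq: "c \<in> \<A> \<Longrightarrow> p \<in> fst c \<Longrightarrow> trace (shape_operator c x N p) = CARD('n) * H1 p"
  using trace_shape_operator_change(1)[of c "chart_at p" p] chart_at[of c p] by (simp add: H1_def)

lemma H1_eq_mean_curvature:
  assumes "c \<in> \<A>" "p \<in> fst c"
  shows "mean_curvature c x N 1 p = H1 p"
  using H1_eq[OF assms] sym_curv_1[OF hypersurface_chart.A_diagonalizable[OF hypersurface_chart[OF assms(1)] assms(2)]]
  unfolding mean_curvature_1 by simp

lemma H1_smooth:
  assumes "c \<in> \<A>"
  shows "Ck_chart c k H1"
proof -
  interpret C: hypersurface_chart c x N by (rule hypersurface_chart[OF assms])
  have "Ck_chart c k (\<lambda>p. inverse (real CARD('n)) * (\<Sum>i\<in>UNIV. C.A p $ i $ i))"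
    by (intro C.Ck_chart_mult C.Ck_chart_const C.Ck_chart_sum C.A_smooth)
  then show ?thesis
    by (rule C.Ck_chart_cong[rotated]) (use H1_eq[OF assms] in \<open>simp add: trace_def field_simps\<close>)
qed

lemma L_op_mean_curvature:
  assumes "c \<in> \<A>" "p \<in> fst c"
  shows "L_op c x N r (mean_curvature c x N 1) p = L_op c x N r H1 p"
  using H1_eq_mean_curvature[OF assms(1)]
  by (rule coord_chart.L_op_cong[OF coord_chart[OF assms(1)] _ assms(2)])

definition half_norm_sq :: "'a \<Rightarrow> real" where "half_norm_sq p = (x p \<bullet> x p) / 2"

lemma half_norm_sq_smooth:
  assumes "c \<in> \<A>"
  shows "Ck_chart c k half_norm_sq"
proof -
  interpret C: hypersurface_chart c x N by (rule hypersurface_chart[OF assms])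
  have "Ck_chart c k (\<lambda>p. inverse 2 * (x p \<bullet> x p))"
    by (intro C.Ck_chart_mult C.Ck_chart_const C.Ck_chart_inner C.x_smooth)
  then show ?thesis by (simp add: half_norm_sq_def[abs_def] field_simps)
qed

section \<open>The integral arguments in both directions\<close>

context
  assumes n: "CARD('n) \<ge> 2"
begin

context
  fixes c p assumes c: "c \<in> \<A>" and p: "p \<in> fst c"
begin

interpretation C: hypersurface_chart c x N by (rule hypersurface_chart[OF c])

lemma scal_eq: "(trace (C.A p))\<^sup>2 - trace (C.A p ** C.A p) = CARD('n) * (CARD('n) - 1) * scal p"
  using trace_shape_operator_change[of c "chart_at p" p] chart_at[of c p] c p n
  by (simp add: scal_def of_nat_diff)

lemma L_op_half_norm_sq_0: "L_op c x N 0 half_norm_sq p = CARD('n) * (1 + \<rho> p * H1 p)"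
  unfolding half_norm_sq_def[abs_def] C.L_op_position_0[OF p] by (simp add: H1_eq[OF c p] algebra_simps)

lemma L_op_half_norm_sq_1: "L_op c x N 1 half_norm_sq p = CARD('n) * (CARD('n) - 1) * (H1 p + \<rho> p * scal p)"
  unfolding half_norm_sq_def[abs_def] C.L_op_position_1[OF p] scal_eq
  using n by (simp add: H1_eq[OF c p] algebra_simps of_nat_diff)

lemma umbilic_defect:
  "CARD('n) * (CARD('n) - 1) * ((H1 p)\<^sup>2 - scal p) = trace (C.A p ** C.A p) - (trace (C.A p))\<^sup>2 / CARD('n)"
proof -
  have "(trace (C.A p))\<^sup>2 / CARD('n) = CARD('n) * (H1 p)\<^sup>2"
    unfolding H1_eq[OF c p] by (simp add: power2_eq_square)
  moreover have "(trace (C.A p))\<^sup>2 = CARD('n) * CARD('n) * (H1 p)\<^sup>2"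
    unfolding H1_eq[OF c p] by (simp add: power2_eq_square)
  ultimately show ?thesis
    using scal_eq n by (simp add: algebra_simps of_nat_diff)
qed

lemma scal_le: "scal p \<le> (H1 p)\<^sup>2"
proof -
  have "0 \<le> CARD('n) * (CARD('n) - 1) * ((H1 p)\<^sup>2 - scal p)"
    unfolding umbilic_defect using trace_square_ge(1)[OF C.A_diagonalizable[OF p]]
    by (simp add: field_simps)
  moreover have "0 < real CARD('n) * (real CARD('n) - 1)" using n by simp
  ultimately show ?thesis using n by (simp add: zero_le_mult_iff)
qed

lemma scal_eq_imp_umbilic:
  assumes "scal p = (H1 p)\<^sup>2"
  shows "C.A p = mat (H1 p)"
proof -
  have "(trace (C.A p))\<^sup>2 = CARD('n) * trace (C.A p ** C.A p)"
    using umbilic_defect assms by (simp add: field_simps)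
  from trace_square_ge(2)[OF C.A_diagonalizable[OF p] this]
  show ?thesis by (simp add: H1_eq[OF c p])
qed

end

text \<open>The second field has the constant weight \<open>a\<close>, so its gradient term drops
  out. This covers all three uses of the divergence theorem.\<close>

lemma newton_field_divergence_eq_0:
  assumes smooth: "\<And>c. c \<in> \<A> \<Longrightarrow> Ck_chart c 1 \<phi> \<and> Ck_chart c 2 u"
    and r: "r \<le> CARD('n)" "r' \<le> 1"
    and \<delta>: "\<And>c p. c \<in> \<A> \<Longrightarrow> p \<in> fst c \<Longrightarrow>
      \<delta> p = \<phi> p * L_op c x N r u p + grad_term r c \<phi> u p + a * L_op c x N r' half_norm_sq p"
    and "\<And>p. p \<in> M \<Longrightarrow> 0 \<le> \<delta> p" "p0 \<in> M"
  shows "\<delta> p0 = 0"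
proof (rule divergence_newton_grad_nonneg_eq_0[of \<phi> u "\<lambda>_. a" half_norm_sq r r' \<delta>])
  show "Ck_chart c 1 \<phi> \<and> Ck_chart c 2 u \<and> Ck_chart c 1 (\<lambda>_. a) \<and> Ck_chart c 2 half_norm_sq" if "c \<in> \<A>" for c
    using smooth[OF that] half_norm_sq_smooth[OF that] coord_chart.Ck_chart_const[OF coord_chart[OF that]] by simp
  show "r' \<le> CARD('n)" using r(2) n by simp
  show "\<delta> p = \<phi> p * L_op c x N r u p + (\<Sum>i\<in>UNIV. pd c i \<phi> p * (newton_mat (shape_operator c x N p) r *v hypersurface_chart.grad c x u p) $ i)
      + (a * L_op c x N r' half_norm_sq p + (\<Sum>i\<in>UNIV. pd c i (\<lambda>_. a) p * (newton_mat (shape_operator c x N p) r' *v hypersurface_chart.grad c x half_norm_sq p) $ i))"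
    if "c \<in> \<A>" "p \<in> fst c" for c p
    using \<delta>[OF that] grad_term_const[OF that(1), of r' a half_norm_sq p] by (simp add: grad_term_def)
qed (use assms in auto)

text \<open>The field \<open>H P\<^sub>r(\<nabla>H) - P\<^sub>1(\<nabla>\<bar>x\<bar>\<^sup>2/2) / (n (n - 1))\<close> has the divergence
  \<open>\<langle>P\<^sub>r(\<nabla>H), \<nabla>H\<rangle> + \<rho> (H\<^sup>2 - scal)\<close>, in which both summands are non-negative.\<close>

lemma constant_mean_curvature_umbilic:
  assumes rho: "\<And>p. p \<in> M \<Longrightarrow> 0 \<le> \<rho> p" and r: "r \<le> CARD('n)"
    and pos: "newton_positive_definite \<A> x N r"
    and eq: "\<And>c p. c \<in> \<A> \<Longrightarrow> p \<in> fst c \<Longrightarrow> L_op c x N r H1 p = 1 + H1 p * \<rho> p"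
  shows "\<exists>k>0. (\<forall>c\<in>\<A>. \<forall>p\<in>fst c. shape_operator c x N p = mat (- k)) \<and> (\<forall>p\<in>M. \<rho> p = 1 / k)"
proof -
  define \<delta> where "\<delta> p = grad_term r (chart_at p) H1 H1 p + \<rho> p * ((H1 p)\<^sup>2 - scal p)" for p
  \<comment> \<open>With this factor the second field has divergence -(H1 + rho scal), whose first
    term cancels the H1 in H1 (1 + H1 rho).\<close>
  define a where "a = - 1 / (real CARD('n) * (real CARD('n) - 1))"
  have gt_eq: "grad_term r (chart_at p) H1 H1 p = grad_term r c H1 H1 p" if "c \<in> \<A>" "p \<in> fst c" for c p
    using grad_term_chart_at[OF that, of H1 H1 r] H1_smooth by simp
  have gt_pos: "0 \<le> grad_term r c H1 H1 p"
    and gt_0: "grad_term r c H1 H1 p = 0 \<Longrightarrow> pd c i H1 p = 0"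
    if c: "c \<in> \<A>" "p \<in> fst c" for c p i
  proof -
    interpret C: hypersurface_chart c x N by (rule hypersurface_chart[OF c(1)])
    \<comment> \<open>The gradient term becomes the quadratic form of P_r in the metric, which is
      what \<open>newton_positive_definite\<close> controls.\<close>
    have e: "grad_term r c H1 H1 p = (newton c x N r p *v C.grad H1 p) \<bullet> (C.g p *v C.grad H1 p)"
      by (simp add: grad_term_def C.inner_grad_pos[OF c(2)] newton_eq_newton_mat)
    have "0 < grad_term r c H1 H1 p" if "C.grad H1 p \<noteq> 0"
      unfolding e using pos c that by (auto simp: newton_positive_definite_def)
    then show "0 \<le> grad_term r c H1 H1 p" "grad_term r c H1 H1 p = 0 \<Longrightarrow> pd c i H1 p = 0"
      using e C.grad_eq_0_iff[OF c(2), of H1] by (cases "C.grad H1 p = 0"; auto)+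
  qed
  have summands: "0 \<le> grad_term r (chart_at p) H1 H1 p" "0 \<le> \<rho> p * ((H1 p)\<^sup>2 - scal p)" if pM: "p \<in> M" for p
  proof -
    obtain c where c: "c \<in> \<A>" "p \<in> fst c" using ex_chart pM by blast
    show "0 \<le> grad_term r (chart_at p) H1 H1 p" using gt_pos[OF c] gt_eq[OF c] by simp
    show "0 \<le> \<rho> p * ((H1 p)\<^sup>2 - scal p)" using rho[OF pM] scal_le[OF c] by simp
  qed
  have \<delta>0: "\<delta> p = 0" if "p \<in> M" for p
  proof (rule newton_field_divergence_eq_0[of H1 H1 r 1 \<delta> a])
    show "\<delta> p = H1 p * L_op c x N r H1 p + grad_term r c H1 H1 p + a * L_op c x N 1 half_norm_sq p"
      if c: "c \<in> \<A>" "p \<in> fst c" for c p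
    proof -
      have "a * L_op c x N 1 half_norm_sq p = - (H1 p + \<rho> p * scal p)"
        unfolding L_op_half_norm_sq_1[OF c] a_def using n by (simp add: field_simps of_nat_diff)
      then show ?thesis unfolding eq[OF c] \<delta>_def gt_eq[OF c] by (simp add: algebra_simps power2_eq_square)
    qed
  qed (use that H1_smooth r summands in \<open>auto simp: \<delta>_def\<close>)
  have gt0: "grad_term r (chart_at p) H1 H1 p = 0" and um: "\<rho> p * ((H1 p)\<^sup>2 - scal p) = 0" if "p \<in> M" for p
    using \<delta>0[OF that] summands[OF that] unfolding \<delta>_def by linarith+
  have dH: "pd c i H1 p = 0" if "c \<in> \<A>" "p \<in> fst c" for c p i
    using gt_0[OF that] gt0[of p] gt_eq[OF that] dom_subset[OF that(1)] that(2) by auto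
  have rho_H: "1 + H1 p * \<rho> p = 0" if pM: "p \<in> M" for p
  proof -
    obtain c where c: "c \<in> \<A>" "p \<in> fst c" using ex_chart pM by blast
    show ?thesis
      using coord_chart.L_op_eq_0[OF coord_chart[OF c(1)] _ c(2)] dH[OF c(1)] eq[OF c] by metis
  qed
  have "H1 constant_on M"
    by (rule zero_derivative_imp_constant) (use H1_smooth dH in auto)
  then obtain h where h: "\<And>p. p \<in> M \<Longrightarrow> H1 p = h" by (auto simp: constant_on_def)
  have rho_pos: "0 < \<rho> p" if "p \<in> M" for p
    using rho_H[OF that] rho[OF that] by (cases "\<rho> p = 0") auto
  obtain p0 where p0: "p0 \<in> M" using M_ne by blast
  have "h * \<rho> p0 < 0" using rho_H[OF p0] h[OF p0] by simp
  then have h_neg: "h < 0" using rho_pos[OF p0] by (simp add: mult_less_0_iff)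
  show ?thesis
  proof (intro exI[of _ "- h"] conjI ballI)
    show "shape_operator c x N p = mat (- (- h))" if c: "c \<in> \<A>" "p \<in> fst c" for c p
    proof -
      have pM: "p \<in> M" using dom_subset[OF c(1)] c(2) by blast
      have "scal p = (H1 p)\<^sup>2" using um[OF pM] rho_pos[OF pM] by simp
      from scal_eq_imp_umbilic[OF c this] show ?thesis by (simp add: h[OF pM])
    qed
    show "\<rho> p = 1 / - h" if "p \<in> M" for p
      using rho_H[OF that] h_neg h[OF that] by (simp add: field_simps)
  qed (use h_neg in simp)
qed

text \<open>The isometry f is itself an immersed hypersurface with the metric of x, normal (f - z) /
  R and shape operator -1/R. As the contracted Gauss equation involves the metric only,
  \<open>scal\<close> may be computed with f instead of x.\<close>

lemma isometric_to_round_sphere_scal: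
  fixes f :: "'a \<Rightarrow> real^'m"
  assumes R: "R > 0" and f: "f ` M \<subseteq> sphere z R" "smooth_map \<A> f"
    and m: "\<And>c p. c \<in> \<A> \<Longrightarrow> p \<in> fst c \<Longrightarrow> metric c f p = metric c x p" and pM: "p \<in> M"
  shows "scal p = 1 / R\<^sup>2"
proof -
  obtain c where c: "c \<in> \<A>" "p \<in> fst c" using ex_chart pM by blast
  interpret C: hypersurface_chart c x N by (rule hypersurface_chart[OF c(1)])
  have f_smooth: "Ck_chart c k f" for k
    using f(2) c(1) by (auto simp: smooth_map_def smooth_on_def Ck_chart_def)
  have fd: "Ck_chart c k (\<lambda>q. f q - z)" for k by (intro C.Ck_chart_diff f_smooth C.Ck_chart_const)
  have fR: "norm (f q - z) = R" if "q \<in> fst c" for q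
  proof -
    have "f q \<in> sphere z R" using f(1) dom_subset[OF c(1)] that by blast
    then show ?thesis by (simp add: dist_norm norm_minus_commute)
  qed
  have "hypersurface_chart c f (\<lambda>q. (1 / R) *\<^sub>R (f q - z))"
  proof
    show "Ck_chart c k f" "Ck_chart c k (\<lambda>q. (1 / R) *\<^sub>R (f q - z))" for k
      by (intro C.Ck_chart_scaleR C.Ck_chart_const f_smooth fd)+
    fix q assume q: "q \<in> fst c"
    show "norm ((1 / R) *\<^sub>R (f q - z)) = 1" using fR[OF q] R by simp
    show "(1 / R) *\<^sub>R (f q - z) \<bullet> pd c i f q = 0" for i
    proof -
      have "pd c i (\<lambda>q. (f q - z) \<bullet> (f q - z)) q = pd c i (\<lambda>_. R\<^sup>2) q"
        by (rule C.pd_cong[OF _ q]) (simp add: fR dot_square_norm)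
      then show ?thesis
        by (simp add: C.pd_inner[OF q fd fd] C.pd_diff[OF q f_smooth C.Ck_chart_const] C.pd_const inner_commute)
    qed
    have D: "frechet_derivative (f \<circ> param c) (at (snd c q)) v = (\<Sum>i\<in>UNIV. v $ i *\<^sub>R pd c i f q)" for v
      by (rule C.frechet_derivative_eq_sum_pd[OF f_smooth q])
    have "linear (frechet_derivative (f \<circ> param c) (at (snd c q)))"
      using has_derivative_linear[OF C.has_derivative_chart[OF f_smooth q]] .
    \<comment> \<open>Injectivity of the derivative of f is inherited from x, because both have the
      same positive definite metric.\<close>
    moreover have "v = 0" if "frechet_derivative (f \<circ> param c) (at (snd c q)) v = 0" for v
    proof -
      have "v \<bullet> (metric c f q *v v) = 0" using that unfolding D inner_metric by simp
      then show ?thesis using C.g_pos[OF q, of v] unfolding m[OF c(1) q] by force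
    qed
    ultimately show "inj (frechet_derivative (f \<circ> param c) (at (snd c q)))"
      by (simp add: linear_injective_0)
  qed (rule C.open_image C.inj_coord C.card_m)+
  then interpret F: hypersurface_chart c f "\<lambda>q. (1 / R) *\<^sub>R (f q - z)" .
  have FA: "F.A p = mat (- (1 / R))" by (rule F.spherical_shape_operator[OF c(2) refl])
  have "CARD('n) * (CARD('n) - 1) * scal p = (trace (C.A p))\<^sup>2 - trace (C.A p ** C.A p)"
    by (rule scal_eq[OF c, symmetric])
  also have "\<dots> = (trace (F.A p))\<^sup>2 - trace (F.A p ** F.A p)"
    unfolding F.trace_gauss_equation[OF c(2)] C.trace_gauss_equation[OF c(2)]
    using C.riemann_form_cong[of f x p, OF m[OF c(1)] c(2)] m[OF c] by simp
  also have "F.A p ** F.A p = mat (1 / R\<^sup>2)"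
  proof -
    have "mat a ** mat a = a *\<^sub>R (mat a :: real^'n^'n)" for a
      unfolding mat_eq_scaleR_mat_1[of a] matrix_mult_scaleR_left by simp
    then show ?thesis by (simp add: FA mat_def vec_eq_iff power2_eq_square)
  qed
  also have "(trace (F.A p))\<^sup>2 - trace (mat (1 / R\<^sup>2) :: real^'n^'n) = CARD('n) * (CARD('n) - 1) * (1 / R\<^sup>2)"
    using n R unfolding FA by (simp add: trace_def mat_def of_nat_diff power2_eq_square field_simps)
  finally show ?thesis using n unfolding mult_cancel_left by simp
qed

text \<open>Here \<open>H\<^sup>2 \<ge> k\<^sup>2\<close>.  If \<open>H\<close> were positive, \<open>\<nabla>\<bar>x\<bar>\<^sup>2/2\<close> would have the positive divergence
  \<open>n (1 + \<rho> H)\<close>; otherwise \<open>- P\<^sub>1(\<nabla>\<bar>x\<bar>\<^sup>2/2) / (n (n - 1)) - (k / n) \<nabla>\<bar>x\<bar>\<^sup>2/2\<close> has the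
  non-negative divergence \<open>(- H - k) (1 + k \<rho>)\<close>.\<close>

lemma constant_scal_umbilic:
  assumes rho: "\<And>p. p \<in> M \<Longrightarrow> 0 \<le> \<rho> p" and k: "k > 0" and s: "\<And>p. p \<in> M \<Longrightarrow> scal p = k\<^sup>2"
    and c: "c \<in> \<A>" "p \<in> fst c"
  shows "shape_operator c x N p = mat (- k)"
proof -
  have kH: "k\<^sup>2 \<le> (H1 p)\<^sup>2" if pM: "p \<in> M" for p
  proof -
    obtain c where c: "c \<in> \<A>" "p \<in> fst c" using ex_chart pM by blast
    show ?thesis using scal_le[OF c] s[OF pM] by simp
  qed
  have H0: "H1 p \<noteq> 0" if "p \<in> M" for p using kH[OF that] k by auto
  have "continuous_on M H1" using H1_smooth by (intro continuous_on_M)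
  then have conn: "connected (H1 ` M)" using connected_M by (intro connected_continuous_image)
  have smooth: "Ck_chart c 1 (\<lambda>_. a) \<and> Ck_chart c 2 half_norm_sq" if "c \<in> \<A>" for a :: real and c
    using half_norm_sq_smooth[OF that] coord_chart.Ck_chart_const[OF coord_chart[OF that]] by simp
  have neg: "H1 p < 0" if pM: "p \<in> M" for p
  proof (rule ccontr)
    assume "\<not> H1 p < 0"
    \<comment> \<open>H never vanishes, so by connectedness its sign at one point is its sign
      everywhere.\<close>
    have pos: "0 < H1 p'" if "p' \<in> M" for p'
    proof (rule ccontr)
      assume "\<not> 0 < H1 p'"
      then have "0 \<in> H1 ` M"
        using connectedD_interval[OF conn, of "H1 p'" "H1 p" 0] \<open>\<not> H1 p < 0\<close> pM that by auto
      then show False using H0 by auto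
    qed
    define \<delta> where "\<delta> p = CARD('n) * (1 + \<rho> p * H1 p)" for p
    have "\<delta> p = 0"
    proof (rule newton_field_divergence_eq_0[of "\<lambda>_. 1" half_norm_sq 0 0 \<delta> 0])
      show "\<delta> p = 1 * L_op c x N 0 half_norm_sq p + grad_term 0 c (\<lambda>_. 1) half_norm_sq p + 0 * L_op c x N 0 half_norm_sq p"
        if "c \<in> \<A>" "p \<in> fst c" for c p
        by (simp add: L_op_half_norm_sq_0[OF that] grad_term_const[OF that(1)] \<delta>_def)
      show "0 \<le> \<delta> p" if "p \<in> M" for p
        unfolding \<delta>_def using rho[OF that] pos[OF that]
        by (intro mult_nonneg_nonneg add_nonneg_nonneg) auto
    qed (use smooth pM in auto)
    moreover have "0 \<le> \<rho> p * H1 p" using rho[OF pM] pos[OF pM] by simp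
    ultimately show False by (simp add: \<delta>_def)
  qed
  have kH': "k \<le> - H1 p" if "p \<in> M" for p
  proof (rule power2_le_imp_le)
    show "k\<^sup>2 \<le> (- H1 p)\<^sup>2" using kH[OF that] by simp
    show "0 \<le> - H1 p" using neg[OF that] by simp
  qed
  define \<delta> where "\<delta> p = (- H1 p - k) * (1 + k * \<rho> p)" for p
  have pM: "p \<in> M" using dom_subset[OF c(1)] c(2) by blast
  \<comment> \<open>Since scal = k^2, the two fields have divergences -(H + k^2 rho) and -k (1 + H
    rho), and the sum factors as stated in the definition of \<open>\<delta>\<close>.\<close>
  define a where "a = - 1 / (real CARD('n) * (real CARD('n) - 1))"
  have "\<delta> p = 0"
  proof (rule newton_field_divergence_eq_0[of "\<lambda>_. a" half_norm_sq 1 0 \<delta> "- k / CARD('n)"])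
    show "\<delta> p = a * L_op c x N 1 half_norm_sq p + grad_term 1 c (\<lambda>_. a) half_norm_sq p + - k / CARD('n) * L_op c x N 0 half_norm_sq p"
      if c: "c \<in> \<A>" "p \<in> fst c" for c p
    proof -
      have "p \<in> M" using dom_subset[OF c(1)] c(2) by blast
      moreover have "a * L_op c x N 1 half_norm_sq p = - (H1 p + \<rho> p * scal p)"
        unfolding L_op_half_norm_sq_1[OF c] a_def using n by (simp add: field_simps of_nat_diff)
      ultimately show ?thesis using s[of p]
        by (simp add: L_op_half_norm_sq_0[OF c] grad_term_const[OF c(1)] \<delta>_def algebra_simps power2_eq_square)
    qed
    show "0 \<le> \<delta> p" if "p \<in> M" for p
      unfolding \<delta>_def using kH'[OF that] rho[OF that] k by (intro mult_nonneg_nonneg add_nonneg_nonneg) auto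
  qed (use smooth pM n in auto)
  moreover have "1 + k * \<rho> p > 0" using rho[OF pM] k by (simp add: add_pos_nonneg)
  ultimately have "H1 p = - k" by (simp add: \<delta>_def)
  then show ?thesis using scal_eq_imp_umbilic[OF c] s[OF pM] by simp
qed

lemma umbilic_round_sphere:
  assumes k: "k > 0" and A: "\<forall>c\<in>\<A>. \<forall>p\<in>fst c. shape_operator c x N p = mat (- k)"
  shows "\<exists>z. (\<forall>p\<in>M. N p = k *\<^sub>R (x p - z)) \<and> x ` M = sphere z (1 / k) \<and> isometric_to_round_sphere M \<A> x"
proof (rule umbilic_imp_sphere[OF k])
  show "shape_operator c x N p = mat (- k)" if "c \<in> \<A>" "p \<in> fst c" for c p using A that by blast
  show ?thesis if z: "\<And>p. p \<in> M \<Longrightarrow> N p = k *\<^sub>R (x p - z)" for z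
    using z x_image_eq_sphere[OF k z n] umbilic_isometric_to_round_sphere[OF n k z] by (intro exI conjI ballI)
qed

lemma mean_curvature_equation_imp_round_sphere:
  assumes rho: "\<And>p. p \<in> M \<Longrightarrow> 0 \<le> \<rho> p" and r: "r \<le> CARD('n)"
    and pos: "newton_positive_definite \<A> x N r"
    and eq: "\<And>c p. c \<in> \<A> \<Longrightarrow> p \<in> fst c \<Longrightarrow> L_op c x N r H1 p = 1 + H1 p * \<rho> p"
  shows "isometric_to_round_sphere M \<A> x \<and> (\<forall>z R. x ` M = sphere z R \<longrightarrow> z = 0)"
proof -
  have "\<exists>k>0. (\<forall>c\<in>\<A>. \<forall>p\<in>fst c. shape_operator c x N p = mat (- k)) \<and> (\<forall>p\<in>M. \<rho> p = 1 / k)"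
    by (rule constant_mean_curvature_umbilic[OF assms])
  then obtain k where k: "k > 0" "\<forall>c\<in>\<A>. \<forall>p\<in>fst c. shape_operator c x N p = mat (- k)"
    and rho_k: "\<forall>p\<in>M. \<rho> p = 1 / k"
    by (elim exE conjE)
  obtain z where z: "\<forall>p\<in>M. N p = k *\<^sub>R (x p - z)" "x ` M = sphere z (1 / k)"
    and iso: "isometric_to_round_sphere M \<A> x"
    using umbilic_round_sphere[OF k(1,2)] by (elim exE conjE)
  have "z = 0"
  proof (rule ccontr)
    assume z0: "z \<noteq> 0"
    \<comment> \<open>The point of the sphere farthest from the origin: its normal is z /
      \<bar>z\<bar>, so rho there is \<bar>z\<bar> + 1/k, more than the constant value 1/k.\<close>
    have "z + (1 / (k * norm z)) *\<^sub>R z \<in> sphere z (1 / k)"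
      using z0 k(1) by (simp add: dist_norm)
    then obtain p where p: "p \<in> M" "x p = z + (1 / (k * norm z)) *\<^sub>R z" using z(2) by (metis imageE)
    have "\<rho> p = (z + (1 / (k * norm z)) *\<^sub>R z) \<bullet> ((1 / norm z) *\<^sub>R z)"
      using k(1) by (simp add: support_function_def z(1)[THEN bspec, OF p(1)] p(2))
    also have "\<dots> = norm z + 1 / k"
      using z0 k(1) by (simp add: inner_add_left dot_square_norm field_simps power2_eq_square)
    finally show False using rho_k p(1) z0 by simp
  qed
  then have "z' = 0" if "x ` M = sphere z' R" for z' R
    using sphere_center_unique[of z "1 / k" z' R] z(2) that k(1) by simp
  with iso show ?thesis by blast
qed

text \<open>Rigidity makes the image of x a round sphere, and the hypothesis on the centre places it
  at the origin. Then H = -k is constant and rho = 1/k, so both sides of the equation are 0.\<close>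

lemma round_sphere_imp_mean_curvature_equation:
  assumes rho: "\<And>p. p \<in> M \<Longrightarrow> 0 \<le> \<rho> p"
    and iso: "isometric_to_round_sphere M \<A> x" and center: "\<And>z R. x ` M = sphere z R \<Longrightarrow> z = 0"
    and c: "c \<in> \<A>" "p \<in> fst c"
  shows "L_op c x N r H1 p = 1 + H1 p * \<rho> p"
proof -
  obtain f :: "'a \<Rightarrow> real^'m" and z R where f: "R > 0" "bij_betw f M (sphere z R)" "smooth_map \<A> f"
    "\<And>c p. c \<in> \<A> \<Longrightarrow> p \<in> fst c \<Longrightarrow> metric c f p = metric c x p"
    using iso unfolding isometric_to_round_sphere_def by blast
  define k where "k = 1 / R"
  have k: "k > 0" using f(1) by (simp add: k_def)
  have "f ` M \<subseteq> sphere z R" using f(2) by (simp add: bij_betw_def)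
  from isometric_to_round_sphere_scal[OF f(1) this f(3,4)]
  have s: "scal p = k\<^sup>2" if "p \<in> M" for p using that by (simp add: k_def power_one_over)
  have A: "\<forall>c\<in>\<A>. \<forall>p\<in>fst c. shape_operator c x N p = mat (- k)"
    by (intro ballI constant_scal_umbilic[OF rho k s])
  obtain z where z: "\<forall>p\<in>M. N p = k *\<^sub>R (x p - z)" "x ` M = sphere z (1 / k)"
    "isometric_to_round_sphere M \<A> x"
    using umbilic_round_sphere[OF k A] by (elim exE conjE)
  have pM: "p \<in> M" using dom_subset[OF c(1)] c(2) by blast
  have z0: "z = 0" using center[OF z(2)] .
  have "x p \<in> sphere 0 (1 / k)" using z(2) z0 pM by blast
  then have "\<rho> p = 1 / k"
    using k by (simp add: support_function_def z(1)[THEN bspec, OF pM] z0 dot_square_norm power2_eq_square)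
  moreover have H: "H1 q = - k" if "q \<in> fst c" for q
  proof -
    have "CARD('n) * H1 q = CARD('n) * (- k)"
      using H1_eq[OF c(1) that] unfolding A[THEN bspec, OF c(1), THEN bspec, OF that] by (simp add: trace_def mat_def)
    then show ?thesis unfolding mult_cancel_left by simp
  qed
  moreover have "L_op c x N r H1 p = 0"
  proof (rule coord_chart.L_op_eq_0[OF coord_chart[OF c(1)] _ c(2)])
    interpret C: coord_chart c by (rule coord_chart[OF c(1)])
    show "pd c i H1 q = 0" if "q \<in> fst c" for q i
      using C.pd_cong[of H1 "\<lambda>_. - k", OF H that] by (simp add: C.pd_const)
  qed
  ultimately show ?thesis using k c(2) by simp
qed

end

end

theorem theorem1p1:
  fixes M :: "'a::t2_space set"
    and \<A> :: "('a, 'n::finite) chart set"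
    and x N :: "'a \<Rightarrow> real ^ 'm::finite"
    and r :: nat
  assumes "CARD('n) \<ge> 2" and "CARD('m) = CARD('n) + 1"
    and "closed_manifold M \<A>"
    and "immersion \<A> x"
    and "unit_normal_field \<A> x N"
    and "\<forall>p\<in>M. support_function x N p \<ge> 0"
    and "r \<le> CARD('n)"
    and "newton_positive_definite \<A> x N r"
  shows "(\<forall>c\<in>\<A>. \<forall>p\<in>fst c.
            L_op c x N r (mean_curvature c x N 1) p
              = 1 + mean_curvature c x N 1 p * support_function x N p)
         \<longleftrightarrow> isometric_to_round_sphere M \<A> x \<and> (\<forall>z R. x ` M = sphere z R \<longrightarrow> z = 0)"
proof -
  interpret closed_hypersurface M \<A> x N by unfold_locales (use assms in auto)
  have rho: "0 \<le> support_function x N p" if "p \<in> M" for p using assms(6) that by blast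
  \<comment> \<open>On the domain of each chart the chart expression for the mean curvature agrees
    with the global function \<open>H1\<close>, and L_r depends only on the values there.\<close>
  have "(\<forall>c\<in>\<A>. \<forall>p\<in>fst c. L_op c x N r (mean_curvature c x N 1) p
      = 1 + mean_curvature c x N 1 p * support_function x N p)
    \<longleftrightarrow> (\<forall>c\<in>\<A>. \<forall>p\<in>fst c. L_op c x N r H1 p = 1 + H1 p * support_function x N p)"
    using L_op_mean_curvature H1_eq_mean_curvature by (metis (no_types, lifting))
  also have "\<dots> \<longleftrightarrow> isometric_to_round_sphere M \<A> x \<and> (\<forall>z R. x ` M = sphere z R \<longrightarrow> z = 0)"
    using mean_curvature_equation_imp_round_sphere[OF assms(1) rho assms(7,8)]
      round_sphere_imp_mean_curvature_equation[OF assms(1) rho] by blast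
  finally show ?thesis .
qed

end
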